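(* Let $m\in\{1,2,4,8\}$ and let $V$ be the representation of dimension $n=3m+3$ of the corresponding Lie algebra $\mathfrak g$ in the $e_6$ series, with dual (conjugate) representation $\bar V$. On $V\otimes\bar V$ let $$P_1=\frac{m+2}{m+4}\Big(\mathbf 1-\frac1{m+1}D+2B\Big),\qquad P_2=\frac{2}{m+4}\Big(\mathbf 1+\frac13D-(m+2)B\Big),\qquad P_3=\frac1{3m+3}D,$$ and let $\check R_{V\bar V}(u):V\otimes\bar V\to\bar V\otimes V$ be $$\mathbf P\Big(P_1+\frac{u+m+4}{u-m-4}P_2+\frac{u+m+4}{u-m-4}\,\frac{u+3m}{u-3m}P_3\Big),$$ which, after multiplication by the scalar $\frac{u-m-4}{u-m}$, is $$\mathbf P\Big(\mathbf 1-\frac{4(m+2)}{u-m}\,B+\frac{4}{u-3m}\,D\Big).$$ Let $\check R_{VV}(u)=4\,\mathbf 1-u\,P+\frac{(4m+8)u}{2m-u}K$ on $V\otimes V$. Then $\check R_{V\bar V}$ and $\check R_{VV}$ together solve the Yang–Baxter equation on $V\otimes V\otimes\bar V$: as maps $V\otimes V\otimes\bar V\to\bar V\otimes V\otimes V$, rational in $u,v$, $$(\check R_{V\bar V}(u)\otimes1)(1\otimes\check R_{V\bar V}(u+v))(\check R_{VV}(v)\otimes1)=(1\otimes\check R_{VV}(v))(\check R_{V\bar V}(u+v)\otimes1)(1\otimes\check R_{V\bar V}(u)).$$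
   Context: Work over $\mathbb{C}$, with repeated indices summed. The $e_6$ series consists of the following pairs $(\mathfrak g,V)$ with $\dim V=n=3m+3$: $m=1$: $\mathfrak g=a_2$, $V=\mathrm{Sym}^2\mathbb{C}^3$; $m=2$: $\mathfrak g=a_2\times a_2$, $V=\mathbb{C}^3\otimes\mathbb{C}^3$; $m=4$: $\mathfrak g=a_5$, $V=\Lambda^2\mathbb{C}^6$; $m=8$: $\mathfrak g=e_6$, $V$ the $27$-dimensional irreducible representation. In each case the spaces of $\mathfrak g$-invariants in $\mathrm{Sym}^3(V^* )$ and $\mathrm{Sym}^3(V)$ are one-dimensional; $d_{abc}$ and $d^{abc}$ denote the components, in a basis $(e_a)$ of $V$ and its dual basis $(e^a)$ of $\bar V=V^*$, of spanning elements, scaled so that $d^{acd}d_{bcd}=\delta^a_b$. On $V\otimes V$ (operators $X$ with components $X^{ab}_{cd}$, upper indices output, lower input): $\mathbf 1^{ab}_{cd}=\delta^a_c\delta^b_d$, $P^{ab}_{cd}=\delta^a_d\delta^b_c$, $K^{ab}_{cd}=d^{abe}d_{ecd}$. On $V\otimes\bar V$: $\mathbf 1$ is the identity, $$D(e_c\otimes e^d)=\delta_c^d\,e_a\otimes e^a,\qquad B(e_c\otimes e^d)=d^{ade}d_{ecb}\,e_a\otimes e^b .$$ $\mathbf P:V\otimes\bar V\to\bar V\otimes V$ is the flip $x\otimes y\mapsto y\otimes x$. The operators $P_1,P_2,P_3$ are the projectors of $V\otimes\bar V$ onto, respectively, the component whose highest weight is the sum of those of $V$ and $\bar V$, the adjoint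 representation $\mathfrak g$, and the trivial representation (for $m=2$, $\mathfrak g=a_2\times a_2$ and the first two are the corresponding $\mathfrak g$-submodules given by these formulas). *)

theory Defs
  imports "HOL-Analysis.Analysis"
begin

text \<open>
  Vectors and tensors are given by their components.  An operator is a matrix whose rows are the
  output (upper) indices and whose columns are the input (lower) indices, so that composition is
  the matrix product.  The space V has a basis indexed by the finite type \<open>'n\<close>, its dual the dual
  basis, indexed by \<open>'n\<close> as well; hence V, its dual, and all their twofold tensor products are
  coordinatised by the same types, and the order of the factors is implicit in each definition.
\<close>

type_synonym 'n cubic = "complex^('n::finite \<times> 'n \<times> 'n)"
type_synonym 'n op2 = "complex^('n::finite \<times> 'n)^('n::finite \<times> 'n)"
type_synonym 'n op3 = "complex^('n::finite \<times> 'n \<times> 'n)^('n::finite \<times> 'n \<times> 'n)"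

definition smult_mat :: "complex \<Rightarrow> complex^'c^'r \<Rightarrow> complex^'c^'r" (infixr "*\<^sub>m" 75)
  where "c *\<^sub>m A = (\<chi> i j. c * A $ i $ j)"

section \<open>The representations of the $e_6$ series\<close>

definition lie_bracket :: "complex^'k^'k \<Rightarrow> complex^'k^'k \<Rightarrow> complex^'k^'k"
  where "lie_bracket X Y = X ** Y - Y ** X"

definition sl :: "(complex^'k^'k) set"
  where "sl = {X. trace X = 0}"

text \<open>The action of \<open>X \<otimes> 1 + 1 \<otimes> Y\<close> on a tensor product of two coordinate spaces.\<close>

definition tensor_act ::
    "complex^'k^'k \<Rightarrow> complex^'l^'l \<Rightarrow> complex^('k::finite \<times> 'l::finite) \<Rightarrow> complex^('k \<times> 'l)"
  where "tensor_act X Y t =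
    (\<chi> p. (\<Sum>k\<in>UNIV. X $ fst p $ k * t $ (k, snd p)) + (\<Sum>l\<in>UNIV. Y $ snd p $ l * t $ (fst p, l)))"

text \<open>In characteristic 0, the second symmetric and exterior powers are the spaces of symmetric
  and of skew-symmetric tensors.\<close>

definition sym2 :: "(complex^('k::finite \<times> 'k)) set"
  where "sym2 = {t. \<forall>i j. t $ (j, i) = t $ (i, j)}"

definition ext2 :: "(complex^('k::finite \<times> 'k)) set"
  where "ext2 = {t. \<forall>i j. t $ (j, i) = - t $ (i, j)}"

definition is_basis :: "('n \<Rightarrow> complex^'w) \<Rightarrow> (complex^'w) set \<Rightarrow> bool"
  where "is_basis e W \<longleftrightarrow> inj e \<and> vec.independent (range e) \<and> vec.span (range e) = W"

text \<open>The matrices, in the basis \<open>e\<close>, of the operators in \<open>T\<close>.\<close>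

definition operator_matrices ::
    "('n \<Rightarrow> complex^'w) \<Rightarrow> (complex^'w \<Rightarrow> complex^'w) set \<Rightarrow> (complex^'n^'n) set"
  where "operator_matrices e T = {M. \<exists>f\<in>T. \<forall>c. f (e c) = (\<Sum>a\<in>UNIV. M $ a $ c *s e a)}"

text \<open>The Cartan matrix of $E_6$ in Bourbaki's numbering: the chain 1 - 3 - 4 - 5 - 6, with 2
  attached to 4.\<close>

definition e6_edges :: "nat set set"
  where "e6_edges = {{1, 3}, {3, 4}, {4, 5}, {5, 6}, {2, 4}}"

definition e6_cartan :: "nat \<Rightarrow> nat \<Rightarrow> int"
  where "e6_cartan i j = (if i = j then 2 else if {i, j} \<in> e6_edges then -1 else 0)"

text \<open>The Chevalley-Serre relations.  The Lie algebra $e_6$ is presented by them, so a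
  representation of $e_6$ is a family of operators that satisfies them.\<close>

definition e6_relations ::
    "(nat \<Rightarrow> complex^'n^'n) \<Rightarrow> (nat \<Rightarrow> complex^'n^'n) \<Rightarrow> (nat \<Rightarrow> complex^'n^'n) \<Rightarrow> bool"
  where "e6_relations E F H \<longleftrightarrow> (\<forall>i\<in>{1..6}. \<forall>j\<in>{1..6}.
      lie_bracket (H i) (H j) = 0 \<and>
      lie_bracket (H i) (E j) = of_int (e6_cartan i j) *\<^sub>m E j \<and>
      lie_bracket (H i) (F j) = - (of_int (e6_cartan i j) *\<^sub>m F j) \<and>
      lie_bracket (E i) (F j) = (if i = j then H i else 0) \<and>
      (i \<noteq> j \<longrightarrow>
        (lie_bracket (E i) ^^ nat (1 - e6_cartan i j)) (E j) = 0 \<and>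
        (lie_bracket (F i) ^^ nat (1 - e6_cartan i j)) (F j) = 0))"

inductive_set lie_generated :: "(complex^'n^'n) set \<Rightarrow> (complex^'n^'n) set"
  for S :: "(complex^'n^'n) set"
  where
    generator: "X \<in> S \<Longrightarrow> X \<in> lie_generated S"
  | zero: "0 \<in> lie_generated S"
  | add: "X \<in> lie_generated S \<Longrightarrow> Y \<in> lie_generated S \<Longrightarrow> X + Y \<in> lie_generated S"
  | smult: "X \<in> lie_generated S \<Longrightarrow> c *\<^sub>m X \<in> lie_generated S"
  | bracket: "X \<in> lie_generated S \<Longrightarrow> Y \<in> lie_generated S \<Longrightarrow> lie_bracket X Y \<in> lie_generated S"

definition irreducible_action :: "(complex^'n^'n) set \<Rightarrow> bool"
  where "irreducible_action L \<longleftrightarrow>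
    (UNIV :: (complex^'n) set) \<noteq> {0} \<and>
    (\<forall>U. vec.subspace U \<and> (\<forall>X\<in>L. \<forall>x\<in>U. X *v x \<in> U) \<longrightarrow> U = {0} \<or> U = UNIV)"

text \<open>\<open>e6_series m L\<close>: the set \<open>L\<close> consists of the matrices, in some basis of V indexed by \<open>'n\<close>, by
  which the Lie algebra of parameter \<open>m\<close> in the $e_6$ series acts on its representation V of
  dimension \<open>3 * m + 3\<close>.\<close>

definition e6_series :: "nat \<Rightarrow> (complex^'n^'n) set \<Rightarrow> bool"
  where "e6_series m L \<longleftrightarrow> CARD('n) = 3 * m + 3 \<and>
    (m = 1 \<and> (\<exists>e :: 'n \<Rightarrow> complex^(3 \<times> 3). is_basis e sym2 \<and>
        L = operator_matrices e {tensor_act X X | X. X \<in> sl}) \<or>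
     m = 2 \<and> (\<exists>e :: 'n \<Rightarrow> complex^(3 \<times> 3). is_basis e UNIV \<and>
        L = operator_matrices e {tensor_act X Y | X Y. X \<in> sl \<and> Y \<in> sl}) \<or>
     m = 4 \<and> (\<exists>e :: 'n \<Rightarrow> complex^(6 \<times> 6). is_basis e ext2 \<and>
        L = operator_matrices e {tensor_act X X | X. X \<in> sl}) \<or>
     m = 8 \<and> (\<exists>E F H. e6_relations E F H \<and>
        L = lie_generated (\<Union>i\<in>{1..6}. {E i, F i, H i}) \<and> irreducible_action L))"

section \<open>Invariant cubic tensors\<close>

definition sym3_invariants :: "(complex^'n^'n) set \<Rightarrow> ('n::finite cubic) set"
  where "sym3_invariants L = {t.
    (\<forall>a b c. t $ (b, a, c) = t $ (a, b, c) \<and> t $ (a, c, b) = t $ (a, b, c)) \<and>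
    (\<forall>X\<in>L. \<forall>a b c.
      (\<Sum>k\<in>UNIV. X $ a $ k * t $ (k, b, c) + X $ b $ k * t $ (a, k, c) + X $ c $ k * t $ (a, b, k)) = 0)}"

definition dual_rep :: "(complex^'n^'n) set \<Rightarrow> (complex^'n^'n) set"
  where "dual_rep L = (\<lambda>X. - transpose X) ` L"

text \<open>\<open>dU\<close> and \<open>dL\<close> are the tensors with upper and lower indices: each spans the invariants in the
  third symmetric power of V, respectively of its dual, and they are scaled relative to each other.\<close>

definition d_tensors ::
    "(complex^'n^'n) set \<Rightarrow> 'n::finite cubic \<Rightarrow> 'n cubic \<Rightarrow> bool"
  where "d_tensors L dU dL \<longleftrightarrow>
    vec.span {dU} = sym3_invariants L \<and>
    vec.span {dL} = sym3_invariants (dual_rep L) \<and>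
    (\<forall>a b. (\<Sum>c\<in>UNIV. \<Sum>d\<in>UNIV. dU $ (a, c, d) * dL $ (b, c, d)) = (if a = b then 1 else 0))"

section \<open>Operators on twofold tensor products\<close>

definition flip_op :: "'n::finite op2"
  where "flip_op = (\<chi> p q. if fst p = snd q \<and> snd p = fst q then 1 else 0)"

definition K_op ::
    "'n::finite cubic \<Rightarrow> 'n cubic \<Rightarrow> 'n op2"
  where "K_op dU dL = (\<chi> p q. case p of (a, b) \<Rightarrow> case q of (c, d) \<Rightarrow>
    \<Sum>e\<in>UNIV. dU $ (a, b, e) * dL $ (e, c, d))"

definition D_op :: "'n::finite op2"
  where "D_op = (\<chi> p q. if fst p = snd p \<and> fst q = snd q then 1 else 0)"

definition B_op ::
    "'n::finite cubic \<Rightarrow> 'n cubic \<Rightarrow> 'n op2"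
  where "B_op dU dL = (\<chi> p q. case p of (a, b) \<Rightarrow> case q of (c, d) \<Rightarrow>
    \<Sum>e\<in>UNIV. dU $ (a, d, e) * dL $ (e, c, b))"

definition P1_op ::
    "nat \<Rightarrow> 'n::finite cubic \<Rightarrow> 'n cubic \<Rightarrow> 'n op2"
  where "P1_op m dU dL = ((of_nat m + 2) / (of_nat m + 4)) *\<^sub>m
    (mat 1 - (1 / (of_nat m + 1)) *\<^sub>m D_op + 2 *\<^sub>m B_op dU dL)"

definition P2_op ::
    "nat \<Rightarrow> 'n::finite cubic \<Rightarrow> 'n cubic \<Rightarrow> 'n op2"
  where "P2_op m dU dL = (2 / (of_nat m + 4)) *\<^sub>m
    (mat 1 + (1 / 3) *\<^sub>m D_op - (of_nat m + 2) *\<^sub>m B_op dU dL)"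

definition P3_op :: "nat \<Rightarrow> 'n::finite op2"
  where "P3_op m = (1 / (3 * of_nat m + 3)) *\<^sub>m D_op"

text \<open>The value at \<open>u\<close> of the R-matrix from (V tensor dual) to (dual tensor V), meaningful away from
  the poles \<open>m + 4\<close> and \<open>3 * m\<close>; then its rescaled form, with poles \<open>m\<close> and \<open>3 * m\<close>.\<close>

definition R_mixed ::
    "nat \<Rightarrow> 'n::finite cubic \<Rightarrow> 'n cubic \<Rightarrow> complex
      \<Rightarrow> 'n op2"
  where "R_mixed m dU dL u = flip_op **
    (P1_op m dU dL
     + ((u + of_nat m + 4) / (u - of_nat m - 4)) *\<^sub>m P2_op m dU dL
     + (((u + of_nat m + 4) / (u - of_nat m - 4)) * ((u + 3 * of_nat m) / (u - 3 * of_nat m)))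
         *\<^sub>m P3_op m)"

definition R_mixed_rescaled ::
    "nat \<Rightarrow> 'n::finite cubic \<Rightarrow> 'n cubic \<Rightarrow> complex
      \<Rightarrow> 'n op2"
  where "R_mixed_rescaled m dU dL u = flip_op **
    (mat 1 - ((4 * (of_nat m + 2)) / (u - of_nat m)) *\<^sub>m B_op dU dL
     + (4 / (u - 3 * of_nat m)) *\<^sub>m D_op)"

definition R_VV ::
    "nat \<Rightarrow> 'n::finite cubic \<Rightarrow> 'n cubic \<Rightarrow> complex
      \<Rightarrow> 'n op2"
  where "R_VV m dU dL u = 4 *\<^sub>m mat 1 - u *\<^sub>m flip_op
    + (((4 * of_nat m + 8) * u) / (2 * of_nat m - u)) *\<^sub>m K_op dU dL"

section \<open>The Yang-Baxter equation\<close>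

text \<open>\<open>X \<otimes> 1\<close> and \<open>1 \<otimes> X\<close> on threefold tensor products.\<close>

definition on12 :: "'n::finite op2 \<Rightarrow> 'n op3"
  where "on12 X = (\<chi> p q. case p of (a, b, c) \<Rightarrow> case q of (a', b', c') \<Rightarrow>
    X $ (a, b) $ (a', b') * (if c = c' then 1 else 0))"

definition on23 :: "'n::finite op2 \<Rightarrow> 'n op3"
  where "on23 X = (\<chi> p q. case p of (a, b, c) \<Rightarrow> case q of (a', b', c') \<Rightarrow>
    (if a = a' then 1 else 0) * X $ (b, c) $ (b', c'))"

text \<open>The equation at the spectral parameters \<open>u\<close>, \<open>v\<close>, on (V tensor V tensor dual).\<close>

definition yang_baxter_mixed ::
    "(complex \<Rightarrow> 'n::finite op2) \<Rightarrow> (complex \<Rightarrow> 'n op2)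
      \<Rightarrow> complex \<Rightarrow> complex \<Rightarrow> bool"
  where "yang_baxter_mixed R S u v \<longleftrightarrow>
    on12 (R u) ** on23 (R (u + v)) ** on12 (S v) = on23 (S v) ** on12 (R (u + v)) ** on23 (R u)"

end

theory Submission
  imports Defs "HOL-Computational_Algebra.Fundamental_Theorem_Algebra"
begin

text \<open>
  The Yang-Baxter equation is an identity between tensor diagrams.  Besides the symmetry and the
  normalisation of \<open>d\<close>, it only needs the Springer identity
  \<open>d\<^sup>g\<^sup>e\<^sup>f (d\<^sub>e\<^sub>a\<^sub>b d\<^sub>f\<^sub>c\<^sub>d + d\<^sub>e\<^sub>a\<^sub>c d\<^sub>f\<^sub>b\<^sub>d + d\<^sub>e\<^sub>a\<^sub>d d\<^sub>f\<^sub>b\<^sub>c) = (\<delta>\<^sub>a\<^sup>g d\<^sub>b\<^sub>c\<^sub>d + \<dots>) / (m + 2)\<close> and its dual.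
  This is the polarisation of \<open>(x\<^sup>#)\<^sup># = \<mu> N(x) x\<close>, where \<open>N\<close> is the cubic form and \<open>x\<^sup>#\<close> its
  gradient; the factor is forced by a trace.  In each of the four cases, V has a basis of weight
  vectors on which the root vectors of the simple roots act explicitly.  An invariant cubic form
  only involves triples of weights of sum zero, and the equations of the root vectors compute all its
  coefficients from one of them.  So \<open>N\<close> is a multiple of an explicit form (the determinant of
  symmetric matrices, the determinant, the Pfaffian, and Cartan's cubic form in 27 variables), for
  which the identity can be expanded.

  For $e_6$, where only irreducibility and the dimension 27 are given, lowering a highest
  weight other than \<open>0\<close>, \<open>\<omega>\<^sub>1\<close>, \<open>\<omega>\<^sub>6\<close> produces at least 28 weights, while lowering \<open>\<omega>\<^sub>1\<close> produces
  exactly 27, so that the resulting vectors form a basis; the automorphism of the Dynkin diagram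
  exchanges \<open>\<omega>\<^sub>1\<close> and \<open>\<omega>\<^sub>6\<close>.
\<close>

section \<open>The tensor diagrams of a cubic pair\<close>

text \<open>Neither the basis of V nor the scales of the two tensors are prescribed, so the explicit
  forms describe \<open>dL\<close> and \<open>dU\<close> only up to unknown scalars \<open>C\<close>
  and \<open>C'\<close>, which also enter \<mu>. The relative normalisation makes the Springer
  factor independent of them, which is why it depends on the dimension alone. A single generic
  element of the Cartan subalgebra stands in for the weight lattice. Its eigenvalues on V are
  distinct integers, so one operator gives the independence of weight vectors, bounds on the
  dimension, and the vanishing of invariant coefficients. In the Yang-Baxter equation the right side
  is the left side for the dual pair with the external indices exchanged. The trees with four
  vertices are indexed by a lone upper and a lone lower index, nine in all; the two Springer
  identities express the row and column sums of this 3 by 3 array by simpler diagrams. The one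
  diagram with a loop of length four is reduced to trees by the same identity.\<close>

definition delta :: "'a \<Rightarrow> 'a \<Rightarrow> complex"
  where "delta a b = (if a = b then 1 else 0)"

lemma delta_commute: "delta a b = delta b a"
  by (simp add: delta_def)

lemma sum_delta_complex:
  "(\<Sum>x\<in>UNIV. f x * delta x (a::'a::finite)) = f a" "(\<Sum>x\<in>UNIV. f x * delta a x) = f a"
  "(\<Sum>x\<in>UNIV. delta x a * f x) = f a" "(\<Sum>x\<in>UNIV. delta a x * f x) = f a"
  by (simp_all add: delta_def if_distrib if_distribR cong: if_cong)

text \<open>The pattern of the three matrix products on either side of the mixed Yang-Baxter equation.\<close>

definition mixed_contraction ::
    "('n::finite \<Rightarrow> 'n \<Rightarrow> complex) \<Rightarrow> ('n \<Rightarrow> 'n \<Rightarrow> complex) \<Rightarrow> ('n \<Rightarrow> 'n \<Rightarrow> complex) \<Rightarrow> complex"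
  where "mixed_contraction f g h = (\<Sum>x\<in>UNIV. \<Sum>z\<in>UNIV. \<Sum>y\<in>UNIV. f x y * g y z * h x z)"

lemma mixed_contraction_add:
  "mixed_contraction (\<lambda>x y. f x y + f' x y) g h = mixed_contraction f g h + mixed_contraction f' g h"
  "mixed_contraction f (\<lambda>x y. g x y + g' x y) h = mixed_contraction f g h + mixed_contraction f g' h"
  "mixed_contraction f g (\<lambda>x y. h x y + h' x y) = mixed_contraction f g h + mixed_contraction f g h'"
  by (simp_all add: mixed_contraction_def distrib_left distrib_right sum.distrib)

lemma mixed_contraction_scale:
  "mixed_contraction (\<lambda>x y. c * f x y) g h = c * mixed_contraction f g h"
  "mixed_contraction f (\<lambda>x y. c * g x y) h = c * mixed_contraction f g h"
  "mixed_contraction f g (\<lambda>x y. c * h x y) = c * mixed_contraction f g h"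
  by (simp_all add: mixed_contraction_def sum_distrib_left mult_ac)

lemma mixed_contraction_sum:
  "mixed_contraction f (\<lambda>y z. \<Sum>i\<in>I. g' i y z) h = (\<Sum>i\<in>I. mixed_contraction f (g' i) h)"
  "mixed_contraction f g (\<lambda>x z. \<Sum>i\<in>I. h' i x z) = (\<Sum>i\<in>I. mixed_contraction f g (h' i))"
  by (induction I rule: infinite_finite_induct)
    (simp_all add: mixed_contraction_add, simp_all add: mixed_contraction_def)

lemma mixed_contraction_delta:
  "mixed_contraction f g (\<lambda>x z. delta x r * delta z s) = (\<Sum>y\<in>UNIV. f r y * g y s)"
  "mixed_contraction (\<lambda>x y. delta a x * delta l y) g h = (\<Sum>z\<in>UNIV. g l z * h a z)"
  "mixed_contraction f (\<lambda>y z. delta b z * delta y c) h = (\<Sum>x\<in>UNIV. f x c * h x b)"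
  "mixed_contraction f (\<lambda>y z. delta b y * delta z c) h = (\<Sum>x\<in>UNIV. f x b * h x c)"
  "mixed_contraction (\<lambda>x y. d * delta x y) g h = d * (\<Sum>x\<in>UNIV. \<Sum>z\<in>UNIV. g x z * h x z)"
proof -
  have "mixed_contraction f g (\<lambda>x z. delta x r * delta z s)
    = (\<Sum>x\<in>UNIV. (\<Sum>z\<in>UNIV. (\<Sum>y\<in>UNIV. f x y * g y z) * delta z s) * delta x r)"
    by (simp add: mixed_contraction_def sum_distrib_right sum_distrib_left mult_ac)
  then show "mixed_contraction f g (\<lambda>x z. delta x r * delta z s) = (\<Sum>y\<in>UNIV. f r y * g y s)"
    by (simp only: sum_delta_complex)
  have "mixed_contraction (\<lambda>x y. delta a x * delta l y) g h
    = (\<Sum>x\<in>UNIV. delta a x * (\<Sum>z\<in>UNIV. (\<Sum>y\<in>UNIV. delta l y * g y z) * h x z))"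
    by (simp add: mixed_contraction_def sum_distrib_right sum_distrib_left mult_ac)
  then show "mixed_contraction (\<lambda>x y. delta a x * delta l y) g h = (\<Sum>z\<in>UNIV. g l z * h a z)"
    by (simp only: sum_delta_complex)
  have "mixed_contraction f (\<lambda>y z. delta b z * delta y c) h
    = (\<Sum>x\<in>UNIV. \<Sum>z\<in>UNIV. delta b z * (h x z * (\<Sum>y\<in>UNIV. delta y c * f x y)))"
    by (simp add: mixed_contraction_def sum_distrib_right sum_distrib_left mult_ac)
  then show "mixed_contraction f (\<lambda>y z. delta b z * delta y c) h = (\<Sum>x\<in>UNIV. f x c * h x b)"
    by (simp only: sum_delta_complex mult.commute[of "f _ c"])
  have "mixed_contraction f (\<lambda>y z. delta b y * delta z c) h
    = (\<Sum>x\<in>UNIV. \<Sum>z\<in>UNIV. delta z c * (h x z * (\<Sum>y\<in>UNIV. delta b y * f x y)))"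
    by (simp add: mixed_contraction_def sum_distrib_right sum_distrib_left mult_ac)
  then show "mixed_contraction f (\<lambda>y z. delta b y * delta z c) h = (\<Sum>x\<in>UNIV. f x b * h x c)"
    by (simp only: sum_delta_complex mult.commute[of "f _ b"])
  have "mixed_contraction (\<lambda>x y. d * delta x y) g h
    = d * (\<Sum>x\<in>UNIV. \<Sum>z\<in>UNIV. h x z * (\<Sum>y\<in>UNIV. delta x y * g y z))"
    by (simp add: mixed_contraction_def sum_distrib_right sum_distrib_left mult_ac)
  then show "mixed_contraction (\<lambda>x y. d * delta x y) g h = d * (\<Sum>x\<in>UNIV. \<Sum>z\<in>UNIV. g x z * h x z)"
    by (simp only: sum_delta_complex mult.commute[of "g _ _" "h _ _"])
qed

section \<open>Cubic pairs, their tree diagrams and their loops\<close>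

locale cubic_pair =
  fixes U L :: "'n::finite \<Rightarrow> 'n \<Rightarrow> 'n \<Rightarrow> complex" and k :: complex
  assumes U_swap12: "U b a c = U a b c" and U_swap23: "U a c b = U a b c"
    and L_swap12: "L b a c = L a b c" and L_swap23: "L a c b = L a b c"
    and normalised: "(\<Sum>x\<in>UNIV. \<Sum>y\<in>UNIV. U a x y * L b x y) = delta a b"
    and springer_L: "(\<Sum>e\<in>UNIV. \<Sum>f\<in>UNIV. U g e f *
        (L e a b * L f c d + L e a c * L f b d + L e a d * L f b c))
      = k * (delta g a * L b c d + delta g b * L a c d + delta g c * L a b d + delta g d * L a b c)"
    and springer_U: "(\<Sum>e\<in>UNIV. \<Sum>f\<in>UNIV. L g e f *
        (U e a b * U f c d + U e a c * U f b d + U e a d * U f b c))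
      = k * (delta g a * U b c d + delta g b * U a c d + delta g c * U a b d + delta g d * U a b c)"
begin

lemma dual: "cubic_pair L U k"
proof
  show "(\<Sum>x\<in>UNIV. \<Sum>y\<in>UNIV. L a x y * U b x y) = delta a b" for a b
    using normalised[of b a] by (simp add: mult.commute delta_commute[of a])
qed (rule U_swap12 U_swap23 L_swap12 L_swap23 springer_L springer_U)+

lemma U_sym: "U a c b = U a b c" "U b a c = U a b c" "U b c a = U a b c" "U c a b = U a b c" "U c b a = U a b c"
  by (metis U_swap12 U_swap23)+

lemma L_sym: "L a c b = L a b c" "L b a c = L a b c" "L b c a = L a b c" "L c a b = L a b c" "L c b a = L a b c"
  by (metis L_swap12 L_swap23)+

definition exchange :: "'n \<Rightarrow> 'n \<Rightarrow> 'n \<Rightarrow> 'n \<Rightarrow> complex"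
  where "exchange a b r s = (\<Sum>e\<in>UNIV. U a b e * L e r s)"

text \<open>\<open>caterpillar a b l c r s\<close> is the tree diagram with four vertices in which the external indices
  \<open>a b\<close>, \<open>l\<close>, \<open>c\<close>, \<open>r s\<close> are attached in this order along the chain \<open>U - L - U - L\<close>.\<close>

definition caterpillar :: "'n \<Rightarrow> 'n \<Rightarrow> 'n \<Rightarrow> 'n \<Rightarrow> 'n \<Rightarrow> 'n \<Rightarrow> complex"
  where "caterpillar a b l c r s =
    (\<Sum>e\<in>UNIV. \<Sum>f\<in>UNIV. \<Sum>g\<in>UNIV. U a b e * L e l f * U f c g * L g r s)"

lemma exchange_sym: "exchange b a r s = exchange a b r s" "exchange a b s r = exchange a b r s"
  by (simp_all add: exchange_def U_sym(2) L_sym(1))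

lemma caterpillar_sym: "caterpillar b a l c r s = caterpillar a b l c r s" "caterpillar a b l c s r = caterpillar a b l c r s"
  by (simp_all add: caterpillar_def U_sym(2) L_sym(1))

text \<open>With the end \<open>U a b e\<close> fixed, the three choices of the lone lower index are
  the three terms of \<open>springer_L\<close> at the lower indices \<open>e, l, r, s\<close>. Of
  its four deltas three contain an external lower index and leave exchanges;
  \<open>delta c e\<close> leaves the disconnected diagram.\<close>

lemma caterpillar_sum_lower:
  "caterpillar a b l c r s + caterpillar a b r c l s + caterpillar a b s c l r =
    k * (delta c l * exchange a b r s + delta c r * exchange a b l s + delta c s * exchange a b l r
      + U a b c * L l r s)"
proof -
  have 1: "caterpillar a b l c r s = (\<Sum>e\<in>UNIV. U a b e * (\<Sum>f\<in>UNIV. \<Sum>g\<in>UNIV. U c f g * (L f e l * L g r s)))"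
    for l r s
    unfolding caterpillar_def sum_distrib_left
    by (intro sum.cong refl) (simp add: L_sym U_sym mult_ac)
  have "caterpillar a b l c r s + caterpillar a b r c l s + caterpillar a b s c l r
    = (\<Sum>e\<in>UNIV. U a b e * (\<Sum>f\<in>UNIV. \<Sum>g\<in>UNIV. U c f g *
         (L f e l * L g r s + L f e r * L g l s + L f e s * L g l r)))"
    unfolding 1 by (simp only: distrib_left sum.distrib)
  also have "\<dots> = (\<Sum>e\<in>UNIV. U a b e * (k * (delta c e * L l r s + delta c l * L e r s
      + delta c r * L e l s + delta c s * L e l r)))"
    by (simp only: springer_L)
  also have "\<dots> = k * ((\<Sum>e\<in>UNIV. (U a b e * L l r s) * delta c e) + delta c l * exchange a b r s
      + delta c r * exchange a b l s + delta c s * exchange a b l r)"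
    unfolding exchange_def sum_distrib_left
    by (simp only: distrib_left sum.distrib sum_distrib_left mult_ac)
  finally show ?thesis
    unfolding sum_delta_complex by (simp add: algebra_simps)
qed

text \<open>Here the other end \<open>L r s e\<close> is kept fixed and \<open>springer_U\<close> is
  applied to the remaining three vertices; the interchanges of sums only bring that end to the
  outside.\<close>

lemma caterpillar_sum_upper:
  "caterpillar a b l c r s + caterpillar a c l b r s + caterpillar b c l a r s =
    k * (delta c l * exchange a b r s + delta b l * exchange a c r s + delta a l * exchange b c r s
      + U a b c * L l r s)"
proof -
  have 1: "caterpillar a b l c r s = (\<Sum>e\<in>UNIV. L r s e * (\<Sum>f\<in>UNIV. \<Sum>g\<in>UNIV. L l f g * (U f e c * U g a b)))"
    for a b c
  proof -
    have "caterpillar a b l c r s = (\<Sum>e\<in>UNIV. \<Sum>f\<in>UNIV. \<Sum>g\<in>UNIV. U a b e * L e l f * U f c g * L g r s)"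
      by (simp add: caterpillar_def)
    also have "\<dots> = (\<Sum>e\<in>UNIV. \<Sum>g\<in>UNIV. \<Sum>f\<in>UNIV. U a b e * L e l f * U f c g * L g r s)"
      by (intro sum.cong refl sum.swap)
    also have "\<dots> = (\<Sum>g\<in>UNIV. \<Sum>e\<in>UNIV. \<Sum>f\<in>UNIV. U a b e * L e l f * U f c g * L g r s)"
      by (rule sum.swap)
    also have "\<dots> = (\<Sum>g\<in>UNIV. \<Sum>f\<in>UNIV. \<Sum>e\<in>UNIV. U a b e * L e l f * U f c g * L g r s)"
      by (intro sum.cong refl sum.swap)
    finally show ?thesis unfolding sum_distrib_left
      by (simp add: L_sym U_sym mult_ac)
  qed
  have "caterpillar a b l c r s + caterpillar a c l b r s + caterpillar b c l a r s
    = (\<Sum>e\<in>UNIV. L r s e * (\<Sum>f\<in>UNIV. \<Sum>g\<in>UNIV. L l f g *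
         (U f e a * U g b c + U f e b * U g a c + U f e c * U g a b)))"
    unfolding 1 by (simp only: distrib_left sum.distrib) (simp add: add_ac)
  also have "\<dots> = (\<Sum>e\<in>UNIV. L r s e * (k * (delta l e * U a b c + delta l a * U e b c
      + delta l b * U e a c + delta l c * U e a b)))"
    by (simp only: springer_U)
  also have "\<dots> = k * ((\<Sum>e\<in>UNIV. (L r s e * U a b c) * delta l e) + delta l a * exchange b c r s
      + delta l b * exchange a c r s + delta l c * exchange a b r s)"
    unfolding exchange_def sum_distrib_left
    by (simp only: distrib_left sum.distrib sum_distrib_left mult_ac L_sym U_sym)
  finally show ?thesis
    unfolding sum_delta_complex
    by (simp add: algebra_simps L_sym delta_commute[of l a] delta_commute[of l b] delta_commute[of l c])
qed

text \<open>In the Springer identity contracted with a third \<open>U\<close>, two of the three summands on the left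
  are the same box diagram, and normalisation collapses the remaining one.\<close>

lemma box:
  "mixed_contraction (\<lambda>x y. exchange a y x l) (\<lambda>y z. L z y f) (\<lambda>x z. U x z g)
    = (k - 1/2) * exchange a g l f + k / 2 * (delta a l * delta f g + delta a f * delta l g)"
proof -
  define S where "S F = (\<Sum>x\<in>UNIV. \<Sum>z\<in>UNIV. U x z g * (\<Sum>e\<in>UNIV. \<Sum>y\<in>UNIV. U a e y * F x z e y))" for F
  define b1 where "b1 = S (\<lambda>x z e y. L e x l * L y z f)"
  define b2 where "b2 = S (\<lambda>x z e y. L e x f * L y z l)"
  define b3 where "b3 = S (\<lambda>x z e y. L e x z * L y l f)"
  have "mixed_contraction (\<lambda>x y. exchange a y x l) (\<lambda>y z. L z y f) (\<lambda>x z. U x z g)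
    = (\<Sum>x\<in>UNIV. \<Sum>z\<in>UNIV. \<Sum>y\<in>UNIV. \<Sum>e\<in>UNIV. U x z g * (U a e y * (L e x l * L y z f)))"
    unfolding mixed_contraction_def exchange_def sum_distrib_right
    by (intro sum.cong refl) (simp add: L_sym U_sym mult_ac)
  also have "\<dots> = (\<Sum>x\<in>UNIV. \<Sum>z\<in>UNIV. \<Sum>e\<in>UNIV. \<Sum>y\<in>UNIV. U x z g * (U a e y * (L e x l * L y z f)))"
    by (intro sum.cong refl sum.swap)
  finally have lhs: "mixed_contraction (\<lambda>x y. exchange a y x l) (\<lambda>y z. L z y f) (\<lambda>x z. U x z g) = b1"
    by (simp only: b1_def S_def sum_distrib_left)
  \<comment> \<open>Renaming \<open>x\<close> with \<open>z\<close> and \<open>e\<close> with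
    \<open>y\<close> is the reflection of the box.\<close>
  have "b2 = (\<Sum>z\<in>UNIV. \<Sum>x\<in>UNIV. U x z g * (\<Sum>y\<in>UNIV. \<Sum>e\<in>UNIV. U a e y * (L e x f * L y z l)))"
    unfolding b2_def S_def sum_distrib_left
    by (subst sum.swap) (intro sum.cong refl sum.swap)
  also have "\<dots> = b1"
    unfolding b1_def S_def sum_distrib_left
    by (intro sum.cong refl) (simp add: L_sym U_sym mult_ac)
  finally have b2: "b2 = b1" .
  have "b3 = (\<Sum>x\<in>UNIV. \<Sum>z\<in>UNIV. \<Sum>e\<in>UNIV. \<Sum>y\<in>UNIV. (U a e y * L y l f) * (U g x z * L e x z))"
    unfolding b3_def S_def sum_distrib_left
    by (intro sum.cong refl) (simp add: L_sym U_sym mult_ac)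
  also have "\<dots> = (\<Sum>x\<in>UNIV. \<Sum>e\<in>UNIV. \<Sum>z\<in>UNIV. \<Sum>y\<in>UNIV. (U a e y * L y l f) * (U g x z * L e x z))"
    by (intro sum.cong refl sum.swap)
  also have "\<dots> = (\<Sum>e\<in>UNIV. \<Sum>x\<in>UNIV. \<Sum>z\<in>UNIV. \<Sum>y\<in>UNIV. (U a e y * L y l f) * (U g x z * L e x z))"
    by (rule sum.swap)
  also have "\<dots> = (\<Sum>e\<in>UNIV. (\<Sum>y\<in>UNIV. U a e y * L y l f) * (\<Sum>x\<in>UNIV. \<Sum>z\<in>UNIV. U g x z * L e x z))"
    unfolding sum_product sum_distrib_left sum_distrib_right by (simp add: mult_ac)
  also have "\<dots> = exchange a g l f"
    by (simp only: normalised sum_delta_complex exchange_def)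
  finally have b3: "b3 = exchange a g l f" .
  have "b1 + b2 + b3 = S (\<lambda>x z e y. L e x l * L y z f + L e x z * L y l f + L e x f * L y l z)"
    unfolding b1_def b2_def b3_def S_def
    by (simp only: distrib_left sum.distrib) (simp add: L_sym(1))
  also have "\<dots> = (\<Sum>x\<in>UNIV. \<Sum>z\<in>UNIV. U x z g * (k * (delta a x * L l z f + delta a l * L x z f
      + delta a z * L x l f + delta a f * L x l z)))"
    unfolding S_def by (simp only: springer_L)
  also have "\<dots> = k * ((\<Sum>z\<in>UNIV. \<Sum>x\<in>UNIV. (U x z g * L l z f) * delta a x)
      + delta a l * (\<Sum>x\<in>UNIV. \<Sum>z\<in>UNIV. U g x z * L f x z)
      + (\<Sum>x\<in>UNIV. \<Sum>z\<in>UNIV. (U x z g * L x l f) * delta a z) + delta a f * (\<Sum>x\<in>UNIV. \<Sum>z\<in>UNIV. U g x z * L l x z))"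
    (is "_ = k * (?p + ?q + ?r + ?s)")
  proof -
    have p: "?p = (\<Sum>x\<in>UNIV. \<Sum>z\<in>UNIV. (U x z g * L l z f) * delta a x)" by (rule sum.swap)
    have q: "?q = (\<Sum>x\<in>UNIV. \<Sum>z\<in>UNIV. delta a l * (U x z g * L x z f))"
      unfolding sum_distrib_left by (simp only: L_sym U_sym)
    have s: "?s = (\<Sum>x\<in>UNIV. \<Sum>z\<in>UNIV. delta a f * (U x z g * L x l z))"
      unfolding sum_distrib_left by (simp only: L_sym U_sym)
    show ?thesis unfolding p q s
      by (simp only: sum.distrib[symmetric] sum_distrib_left) (intro sum.cong refl, simp only: distrib_left mult_ac)
  qed
  also have "\<dots> = k * (2 * exchange a g l f + delta a l * delta f g + delta a f * delta l g)"
    unfolding sum_delta_complex normalised exchange_def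
    by (simp add: L_sym U_sym algebra_simps delta_commute[of g f] delta_commute[of g l])
  finally have "2 * b1 + exchange a g l f = k * (2 * exchange a g l f + delta a l * delta f g + delta a f * delta l g)"
    unfolding b2 b3 by simp
  then show ?thesis unfolding lhs by algebra
qed

lemma sum_exchange_exchange:
  "(\<Sum>z\<in>UNIV. exchange b c z l * exchange a z r s) = caterpillar b c l a r s"
  "(\<Sum>x\<in>UNIV. exchange a c x l * exchange x b r s) = caterpillar a c l b r s"
  "(\<Sum>x\<in>UNIV. \<Sum>z\<in>UNIV. exchange b c z x * exchange x z r s) = exchange b c r s"
proof -
  show *: "(\<Sum>z\<in>UNIV. exchange b c z l * exchange a z r s) = caterpillar b c l a r s" for a b c l r s
  proof -
    have "caterpillar b c l a r s = (\<Sum>z\<in>UNIV. \<Sum>e\<in>UNIV. \<Sum>g\<in>UNIV. U b c e * L e l z * U z a g * L g r s)"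
      unfolding caterpillar_def by (rule sum.swap)
    also have "\<dots> = (\<Sum>z\<in>UNIV. exchange b c z l * exchange a z r s)"
      unfolding exchange_def sum_product
      by (simp add: L_sym(1)[of _ _ l] U_sym(2)[of _ a] mult_ac)
    finally show ?thesis by simp
  qed
  show "(\<Sum>x\<in>UNIV. exchange a c x l * exchange x b r s) = caterpillar a c l b r s"
    using *[of a c l b r s] by (simp add: exchange_sym(1)[of b])
  have "(\<Sum>x\<in>UNIV. \<Sum>z\<in>UNIV. exchange b c z x * exchange x z r s)
    = (\<Sum>x\<in>UNIV. \<Sum>z\<in>UNIV. \<Sum>e\<in>UNIV. \<Sum>g\<in>UNIV. (U b c e * L g r s) * (U g x z * L e x z))"
    unfolding exchange_def sum_product by (intro sum.cong refl) (simp add: L_sym U_sym mult_ac)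
  also have "\<dots> = (\<Sum>x\<in>UNIV. \<Sum>e\<in>UNIV. \<Sum>z\<in>UNIV. \<Sum>g\<in>UNIV. (U b c e * L g r s) * (U g x z * L e x z))"
    by (intro sum.cong refl sum.swap)
  also have "\<dots> = (\<Sum>e\<in>UNIV. \<Sum>x\<in>UNIV. \<Sum>z\<in>UNIV. \<Sum>g\<in>UNIV. (U b c e * L g r s) * (U g x z * L e x z))"
    by (rule sum.swap)
  also have "\<dots> = (\<Sum>e\<in>UNIV. \<Sum>x\<in>UNIV. \<Sum>g\<in>UNIV. \<Sum>z\<in>UNIV. (U b c e * L g r s) * (U g x z * L e x z))"
    by (intro sum.cong refl sum.swap)
  also have "\<dots> = (\<Sum>e\<in>UNIV. \<Sum>g\<in>UNIV. \<Sum>x\<in>UNIV. \<Sum>z\<in>UNIV. (U b c e * L g r s) * (U g x z * L e x z))"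
    by (intro sum.cong refl sum.swap)
  also have "\<dots> = (\<Sum>e\<in>UNIV. \<Sum>g\<in>UNIV. (U b c e * L g r s) * delta g e)"
    by (simp only: normalised sum_distrib_left[symmetric])
  also have "\<dots> = exchange b c r s"
    by (simp only: sum_delta_complex exchange_def)
  finally show "(\<Sum>x\<in>UNIV. \<Sum>z\<in>UNIV. exchange b c z x * exchange x z r s) = exchange b c r s" .
qed

text \<open>Cutting the inner edges \<open>f\<close> of \<open>exchange b c\<close> and
  \<open>g\<close> of \<open>exchange r s\<close> exposes the box. Of the three diagrams that
  replace it, the exchange gives a caterpillar, and the two products of deltas give an exchange and
  a disconnected diagram.\<close>

lemma contraction_box:
  "mixed_contraction (\<lambda>x y. exchange a y x l) (\<lambda>y z. exchange b c z y) (\<lambda>x z. exchange x z r s)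
    = (k - 1/2) * caterpillar b c l a r s + k / 2 * (delta a l * exchange b c r s + U a b c * L l r s)"
proof -
  let ?m = "mixed_contraction (\<lambda>x y. exchange a y x l)"
  have 1: "exchange b c z y = (\<Sum>f\<in>UNIV. U b c f * L z y f)" for y z
    unfolding exchange_def by (simp add: L_sym)
  have 2: "exchange x z r s = (\<Sum>g\<in>UNIV. L g r s * U x z g)" for x z
    unfolding exchange_def by (simp add: mult.commute)
  have "?m (\<lambda>y z. exchange b c z y) (\<lambda>x z. exchange x z r s)
    = (\<Sum>f\<in>UNIV. \<Sum>g\<in>UNIV. U b c f * (L g r s * ?m (\<lambda>y z. L z y f) (\<lambda>x z. U x z g)))"
    unfolding 1 2 mixed_contraction_sum mixed_contraction_scale sum_distrib_left
    by simp
  also have "\<dots> = (\<Sum>f\<in>UNIV. \<Sum>g\<in>UNIV. (k - 1/2) * (U b c f * L g r s * exchange a g l f)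
      + k / 2 * (delta a l * (U b c f * L g r s * delta f g) + U b c f * delta a f * (L g r s * delta l g)))"
    unfolding box by (intro sum.cong refl) (simp add: field_simps)
  also have "\<dots> = (k - 1/2) * (\<Sum>f\<in>UNIV. \<Sum>g\<in>UNIV. U b c f * L g r s * exchange a g l f)
      + k / 2 * (delta a l * (\<Sum>f\<in>UNIV. \<Sum>g\<in>UNIV. U b c f * L g r s * delta f g)
      + (\<Sum>f\<in>UNIV. U b c f * delta a f) * (\<Sum>g\<in>UNIV. L g r s * delta l g))"
    by (simp only: sum.distrib sum_distrib_left[symmetric] sum_product)
  also have "(\<Sum>f\<in>UNIV. \<Sum>g\<in>UNIV. U b c f * L g r s * exchange a g l f) = caterpillar b c l a r s"
  proof -
    have "caterpillar b c l a r s = (\<Sum>e\<in>UNIV. \<Sum>g\<in>UNIV. \<Sum>f\<in>UNIV. U b c e * L e l f * U f a g * L g r s)"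
      unfolding caterpillar_def by (intro sum.cong refl sum.swap)
    also have "\<dots> = (\<Sum>f\<in>UNIV. \<Sum>g\<in>UNIV. U b c f * L g r s * exchange a g l f)"
      unfolding exchange_def sum_distrib_left
      by (intro sum.cong refl) (simp add: L_sym U_sym mult_ac)
    finally show ?thesis by simp
  qed
  finally show ?thesis
    unfolding sum_delta_complex by (simp add: exchange_def U_sym)
qed

end

lemma sum_delta_nested:
  "(\<Sum>x\<in>UNIV. f x * (delta x (a::'a::finite) * d)) = f a * d" "(\<Sum>x\<in>UNIV. f x * (delta a x * d)) = f a * d"
  "(\<Sum>x\<in>UNIV. f x * (d * delta x a)) = f a * d" "(\<Sum>x\<in>UNIV. f x * (d * delta a x)) = f a * d"
  by (simp_all add: delta_def if_distrib if_distribR cong: if_cong)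

section \<open>The Yang-Baxter equation as an identity of diagrams\<close>

context cubic_pair
begin

text \<open>Of the 27 products only two contain a loop: the one with
  \<open>\<kappa> * \<gamma> * \<beta>'\<close> closes a bubble, which normalisation turns into an
  edge, and the one with \<open>\<kappa> * \<beta> * \<beta>'\<close> is the box. No closed circle
  arises, so the dimension does not enter.\<close>

lemma mixed_contraction_value:
  "mixed_contraction
      (\<lambda>x y. \<alpha> * (delta a x * delta l y) + \<beta> * exchange a y x l + \<gamma> * (delta a l * delta x y))
      (\<lambda>y z. \<alpha>' * (delta b z * delta y c) + \<beta>' * exchange b c z y + \<gamma>' * (delta b y * delta z c))
      (\<lambda>x z. p * (delta x r * delta z s) + q * (delta x s * delta z r) + \<kappa> * exchange x z r s) =
    p * (\<alpha> * \<alpha>' * delta a r * delta b s * delta c l + \<gamma> * \<alpha>' * delta a l * delta c r * delta b s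
        + \<alpha> * \<gamma>' * delta a r * delta b l * delta c s + \<gamma> * \<gamma>' * delta a l * delta b r * delta c s
        + \<beta> * \<alpha>' * delta b s * exchange a c l r + \<alpha> * \<beta>' * delta a r * exchange b c l s
        + \<beta> * \<gamma>' * delta c s * exchange a b l r + \<gamma> * \<beta>' * delta a l * exchange b c r s
        + \<beta> * \<beta>' * caterpillar b c s a l r)
    + q * (\<alpha> * \<alpha>' * delta a s * delta b r * delta c l + \<gamma> * \<alpha>' * delta a l * delta c s * delta b r
        + \<alpha> * \<gamma>' * delta a s * delta b l * delta c r + \<gamma> * \<gamma>' * delta a l * delta b s * delta c r
        + \<beta> * \<alpha>' * delta b r * exchange a c l s + \<alpha> * \<beta>' * delta a s * exchange b c l r
        + \<beta> * \<gamma>' * delta c r * exchange a b l s + \<gamma> * \<beta>' * delta a l * exchange b c r s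
        + \<beta> * \<beta>' * caterpillar b c r a l s)
    + \<kappa> * (\<alpha> * \<alpha>' * delta c l * exchange a b r s + \<gamma> * \<alpha>' * delta a l * exchange b c r s
        + \<alpha> * \<gamma>' * delta b l * exchange a c r s
        + \<gamma> * \<beta>' * delta a l * exchange b c r s + \<gamma> * \<gamma>' * delta a l * exchange b c r s
        + \<beta> * \<alpha>' * caterpillar a c l b r s + \<alpha> * \<beta>' * caterpillar b c l a r s + \<beta> * \<gamma>' * caterpillar a b l c r s
        + \<beta> * \<beta>' * ((k - 1/2) * caterpillar b c l a r s + k / 2 * (delta a l * exchange b c r s + U a b c * L l r s)))"
proof -
  have 1: "(\<Sum>y\<in>UNIV. exchange a y r l * exchange b c s y) = caterpillar b c s a l r" for r s
    using sum_exchange_exchange(1)[of b c s a r l] by (simp add: exchange_sym mult.commute caterpillar_sym)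
  have 2: "mixed_contraction delta (\<lambda>y z. exchange b c z y) (\<lambda>x z. exchange x z r s) = exchange b c r s"
    by (subst mixed_contraction_delta(5)[of 1, simplified]) (rule sum_exchange_exchange(3))
  show ?thesis
    unfolding mixed_contraction_add mixed_contraction_scale contraction_box mixed_contraction_delta
    by (simp add: 1 2 sum_exchange_exchange sum_delta_complex sum_delta_nested mult.assoc
        sum_distrib_left[symmetric] sum_distrib_right[symmetric])
       (simp add: exchange_sym algebra_simps delta_commute)
qed

text \<open>The coefficient of \<open>path\<close> in the difference of the two sides of the Yang-Baxter equation is
  the sum of a function of its lone upper and a function of its lone lower index, so that the
  Springer identities apply.\<close>

lemma yang_baxter_contraction:
  assumes C: "4 * \<beta> * \<alpha>' - 4 * \<alpha> * \<beta>' + k * v * \<beta> * \<beta>' = 0"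
    "4 * \<gamma> * \<alpha>' - 4 * \<alpha> * \<gamma>' - v * \<gamma> * \<gamma>' = 0"
    "\<kappa> * \<beta> * \<alpha>' = \<kappa> * (\<alpha> * \<beta>' + \<beta> * \<beta>' * (k - 1/2)) + v * \<beta> * \<beta>'"
    "v * \<beta> * \<gamma>' + \<kappa> * \<alpha> * \<gamma>' + k * \<kappa> * \<beta> * \<alpha>' = 0"
    "4 * \<beta> * \<gamma>' - 4 * \<gamma> * \<beta>' + v * \<gamma> * \<beta>' - \<kappa> * (\<gamma> * \<alpha>' + k / 2 * \<beta> * \<beta>' + \<gamma> * \<beta>' + \<gamma> * \<gamma>')
      - k * \<kappa> * (\<alpha> * \<beta>' + \<beta> * \<beta>' * (k - 1/2)) = 0"
  shows "mixed_contraction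
      (\<lambda>x y. \<alpha> * (delta a x * delta l y) + \<beta> * exchange a y x l + \<gamma> * (delta a l * delta x y))
      (\<lambda>y z. \<alpha>' * (delta b z * delta y c) + \<beta>' * exchange b c z y + \<gamma>' * (delta b y * delta z c))
      (\<lambda>x z. 4 * (delta x r * delta z s) + (- v) * (delta x s * delta z r) + \<kappa> * exchange x z r s) =
    mixed_contraction
      (\<lambda>x y. \<alpha> * (delta s x * delta c y) + \<beta> * exchange x c s y + \<gamma> * (delta s c * delta x y))
      (\<lambda>y z. \<alpha>' * (delta r z * delta y l) + \<beta>' * exchange z y r l + \<gamma>' * (delta r y * delta z l))
      (\<lambda>x z. 4 * (delta x b * delta z a) + (- v) * (delta x a * delta z b) + \<kappa> * exchange b a x z)"
proof -
  \<comment> \<open>The right side is the left side for the dual pair with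
    \<open>a, b, c, l, r, s\<close> replaced by \<open>s, r, l, c, b, a\<close>, so one evaluation
    of the contraction serves both.\<close>
  interpret dual: cubic_pair L U k by (rule dual)
  have ex: "dual.exchange a b r s = exchange r s a b" for a b r s
    by (simp add: exchange_def dual.exchange_def mult.commute U_sym L_sym)
  have pa: "dual.caterpillar a b l c r s = caterpillar r s c l a b" for a b l c r s
  proof -
    have "dual.caterpillar a b l c r s = (\<Sum>f\<in>UNIV. \<Sum>e\<in>UNIV. \<Sum>g\<in>UNIV. L a b e * U e l f * L f c g * U g r s)"
      unfolding dual.caterpillar_def by (rule sum.swap)
    also have "\<dots> = (\<Sum>f\<in>UNIV. \<Sum>g\<in>UNIV. \<Sum>e\<in>UNIV. L a b e * U e l f * L f c g * U g r s)"
      by (intro sum.cong refl sum.swap)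
    also have "\<dots> = (\<Sum>g\<in>UNIV. \<Sum>f\<in>UNIV. \<Sum>e\<in>UNIV. L a b e * U e l f * L f c g * U g r s)"
      by (rule sum.swap)
    also have "\<dots> = caterpillar r s c l a b"
      unfolding caterpillar_def by (intro sum.cong refl) (simp add: U_sym L_sym mult_ac)
    finally show ?thesis .
  qed
  define zb where "zb = k - 1/2"
  define hb where "hb = k / 2"
  define Z where "Z = \<kappa> * (\<alpha> * \<beta>' + \<beta> * \<beta>' * (k - 1/2))"
  define W where "W = v * \<beta> * \<beta>'"
  have row: "caterpillar x y l w r s + caterpillar x y r w l s + caterpillar x y s w l r =
    k * (delta w l * exchange x y r s + delta w r * exchange x y l s + delta w s * exchange x y l r + U x y w * L l r s)"
    for x y w by (rule caterpillar_sum_lower)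
  have col: "caterpillar a b x c y w + caterpillar a c x b y w + caterpillar b c x a y w =
    k * (delta c x * exchange a b y w + delta b x * exchange a c y w + delta a x * exchange b c y w + U a b c * L x y w)"
    for x y w by (rule caterpillar_sum_upper)
  have Q: "U a c b = U a b c" "L r l s = L l r s" "U c b a = U a b c" "L s r l = L l r s" by (simp_all add: U_sym L_sym)
  have dualv: "mixed_contraction
      (\<lambda>x y. \<alpha> * (delta s x * delta c y) + \<beta> * exchange x c s y + \<gamma> * (delta s c * delta x y))
      (\<lambda>y z. \<alpha>' * (delta r z * delta y l) + \<beta>' * exchange z y r l + \<gamma>' * (delta r y * delta z l))
      (\<lambda>x z. 4 * (delta x b * delta z a) + (- v) * (delta x a * delta z b) + \<kappa> * exchange b a x z)
   = mixed_contraction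
      (\<lambda>x y. \<alpha> * (delta s x * delta c y) + \<beta> * dual.exchange s y x c + \<gamma> * (delta s c * delta x y))
      (\<lambda>y z. \<alpha>' * (delta r z * delta y l) + \<beta>' * dual.exchange r l z y + \<gamma>' * (delta r y * delta z l))
      (\<lambda>x z. 4 * (delta x b * delta z a) + (- v) * (delta x a * delta z b) + \<kappa> * dual.exchange x z b a)"
    by (simp only: ex)
  have sym: "exchange y x r s = exchange x y r s" "exchange x y s r = exchange x y r s"
    "caterpillar y x l w r s = caterpillar x y l w r s" "caterpillar x y l w s r = caterpillar x y l w r s" for x y l w r s
    by (simp_all add: exchange_sym caterpillar_sym)
  note dc = delta_commute[of r] delta_commute[of s] delta_commute[of l]
  note norm = dc sym(1)[of c a] sym(1)[of c b] sym(1)[of b a] sym(2)[of _ _ r l] sym(2)[of _ _ s l] sym(2)[of _ _ s r]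
    sym(3)[of c a] sym(3)[of c b] sym(3)[of b a] sym(4)[of _ _ _ _ r l] sym(4)[of _ _ _ _ s l] sym(4)[of _ _ _ _ s r] Q
  \<comment> \<open>After the third hypothesis is used, the difference of the sides contains the
    caterpillar of a lone upper and a lone lower index with the sum of two weights:
    \<open>0, W, - Z\<close> for the upper \<open>a, b, c\<close> and \<open>Z, - W, 0\<close> for
    the lower \<open>l, r, s\<close>. So the relations of columns \<open>l\<close>, \<open>r\<close>
    and rows \<open>b\<close>, \<open>c\<close> remove all nine caterpillars, and the simpler
    diagrams that remain carry the left sides of the hypotheses as coefficients.\<close>
  have combine: "lhs = rhs" if
    "lhs - rhs = Z * (colL - colL') - W * (colR - colR') + W * (rowB - rowB') - Z * (rowC - rowC')
     + (4 * \<beta> * \<alpha>' - 4 * \<alpha> * \<beta>' + k * W) * x1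
     + (4 * \<gamma> * \<alpha>' - 4 * \<alpha> * \<gamma>' - v * \<gamma> * \<gamma>') * x2
     + (\<kappa> * \<beta> * \<alpha>' - Z - W) * x3
     + (v * \<beta> * \<gamma>' + \<kappa> * \<alpha> * \<gamma>' + k * \<kappa> * \<beta> * \<alpha>') * x4
     + (4 * \<beta> * \<gamma>' - 4 * \<gamma> * \<beta>' + v * \<gamma> * \<beta>' - \<kappa> * (\<gamma> * \<alpha>' + k / 2 * \<beta> * \<beta>' + \<gamma> * \<beta>' + \<gamma> * \<gamma>') - k * Z) * x5"
    "colL = colL'" "colR = colR'" "rowB = rowB'" "rowC = rowC'"
    for lhs rhs colL colL' colR colR' rowB rowB' rowC rowC' x1 x2 x3 x4 x5
    using that C unfolding Z_def W_def by (simp add: mult.assoc)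
  show ?thesis
    unfolding mixed_contraction_value unfolding dualv dual.mixed_contraction_value unfolding ex pa
    apply (rule combine[OF _ col[of l r s] col[of r l s] row[of a c b] row[of a b c],
        where ?x1.0 = "delta b s * exchange a c l r - delta a r * exchange b c l s"
          and ?x2.0 = "delta a l * delta c r * delta b s - delta a r * delta b l * delta c s"
          and ?x3.0 = "caterpillar a c l b r s - caterpillar a b r c l s - k * (exchange a c r s * delta b l - exchange a b l s * delta c r)"
          and ?x4.0 = "delta b l * exchange a c r s - delta c r * exchange a b l s"
          and ?x5.0 = "delta c s * exchange a b l r - delta a l * exchange b c r s"])
    apply (simp only: norm Z_def W_def)
    \<comment> \<open>As indeterminates, \<open>k - 1/2\<close> and \<open>k / 2\<close> are not
      expanded, so that both sides reach the same normal form.\<close>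
    apply (fold zb_def hb_def)
    apply (simp add: algebra_simps)
    done
qed

end

section \<open>From tensor diagrams to operators\<close>

lemma sum_UNIV_pair: "(\<Sum>p\<in>UNIV. f p) = (\<Sum>a\<in>UNIV. \<Sum>b\<in>UNIV. f (a :: 'a::finite, b :: 'b::finite))"
  by (simp add: sum.cartesian_product)

lemma on12_mult:
  "(on12 X ** Y) $ (p1, p2, p3) $ q = (\<Sum>x\<in>UNIV. \<Sum>y\<in>UNIV. X $ (p1, p2) $ (x, y) * Y $ (x, y, p3) $ q)"
  by (simp add: matrix_matrix_mult_def sum_UNIV_pair on12_def if_distrib if_distribR cong: if_cong)

lemma on23_mult:
  "(on23 X ** Y) $ (p1, p2, p3) $ q = (\<Sum>x\<in>UNIV. \<Sum>y\<in>UNIV. X $ (p2, p3) $ (x, y) * Y $ (p1, x, y) $ q)"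
proof -
  have "(on23 X ** Y) $ (p1, p2, p3) $ q
    = (\<Sum>w\<in>UNIV. \<Sum>x\<in>UNIV. \<Sum>y\<in>UNIV. (if p1 = w then 1 else 0) * X $ (p2, p3) $ (x, y) * Y $ (w, x, y) $ q)"
    unfolding matrix_matrix_mult_def sum_UNIV_pair on23_def by simp
  also have "\<dots> = (\<Sum>w\<in>UNIV. if p1 = w then (\<Sum>x\<in>UNIV. \<Sum>y\<in>UNIV. X $ (p2, p3) $ (x, y) * Y $ (w, x, y) $ q) else 0)"
    by (intro sum.cong refl) simp
  finally show ?thesis by simp
qed

lemma flip_op_mult: "(flip_op ** X) $ (p1, p2) $ q = X $ (p2, p1) $ q"
proof -
  have "(flip_op ** X) $ (p1, p2) $ q
    = (\<Sum>x\<in>UNIV. \<Sum>y\<in>UNIV. (if p1 = y \<and> p2 = x then 1 else 0) * X $ (x, y) $ q)"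
    unfolding matrix_matrix_mult_def sum_UNIV_pair flip_op_def by simp
  also have "\<dots> = (\<Sum>x\<in>UNIV. if p2 = x then (\<Sum>y\<in>UNIV. if p1 = y then X $ (x, y) $ q else 0) else 0)"
    by (intro sum.cong refl) (simp add: if_distrib if_distribR cong: if_cong)
  finally show ?thesis by simp
qed

text \<open>The flips merely permute output indices. Read from the output \<open>(l, a, b)\<close>
  of dual tensor V tensor V to the input \<open>(r, s, c)\<close>, both sides become a sum over
  three inner lines \<open>x, y, z\<close>: on the left \<open>S\<close> comes first in the
  composition, on the right last.\<close>

lemma yang_baxter_mixed_flip:
  assumes "\<And>a b c l r s.
    mixed_contraction (\<lambda>x y. M u $ (a, l) $ (x, y)) (\<lambda>y z. M (u + v) $ (b, y) $ (z, c)) (\<lambda>x z. S v $ (x, z) $ (r, s))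
    = mixed_contraction (\<lambda>x y. M u $ (x, y) $ (s, c)) (\<lambda>y z. M (u + v) $ (z, l) $ (r, y)) (\<lambda>x z. S v $ (a, b) $ (z, x))"
  shows "yang_baxter_mixed (\<lambda>u. flip_op ** M u) S u v"
proof -
  have "(on12 (flip_op ** M u) ** (on23 (flip_op ** M (u + v)) ** on12 (S v))) $ (l, a, b) $ (r, s, c)
     = (on23 (S v) ** (on12 (flip_op ** M (u + v)) ** on23 (flip_op ** M u))) $ (l, a, b) $ (r, s, c)" for l a b r s c
  proof -
    have "(on12 (flip_op ** M u) ** (on23 (flip_op ** M (u + v)) ** on12 (S v))) $ (l, a, b) $ (r, s, c)
      = (\<Sum>x\<in>UNIV. \<Sum>y\<in>UNIV. \<Sum>z\<in>UNIV. M u $ (a, l) $ (x, y) * M (u + v) $ (b, y) $ (z, c) * S v $ (x, z) $ (r, s))"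
      unfolding on12_mult on23_mult flip_op_mult
      by (simp add: on12_def sum_distrib_left if_distrib if_distribR mult.assoc cong: if_cong)
    also have "\<dots> = mixed_contraction (\<lambda>x y. M u $ (a, l) $ (x, y)) (\<lambda>y z. M (u + v) $ (b, y) $ (z, c)) (\<lambda>x z. S v $ (x, z) $ (r, s))"
      unfolding mixed_contraction_def by (intro sum.cong refl sum.swap)
    also have "\<dots> = mixed_contraction (\<lambda>x y. M u $ (x, y) $ (s, c)) (\<lambda>y z. M (u + v) $ (z, l) $ (r, y)) (\<lambda>x z. S v $ (a, b) $ (z, x))"
      by (rule assms)
    also have "\<dots> = (\<Sum>z\<in>UNIV. \<Sum>x\<in>UNIV. \<Sum>y\<in>UNIV. M u $ (x, y) $ (s, c) * M (u + v) $ (z, l) $ (r, y) * S v $ (a, b) $ (z, x))"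
      unfolding mixed_contraction_def by (rule sum.swap)
    also have "\<dots> = (on23 (S v) ** (on12 (flip_op ** M (u + v)) ** on23 (flip_op ** M u))) $ (l, a, b) $ (r, s, c)"
    proof -
      have 1: "(\<Sum>x'\<in>UNIV. \<Sum>y\<in>UNIV. M (u + v) $ (z, l) $ (x', y) * on23 (flip_op ** M u) $ (x', y, x) $ (r, s, c))
        = (\<Sum>y\<in>UNIV. M (u + v) $ (z, l) $ (r, y) * M u $ (x, y) $ (s, c))" for x z
      proof -
        have "(\<Sum>x'\<in>UNIV. \<Sum>y\<in>UNIV. M (u + v) $ (z, l) $ (x', y) * on23 (flip_op ** M u) $ (x', y, x) $ (r, s, c))
          = (\<Sum>x'\<in>UNIV. if x' = r then (\<Sum>y\<in>UNIV. M (u + v) $ (z, l) $ (x', y) * M u $ (x, y) $ (s, c)) else 0)"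
          by (intro sum.cong refl) (simp add: on23_def flip_op_mult)
        then show ?thesis by simp
      qed
      show ?thesis
        unfolding on12_mult on23_mult flip_op_mult 1
        by (simp add: sum_distrib_left mult_ac)
    qed
    finally show ?thesis .
  qed
  then show ?thesis
    unfolding yang_baxter_mixed_def vec_eq_iff by (simp add: split_paired_all matrix_mul_assoc)
qed

section \<open>The mixed R-matrices as combinations of 1, B and D\<close>

definition mixed_op :: "complex \<Rightarrow> complex \<Rightarrow> complex \<Rightarrow> 'n::finite cubic \<Rightarrow> 'n cubic \<Rightarrow> 'n op2"
  where "mixed_op \<alpha> \<beta> \<gamma> dU dL = \<alpha> *\<^sub>m mat 1 + \<beta> *\<^sub>m B_op dU dL + \<gamma> *\<^sub>m D_op"

lemma smult_mat_nth [simp]: "(c *\<^sub>m A) $ i $ j = c * A $ i $ j"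
  by (simp add: smult_mat_def)

text \<open>Here \<open>M = m + 2\<close> and \<open>p = u - m\<close>, so that
  \<open>p - 2 * (M - 2)\<close> is \<open>u - 3 * m\<close> and \<open>2 * (M - 2) - v\<close> is
  \<open>2 * m - v\<close>. Multiplying the rescaled operator by \<open>u - m\<close> removes its
  pole at \<open>m\<close>; the normalisation then survives only in \<open>s\<close> and
  \<open>s'\<close>, in each of which the conditions are homogeneous of degree one.\<close>

lemma yang_baxter_coefficients:
  fixes M p v s s' :: complex
  assumes nz: "M \<noteq> 0" "p - 2 * (M - 2) \<noteq> 0" "p + v - 2 * (M - 2) \<noteq> 0" "2 * (M - 2) - v \<noteq> 0"
  defines "\<alpha> \<equiv> s * p" and "\<alpha>' \<equiv> s' * (p + v)"
    and "\<beta> \<equiv> - (4 * M) * s" and "\<beta>' \<equiv> - (4 * M) * s'"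
    and "\<gamma> \<equiv> 4 * (s * p) / (p - 2 * (M - 2))" and "\<gamma>' \<equiv> 4 * (s' * (p + v)) / (p + v - 2 * (M - 2))"
    and "\<kappa> \<equiv> 4 * M * v / (2 * (M - 2) - v)" and "k \<equiv> 1 / M"
  shows "4 * \<beta> * \<alpha>' - 4 * \<alpha> * \<beta>' + k * v * \<beta> * \<beta>' = 0"
    "4 * \<gamma> * \<alpha>' - 4 * \<alpha> * \<gamma>' - v * \<gamma> * \<gamma>' = 0"
    "\<kappa> * \<beta> * \<alpha>' = \<kappa> * (\<alpha> * \<beta>' + \<beta> * \<beta>' * (k - 1/2)) + v * \<beta> * \<beta>'"
    "v * \<beta> * \<gamma>' + \<kappa> * \<alpha> * \<gamma>' + k * \<kappa> * \<beta> * \<alpha>' = 0"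
    "4 * \<beta> * \<gamma>' - 4 * \<gamma> * \<beta>' + v * \<gamma> * \<beta>'
      - \<kappa> * (\<gamma> * \<alpha>' + k / 2 * \<beta> * \<beta>' + \<gamma> * \<beta>' + \<gamma> * \<gamma>')
      - k * \<kappa> * (\<alpha> * \<beta>' + \<beta> * \<beta>' * (k - 1/2)) = 0"
proof -
  \<comment> \<open>The reciprocals become unknowns subject to polynomial relations, so that each
    condition is a question of ideal membership.\<close>
  define iq iq' iN iM where "iq = 1 / (p - 2 * (M - 2))" "iq' = 1 / (p + v - 2 * (M - 2))"
    "iN = 1 / (2 * (M - 2) - v)" "iM = 1 / M"
  note i = this
  have inv: "(p - 2 * (M - 2)) * iq = 1" "(p + v - 2 * (M - 2)) * iq' = 1" "(2 * (M - 2) - v) * iN = 1" "M * iM = 1"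
    using nz by (simp_all add: i)
  have co: "\<alpha> = s * p" "\<alpha>' = s' * (p + v)" "\<beta> = - 4 * M * s" "\<beta>' = - 4 * M * s'"
    "\<gamma> = 4 * (s * p) * iq" "\<gamma>' = 4 * (s' * (p + v)) * iq'" "\<kappa> = 4 * M * v * iN" "k = iM"
    by (simp_all add: \<alpha>_def \<alpha>'_def \<beta>_def \<beta>'_def \<gamma>_def \<gamma>'_def \<kappa>_def k_def i)
  show "4 * \<beta> * \<alpha>' - 4 * \<alpha> * \<beta>' + k * v * \<beta> * \<beta>' = 0" unfolding co using inv by algebra
  show "4 * \<gamma> * \<alpha>' - 4 * \<alpha> * \<gamma>' - v * \<gamma> * \<gamma>' = 0" unfolding co using inv by algebra
  show "\<kappa> * \<beta> * \<alpha>' = \<kappa> * (\<alpha> * \<beta>' + \<beta> * \<beta>' * (k - 1/2)) + v * \<beta> * \<beta>'" unfolding co using inv by algebra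
  show "v * \<beta> * \<gamma>' + \<kappa> * \<alpha> * \<gamma>' + k * \<kappa> * \<beta> * \<alpha>' = 0" unfolding co using inv by algebra
  show "4 * \<beta> * \<gamma>' - 4 * \<gamma> * \<beta>' + v * \<gamma> * \<beta>'
      - \<kappa> * (\<gamma> * \<alpha>' + k / 2 * \<beta> * \<beta>' + \<gamma> * \<beta>' + \<gamma> * \<gamma>')
      - k * \<kappa> * (\<alpha> * \<beta>' + \<beta> * \<beta>' * (k - 1/2)) = 0" unfolding co using inv by algebra
qed

definition tensor :: "'n::finite cubic \<Rightarrow> 'n \<Rightarrow> 'n \<Rightarrow> 'n \<Rightarrow> complex"
  where "tensor t a b c = t $ (a, b, c)"

text \<open>Each side of the equation has one mixed factor at \<open>u\<close> and one at
  \<open>u + v\<close>, so an arbitrary scalar function \<open>s\<close> is harmless. The choices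
  \<open>1 / (u - m)\<close> and \<open>1 / (u - m - 4)\<close> produce the two forms of the mixed
  R-matrix.\<close>

lemma yang_baxter_mixed_op:
  fixes dU dL :: "'n::finite cubic" and s :: "complex \<Rightarrow> complex"
  assumes "cubic_pair (tensor dU) (tensor dL) (1 / (of_nat m + 2))"
    and nz: "u \<noteq> 3 * of_nat m" "u + v \<noteq> 3 * of_nat m" "v \<noteq> 2 * of_nat m"
  shows "yang_baxter_mixed
    (\<lambda>u. flip_op ** mixed_op (s u * (u - of_nat m)) (- (4 * (of_nat m + 2)) * s u)
      (4 * (s u * (u - of_nat m)) / (u - 3 * of_nat m)) dU dL) (R_VV m dU dL) u v"
proof -
  interpret cubic_pair "tensor dU" "tensor dL" "1 / (of_nat m + 2)" by fact
  have one: "(mat 1 :: 'n op2) $ (a, l) $ (x, y) = delta a x * delta l y" for a l x y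
    by (auto simp: mat_def delta_def)
  have D: "(D_op :: 'n op2) $ (a, l) $ (x, y) = delta a l * delta x y" for a l x y
    by (auto simp: D_op_def delta_def)
  have flip: "(flip_op :: 'n op2) $ (a, b) $ (r, s) = delta a s * delta b r" for a b r s
    by (auto simp: flip_op_def delta_def)
  have B: "B_op dU dL $ (a, l) $ (x, y) = exchange a y x l" for a l x y
    by (simp add: B_op_def exchange_def tensor_def)
  have K: "K_op dU dL $ (a, b) $ (r, s) = exchange a b r s" for a b r s
    by (simp add: K_op_def exchange_def tensor_def)
  have M: "mixed_op \<alpha> \<beta> \<gamma> dU dL $ (a, l) $ (x, y) =
      \<alpha> * (delta a x * delta l y) + \<beta> * exchange a y x l + \<gamma> * (delta a l * delta x y)"
    for \<alpha> \<beta> \<gamma> a l x y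
    by (simp only: mixed_op_def vector_add_component smult_mat_nth one D B)
  have S: "R_VV m dU dL v $ (x, z) $ (r, s) = 4 * (delta x r * delta z s) + (- v) * (delta x s * delta z r)
      + (4 * of_nat m + 8) * v / (2 * of_nat m - v) * exchange x z r s" for x z r s
    by (simp add: R_VV_def one flip K)
  have M': "mixed_op \<alpha> \<beta> \<gamma> dU dL $ (a, l) $ (x, y) =
      \<alpha> * (delta x a * delta y l) + \<beta> * exchange a y x l + \<gamma> * (delta x y * delta a l)"
    for \<alpha> \<beta> \<gamma> a l x y
    unfolding M by (simp add: delta_commute mult.commute)
  have S': "R_VV m dU dL v $ (x, z) $ (r, s) = 4 * (delta s z * delta r x) + (- v) * (delta s x * delta r z)
      + (4 * of_nat m + 8) * v / (2 * of_nat m - v) * exchange z x s r" for x z r s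
    unfolding S by (simp add: delta_commute mult.commute exchange_sym)
  define M2 :: complex where "M2 = of_nat m + 2"
  define p where "p = u - of_nat m"
  have "M2 \<noteq> 0" unfolding M2_def
    using of_nat_neq_0[of "m + 1", where ?'a = complex] by (simp add: add.commute)
  have eqs: "u - of_nat m = p" "u + v - of_nat m = p + v"
    "u - 3 * of_nat m = p - 2 * (M2 - 2)" "u + v - 3 * of_nat m = p + v - 2 * (M2 - 2)"
    "2 * of_nat m - v = 2 * (M2 - 2) - v" "of_nat m + 2 = M2" "4 * of_nat m + 8 = 4 * M2"
    by (simp_all add: p_def M2_def)
  have nz': "p - 2 * (M2 - 2) \<noteq> 0" "p + v - 2 * (M2 - 2) \<noteq> 0" "2 * (M2 - 2) - v \<noteq> 0"
    unfolding eqs[symmetric] using nz by simp_all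
  note eq = yang_baxter_contraction[unfolded eqs, OF yang_baxter_coefficients[OF \<open>M2 \<noteq> 0\<close> nz', of "s u" "s (u + v)"]]
  let ?M = "\<lambda>u. mixed_op (s u * (u - of_nat m)) (- (4 * (of_nat m + 2)) * s u)
      (4 * (s u * (u - of_nat m)) / (u - 3 * of_nat m)) dU dL"
  let ?S = "R_VV m dU dL v"
  show ?thesis
  proof (rule yang_baxter_mixed_flip)
    show "mixed_contraction (\<lambda>x y. ?M u $ (a, l) $ (x, y)) (\<lambda>y z. ?M (u + v) $ (b, y) $ (z, c)) (\<lambda>x z. ?S $ (x, z) $ (r, t))
      = mixed_contraction (\<lambda>x y. ?M u $ (x, y) $ (t, c)) (\<lambda>y z. ?M (u + v) $ (z, l) $ (r, y)) (\<lambda>x z. ?S $ (a, b) $ (z, x))"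
      (is "?l = ?r") for a b c l r t
    proof -
      let ?\<gamma> = "4 * (s u * p) / (p - 2 * (M2 - 2))" and ?\<gamma>' = "4 * (s (u + v) * (p + v)) / (p + v - 2 * (M2 - 2))"
      have l: "?l = mixed_contraction
        (\<lambda>x y. s u * p * (delta a x * delta l y) + (- (4 * M2) * s u) * exchange a y x l + ?\<gamma> * (delta a l * delta x y))
        (\<lambda>y z. s (u + v) * (p + v) * (delta b z * delta y c) + (- (4 * M2) * s (u + v)) * exchange b c z y + ?\<gamma>' * (delta b y * delta z c))
        (\<lambda>x z. 4 * (delta x r * delta z t) + (- v) * (delta x t * delta z r) + (4 * M2 * v / (2 * (M2 - 2) - v)) * exchange x z r t)"
        unfolding M S eqs ..
      have r: "?r = mixed_contraction
        (\<lambda>x y. s u * p * (delta t x * delta c y) + (- (4 * M2) * s u) * exchange x c t y + ?\<gamma> * (delta t c * delta x y))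
        (\<lambda>y z. s (u + v) * (p + v) * (delta r z * delta y l) + (- (4 * M2) * s (u + v)) * exchange z y r l + ?\<gamma>' * (delta r y * delta z l))
        (\<lambda>x z. 4 * (delta x b * delta z a) + (- v) * (delta x a * delta z b) + (4 * M2 * v / (2 * (M2 - 2) - v)) * exchange b a x z)"
        unfolding M' S' eqs ..
      show ?thesis unfolding l r by (rule eq)
    qed
  qed
qed

lemma yang_baxter_mixed_cong:
  assumes "R u = R' u" "R (u + v) = R' (u + v)"
  shows "yang_baxter_mixed R S u v = yang_baxter_mixed R' S u v"
  unfolding yang_baxter_mixed_def assms ..

lemma R_mixed_rescaled_eq:
  assumes "u \<noteq> of_nat m"
  shows "R_mixed_rescaled m dU dL u = flip_op ** mixed_op (1 / (u - of_nat m) * (u - of_nat m))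
    (- (4 * (of_nat m + 2)) * (1 / (u - of_nat m))) (4 * (1 / (u - of_nat m) * (u - of_nat m)) / (u - 3 * of_nat m)) dU dL"
proof -
  have 1: "1 / (u - of_nat m) * (u - of_nat m) = 1"
    using assms by simp
  have "mat 1 - ((4 * (of_nat m + 2)) / (u - of_nat m)) *\<^sub>m B_op dU dL + (4 / (u - 3 * of_nat m)) *\<^sub>m D_op
    = mixed_op 1 (- (4 * (of_nat m + 2)) * (1 / (u - of_nat m))) (4 * 1 / (u - 3 * of_nat m)) dU dL"
    by (simp add: mixed_op_def vec_eq_iff divide_inverse algebra_simps)
  then show ?thesis
    unfolding 1 by (simp only: R_mixed_rescaled_def)
qed

text \<open>The coefficients of 1, B and D are compared separately. That of 1 is (m+2)/(m+4) +
  2(u+m+4)/((m+4)(u-m-4)) = (u-m)/(u-m-4), the inverse of the rescaling factor.\<close>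

lemma R_mixed_eq:
  fixes dU dL :: "'n::finite cubic"
  assumes u: "u \<noteq> of_nat m + 4" "u \<noteq> 3 * of_nat m"
  shows "R_mixed m dU dL u = flip_op ** mixed_op (1 / (u - of_nat m - 4) * (u - of_nat m))
    (- (4 * (of_nat m + 2)) * (1 / (u - of_nat m - 4)))
    (4 * (1 / (u - of_nat m - 4) * (u - of_nat m)) / (u - 3 * of_nat m)) dU dL"
proof -
  define M :: complex where "M = of_nat m"
  have "M + 4 = of_nat (Suc (m + 3))" "M + 1 = of_nat (Suc m)"
    by (simp_all add: M_def algebra_simps)
  then have "M + 4 \<noteq> 0" "M + 1 \<noteq> 0"
    using of_nat_neq_0[where ?'a = complex] by metis+
  moreover have "u - M - 4 \<noteq> 0" "u - 3 * M \<noteq> 0"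
    using u by (simp_all add: M_def diff_diff_eq)
  ultimately have inv: "inverse (M + 4) * (M + 4) = 1" "inverse (M + 1) * (M + 1) = 1"
    "inverse (u - M - 4) * (u - M - 4) = 1" "inverse (u - 3 * M) * (u - 3 * M) = 1"
    by simp_all
  have 3: "inverse (3 * M + 3) = inverse (M + 1) / 3"
    by (metis distrib_left_numeral inverse_mult_distrib mult.commute mult.right_neutral inverse_eq_divide divide_inverse)
  have coeff: "(M + 2) / (M + 4) * (o1 - 1 / (M + 1) * d + 2 * b)
    + (u + M + 4) / (u - M - 4) * (2 / (M + 4) * (o1 + 1 / 3 * d - (M + 2) * b))
    + (u + M + 4) / (u - M - 4) * ((u + 3 * M) / (u - 3 * M)) * (1 / (3 * M + 3) * d)
    = 1 / (u - M - 4) * (u - M) * o1 + - (4 * (M + 2)) * (1 / (u - M - 4)) * b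
      + 4 * (1 / (u - M - 4) * (u - M)) / (u - 3 * M) * d"
    for o1 b d :: complex
  proof -
    have "(M + 2) / (M + 4) + (u + M + 4) / (u - M - 4) * (2 / (M + 4)) = 1 / (u - M - 4) * (u - M)"
      unfolding divide_inverse using inv by algebra
    moreover have "(M + 2) / (M + 4) * 2 - (u + M + 4) / (u - M - 4) * (2 / (M + 4)) * (M + 2) = - (4 * (M + 2)) * (1 / (u - M - 4))"
      unfolding divide_inverse using inv by algebra
    moreover have "- (M + 2) / (M + 4) * (1 / (M + 1)) + (u + M + 4) / (u - M - 4) * (2 / (M + 4)) / 3
      + (u + M + 4) / (u - M - 4) * ((u + 3 * M) / (u - 3 * M)) * (1 / (3 * M + 3))
      = 4 * (1 / (u - M - 4) * (u - M)) / (u - 3 * M)"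
      unfolding divide_inverse 3 using inv by algebra
    ultimately show ?thesis by algebra
  qed
  show ?thesis
    unfolding R_mixed_def P1_op_def P2_op_def P3_op_def mixed_op_def M_def[symmetric]
    by (rule arg_cong[of _ _ "(**) flip_op"])
      (simp only: vec_eq_iff vector_add_component vector_minus_component smult_mat_nth coeff simp_thms)
qed

lemma smult_matrix_mult: "c *\<^sub>m (A ** B) = A ** (c *\<^sub>m B)"
  by (simp add: vec_eq_iff matrix_matrix_mult_def sum_distrib_left mult_ac)

lemma R_mixed_rescaled_eq_smult:
  assumes "u \<notin> {of_nat m, of_nat m + 4, 3 * of_nat m}"
  shows "((u - of_nat m - 4) / (u - of_nat m)) *\<^sub>m R_mixed m dU dL u = R_mixed_rescaled m dU dL u"
proof -
  have nz: "u - of_nat m - 4 \<noteq> 0" "u - of_nat m \<noteq> 0"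
    using assms by (simp_all add: diff_diff_eq)
  have smult: "c *\<^sub>m mixed_op \<alpha> \<beta> \<gamma> dU dL = mixed_op (c * \<alpha>) (c * \<beta>) (c * \<gamma>) dU dL" for c \<alpha> \<beta> \<gamma>
    by (simp add: mixed_op_def vec_eq_iff algebra_simps)
  have R: "R_mixed m dU dL u = flip_op ** mixed_op (1 / (u - of_nat m - 4) * (u - of_nat m))
    (- (4 * (of_nat m + 2)) * (1 / (u - of_nat m - 4)))
    (4 * (1 / (u - of_nat m - 4) * (u - of_nat m)) / (u - 3 * of_nat m)) dU dL"
    by (rule R_mixed_eq) (use assms in auto)
  have R': "R_mixed_rescaled m dU dL u = flip_op ** mixed_op (1 / (u - of_nat m) * (u - of_nat m))
    (- (4 * (of_nat m + 2)) * (1 / (u - of_nat m))) (4 * (1 / (u - of_nat m) * (u - of_nat m)) / (u - 3 * of_nat m)) dU dL"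
    by (rule R_mixed_rescaled_eq) (use assms in auto)
  define w where "w = u - of_nat m"
  have "w - 4 \<noteq> 0" "w \<noteq> 0"
    using nz by (simp_all add: w_def)
  then have coeff: "(w - 4) / w * (1 / (w - 4) * w) = 1 / w * w" "(w - 4) / w * (x * (1 / (w - 4))) = x * (1 / w)"
    "(w - 4) / w * (4 * (1 / (w - 4) * w) / x) = 4 * (1 / w * w) / x" for x
    by (simp_all add: divide_simps)
  show ?thesis
    unfolding R R' smult_matrix_mult smult
    by (simp only: w_def[symmetric] coeff)
qed

lemma corollary_of_cubic_pair:
  fixes dU dL :: "'n::finite cubic"
  assumes "cubic_pair (tensor dU) (tensor dL) (1 / (of_nat m + 2))"
  shows "(\<forall>u. u \<notin> {of_nat m, of_nat m + 4, 3 * of_nat m} \<longrightarrow>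
            ((u - of_nat m - 4) / (u - of_nat m)) *\<^sub>m R_mixed m dU dL u = R_mixed_rescaled m dU dL u)
       \<and> (\<forall>u v. u \<notin> {of_nat m + 4, 3 * of_nat m} \<and> u + v \<notin> {of_nat m + 4, 3 * of_nat m}
              \<and> v \<noteq> 2 * of_nat m \<longrightarrow>
            yang_baxter_mixed (R_mixed m dU dL) (R_VV m dU dL) u v)
       \<and> (\<forall>u v. u \<notin> {of_nat m, 3 * of_nat m} \<and> u + v \<notin> {of_nat m, 3 * of_nat m}
              \<and> v \<noteq> 2 * of_nat m \<longrightarrow>
            yang_baxter_mixed (R_mixed_rescaled m dU dL) (R_VV m dU dL) u v)"
proof (intro conjI allI impI)
  fix u :: complex assume "u \<notin> {of_nat m, of_nat m + 4, 3 * of_nat m}"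
  then show "((u - of_nat m - 4) / (u - of_nat m)) *\<^sub>m R_mixed m dU dL u = R_mixed_rescaled m dU dL u"
    by (rule R_mixed_rescaled_eq_smult)
next
  fix u v :: complex
  assume a: "u \<notin> {of_nat m + 4, 3 * of_nat m} \<and> u + v \<notin> {of_nat m + 4, 3 * of_nat m} \<and> v \<noteq> 2 * of_nat m"
  show "yang_baxter_mixed (R_mixed m dU dL) (R_VV m dU dL) u v"
    by (rule yang_baxter_mixed_cong[THEN iffD2,
          OF _ _ yang_baxter_mixed_op[OF assms, where s = "\<lambda>u. 1 / (u - of_nat m - 4)"]])
      ((rule R_mixed_eq; use a in simp)+, (use a in auto))
next
  fix u v :: complex
  assume a: "u \<notin> {of_nat m, 3 * of_nat m} \<and> u + v \<notin> {of_nat m, 3 * of_nat m} \<and> v \<noteq> 2 * of_nat m"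
  show "yang_baxter_mixed (R_mixed_rescaled m dU dL) (R_VV m dU dL) u v"
    by (rule yang_baxter_mixed_cong[THEN iffD2,
          OF _ _ yang_baxter_mixed_op[OF assms, where s = "\<lambda>u. 1 / (u - of_nat m)"]])
      ((rule R_mixed_rescaled_eq; use a in simp)+, (use a in auto))
qed

section \<open>Polarisation of the adjoint identity\<close>

definition sharp :: "'i set \<Rightarrow> ('i \<Rightarrow> 'i \<Rightarrow> 'i \<Rightarrow> complex) \<Rightarrow> ('i \<Rightarrow> complex) \<Rightarrow> 'i \<Rightarrow> complex"
  where "sharp I t x a = (\<Sum>b\<in>I. \<Sum>c\<in>I. t a b c * (x b * x c))"

text \<open>The identity \<open>(x\<^sup>#)\<^sup># = \<mu> N(x) x\<close>, where \<open>N\<close> and \<open>#\<close> on the right come from \<open>t\<close> and the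
  outer \<open>#\<close> from \<open>s\<close>.\<close>

definition adjoint_identity ::
    "'i set \<Rightarrow> ('i \<Rightarrow> 'i \<Rightarrow> 'i \<Rightarrow> complex) \<Rightarrow> ('i \<Rightarrow> 'i \<Rightarrow> 'i \<Rightarrow> complex) \<Rightarrow> complex \<Rightarrow> bool"
  where "adjoint_identity I s t \<mu> \<longleftrightarrow>
    (\<forall>x. \<forall>a\<in>I. sharp I s (sharp I t x) a = \<mu> * (\<Sum>b\<in>I. x b * sharp I t x b) * x a)"

lemma quartic_polarisation:
  fixes q :: "('i \<Rightarrow> complex) \<Rightarrow> ('i \<Rightarrow> complex) \<Rightarrow> ('i \<Rightarrow> complex) \<Rightarrow> ('i \<Rightarrow> complex) \<Rightarrow> complex"
  assumes add: "\<And>x x' y z w. q (\<lambda>i. x i + x' i) y z w = q x y z w + q x' y z w"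
    and scale: "\<And>c x y z w. q (\<lambda>i. c * x i) y z w = c * q x y z w"
    and sym: "\<And>x y z w. q y x z w = q x y z w" "\<And>x y z w. q x z y w = q x y z w" "\<And>x y z w. q x y w z = q x y z w"
    and zero: "\<And>x. q x x x x = 0"
  shows "q x y z w = 0"
proof -
  have add': "q y (\<lambda>i. x i + x' i) z w = q y x z w + q y x' z w"
    "q y z (\<lambda>i. x i + x' i) w = q y z x w + q y z x' w"
    "q y z w (\<lambda>i. x i + x' i) = q y z w x + q y z w x'" for x x' y z w
    using add sym by metis+
  have scale': "q y (\<lambda>i. c * x i) z w = c * q y x z w"
    "q y z (\<lambda>i. c * x i) w = c * q y z x w"
    "q y z w (\<lambda>i. c * x i) = c * q y z w x" for x y z w c
    using scale sym by metis+
  note lin = add add' scale scale'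
  have s4: "q x x y x = q x x x y" "q x y x x = q x x x y" "q y x x x = q x x x y"
    "q x y x y = q x x y y" "q x y y x = q x x y y" "q y x x y = q x x y y" "q y x y x = q x x y y" "q y y x x = q x x y y"
    "q y x y y = q x y y y" "q y y x y = q x y y y" "q y y y x = q x y y y" for x y
    using sym by metis+
  have 4: "q x x x y = 0" for x y
  proof -
    define A B C where "A = q x x x y" and "B = q x x y y" and "C = q x y y y"
    \<comment> \<open>The terms of degree 0 and 4 in \<open>t\<close> are diagonal values and
      vanish, so three values of \<open>t\<close> separate the three unknowns.\<close>
    have "4 * t * A + 6 * t ^ 2 * B + 4 * t ^ 3 * C = 0" for t
      using zero[of "\<lambda>i. x i + t * y i"] unfolding lin zero s4 A_def B_def C_def
      by (simp add: algebra_simps power2_eq_square power3_eq_cube)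
    from this[of 1] this[of "-1"] this[of 2] have "A = 0" by simp algebra
    then show ?thesis by (simp add: A_def)
  qed
  have s3: "q x y x z = q x x y z" "q y x x z = q x x y z" "q y x y z = q x y y z" "q y y x z = q x y y z" for x y z
    using sym by metis+
  have 3: "q x x y z = 0" for x y z
  proof -
    define A B where "A = q x x y z" and "B = q x y y z"
    \<comment> \<open>Now the terms of degree 0 and 3 vanish by the previous step, and two values of
      \<open>t\<close> suffice.\<close>
    have "3 * t * A + 3 * t ^ 2 * B = 0" for t
      using 4[of "\<lambda>i. x i + t * y i" z] unfolding lin 4 s3 A_def B_def
      by (simp add: algebra_simps power2_eq_square)
    from this[of 1] this[of "-1"] have "A = 0" by simp
    then show ?thesis by (simp add: A_def)
  qed
  show ?thesis
    using 3[of "\<lambda>i. x i + y i" z w] sym(1)[of y x] unfolding lin 3 by simp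
qed

definition quartic :: "('n::finite \<Rightarrow> 'n \<Rightarrow> 'n \<Rightarrow> 'n \<Rightarrow> complex) \<Rightarrow>
    ('n \<Rightarrow> complex) \<Rightarrow> ('n \<Rightarrow> complex) \<Rightarrow> ('n \<Rightarrow> complex) \<Rightarrow> ('n \<Rightarrow> complex) \<Rightarrow> complex"
  where "quartic S x y z w =
    (\<Sum>a\<in>UNIV. \<Sum>b\<in>UNIV. \<Sum>c\<in>UNIV. \<Sum>d\<in>UNIV. S a b c d * (x a * y b * z c * w d))"

lemma symmetric_tensor4_eq_0:
  fixes S :: "'n::finite \<Rightarrow> 'n \<Rightarrow> 'n \<Rightarrow> 'n \<Rightarrow> complex"
  assumes sym: "\<And>a b c d. S b a c d = S a b c d" "\<And>a b c d. S a c b d = S a b c d" "\<And>a b c d. S a b d c = S a b c d"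
    and zero: "\<And>x. quartic S x x x x = 0"
  shows "S a b c d = 0"
proof -
  have "quartic S x y z w = 0" for x y z w
  proof (rule quartic_polarisation[of "quartic S"])
    show "quartic S (\<lambda>i. x i + x' i) y z w = quartic S x y z w + quartic S x' y z w" for x x' y z w
      unfolding quartic_def sum.distrib[symmetric] by (simp add: algebra_simps)
    show "quartic S (\<lambda>i. c * x i) y z w = c * quartic S x y z w" for c x y z w
      unfolding quartic_def sum_distrib_left by (simp add: mult_ac)
    show "quartic S y x z w = quartic S x y z w" for x y z w
      unfolding quartic_def by (subst sum.swap) (simp add: sym mult_ac)
    show "quartic S x z y w = quartic S x y z w" for x y z w
      unfolding quartic_def
      by (rule sum.cong[OF refl], subst sum.swap) (simp add: sym mult_ac)
    show "quartic S x y w z = quartic S x y z w" for x y z w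
      unfolding quartic_def
      by (rule sum.cong[OF refl], rule sum.cong[OF refl], subst sum.swap) (simp add: sym mult_ac)
  qed (rule zero)
  from this[of "delta a" "delta b" "delta c" "delta d"] show ?thesis
    unfolding quartic_def mult.assoc[symmetric] by (simp only: sum_delta_complex sum_distrib_right[symmetric])
qed

lemma springer_of_adjoint_identity:
  fixes U L :: "'n::finite \<Rightarrow> 'n \<Rightarrow> 'n \<Rightarrow> complex"
  assumes U: "\<And>a b c. U b a c = U a b c" "\<And>a b c. U a c b = U a b c"
    and L: "\<And>a b c. L b a c = L a b c" "\<And>a b c. L a c b = L a b c"
    and normalised: "\<And>a b. (\<Sum>x\<in>UNIV. \<Sum>y\<in>UNIV. U a x y * L b x y) = delta a b"
    and adj: "adjoint_identity UNIV U L \<mu>"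
  shows "(\<Sum>e\<in>UNIV. \<Sum>f\<in>UNIV. U g e f *
        (L e a b * L f c d + L e a c * L f b d + L e a d * L f b c))
      = 3 / (of_nat CARD('n) + 3) * (delta g a * L b c d + delta g b * L a c d + delta g c * L a b d + delta g d * L a b c)"
proof -
  \<comment> \<open>On the diagonal each of the three terms of \<open>P\<close> becomes \<mu> N(x)
    x_g and each of the four terms of \<open>Q\<close> becomes N(x) x_g, which dictates the
    quotient.\<close>
  define k where "k = 3 * \<mu> / 4"
  define P where "P g a b c d = (\<Sum>e\<in>UNIV. \<Sum>f\<in>UNIV. U g e f *
        (L e a b * L f c d + L e a c * L f b d + L e a d * L f b c))" for g a b c d
  define Q where "Q g a b c d = delta g a * L b c d + delta g b * L a c d + delta g c * L a b d + delta g d * L a b c"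
    for g a b c d
  have Lsym: "L a c b = L a b c" "L b a c = L a b c" "L b c a = L a b c" "L c a b = L a b c" "L c b a = L a b c" for a b c
    using L by metis+
  have swap: "(\<Sum>e\<in>UNIV. \<Sum>f\<in>UNIV. U g e f * (L f a b * L e c d)) = (\<Sum>e\<in>UNIV. \<Sum>f\<in>UNIV. U g e f * (L e a b * L f c d))"
    for g a b c d
    by (subst sum.swap) (simp add: U)
  have P: "P g a b c d = (\<Sum>e\<in>UNIV. \<Sum>f\<in>UNIV. U g e f * (L e a b * L f c d))
    + (\<Sum>e\<in>UNIV. \<Sum>f\<in>UNIV. U g e f * (L e a c * L f b d))
    + (\<Sum>e\<in>UNIV. \<Sum>f\<in>UNIV. U g e f * (L e a d * L f b c))" for g a b c d
    by (simp add: P_def distrib_left sum.distrib)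
  have eq: "P g a b c d - k * Q g a b c d = 0" for g a b c d
  proof (rule symmetric_tensor4_eq_0[of "\<lambda>a b c d. P g a b c d - k * Q g a b c d"])
    show "P g b a c d - k * Q g b a c d = P g a b c d - k * Q g a b c d" for a b c d
      unfolding P Q_def swap[of g b d a c, symmetric] swap[of g a d b c] 
      using swap[of g b c a d] swap[of g b d a c] by (simp add: Lsym mult.commute add_ac)
    show "P g a c b d - k * Q g a c b d = P g a b c d - k * Q g a b c d" for a b c d
      unfolding P Q_def by (simp add: Lsym add_ac)
    show "P g a b d c - k * Q g a b d c = P g a b c d - k * Q g a b c d" for a b c d
      unfolding P Q_def by (simp add: Lsym add_ac)
  next
    fix x
    define s where "s = sharp UNIV L x"
    define N where "N = (\<Sum>b\<in>UNIV. x b * s b)"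
    have N: "(\<Sum>b\<in>UNIV. \<Sum>c\<in>UNIV. \<Sum>d\<in>UNIV. L b c d * (x b * x c * x d)) = N"
      by (simp add: N_def s_def sharp_def sum_distrib_left mult_ac)
    have lin: "quartic (\<lambda>a b c d. S a b c d + S' a b c d) x x x x = quartic S x x x x + quartic S' x x x x"
      "quartic (\<lambda>a b c d. t * S a b c d) x x x x = t * quartic S x x x x"
      "quartic (\<lambda>a b c d. S a b c d - S' a b c d) x x x x = quartic S x x x x - quartic S' x x x x" for S S' t
      by (simp_all add: quartic_def sum.distrib sum_subtractf distrib_right left_diff_distrib sum_distrib_left mult.assoc)
    have perm: "quartic (\<lambda>a b c d. S a c b d) x x x x = quartic S x x x x"
      "quartic (\<lambda>a b c d. S b a c d) x x x x = quartic S x x x x"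
      "quartic (\<lambda>a b c d. S a b d c) x x x x = quartic S x x x x" for S
    proof -
      show "quartic (\<lambda>a b c d. S a c b d) x x x x = quartic S x x x x"
        unfolding quartic_def by (rule sum.cong[OF refl], subst sum.swap) (simp add: mult_ac)
      show "quartic (\<lambda>a b c d. S b a c d) x x x x = quartic S x x x x"
        unfolding quartic_def by (subst sum.swap) (simp add: mult_ac)
      show "quartic (\<lambda>a b c d. S a b d c) x x x x = quartic S x x x x"
        unfolding quartic_def by (rule sum.cong[OF refl], rule sum.cong[OF refl], subst sum.swap) (simp add: mult_ac)
    qed
    define P0 where "P0 a b c d = (\<Sum>e\<in>UNIV. \<Sum>f\<in>UNIV. U g e f * (L e a b * L f c d))" for a b c d
    define Q0 where "Q0 a b c d = delta g a * L b c d" for a b c d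
    have "quartic P0 x x x x = (\<Sum>e\<in>UNIV. \<Sum>f\<in>UNIV. U g e f * (s e * s f))"
    proof -
      have "quartic P0 x x x x = (\<Sum>(a, b, c, d)\<in>UNIV. \<Sum>(e, f)\<in>UNIV. U g e f * ((L e a b * (x a * x b)) * (L f c d * (x c * x d))))"
        unfolding quartic_def P0_def sum_UNIV_pair prod.case sum_distrib_right by (simp add: mult_ac)
      also have "\<dots> = (\<Sum>(e, f)\<in>UNIV. \<Sum>(a, b, c, d)\<in>UNIV. U g e f * ((L e a b * (x a * x b)) * (L f c d * (x c * x d))))"
        unfolding split_def by (rule sum.swap)
      also have "\<dots> = (\<Sum>e\<in>UNIV. \<Sum>f\<in>UNIV. U g e f * (s e * s f))"
        unfolding s_def sharp_def sum_UNIV_pair prod.case unfolding sum_distrib_right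
        unfolding sum_distrib_left ..
      finally show ?thesis .
    qed
    also have "\<dots> = \<mu> * N * x g"
      using adj unfolding adjoint_identity_def by (simp add: sharp_def s_def N_def)
    finally have qP: "quartic P0 x x x x = \<mu> * N * x g" .
    have "quartic Q0 x x x x = (\<Sum>a\<in>UNIV. delta g a * (x a * (\<Sum>b\<in>UNIV. \<Sum>c\<in>UNIV. \<Sum>d\<in>UNIV. L b c d * (x b * x c * x d))))"
      unfolding quartic_def Q0_def sum_distrib_left by (simp add: mult_ac)
    then have qQ: "quartic Q0 x x x x = x g * N"
      unfolding N sum_delta_complex .
    have "P g a b c d = P0 a b c d + P0 a c b d + P0 a d b c" for a b c d
      by (simp add: P P0_def)
    moreover have "Q g a b c d = Q0 a b c d + Q0 b a c d + Q0 c a b d + Q0 d a b c" for a b c d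
      by (simp add: Q_def Q0_def)
    ultimately have "quartic (\<lambda>a b c d. P g a b c d - k * Q g a b c d) x x x x
      = quartic (\<lambda>a b c d. P0 a b c d + P0 a c b d + P0 a d b c - k * (Q0 a b c d + Q0 b a c d + Q0 c a b d + Q0 d a b c)) x x x x"
      by simp
    also have "\<dots> = 3 * quartic P0 x x x x - k * (4 * quartic Q0 x x x x)"
      using perm(1)[of P0] perm(3)[of "\<lambda>a b c d. P0 a c b d"] perm(2)[of Q0] perm(1)[of "\<lambda>a b c d. Q0 b a c d"]
        perm(3)[of "\<lambda>a b c d. Q0 c a b d"]
      by (simp add: lin)
    finally show "quartic (\<lambda>a b c d. P g a b c d - k * Q g a b c d) x x x x = 0"
      unfolding qP qQ by (simp add: k_def)
  qed
  \<comment> \<open>Putting \<open>g = a\<close> and summing gives a value of \<open>k\<close> free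
    of \<mu>: normalisation collapses each of the three terms of \<open>P\<close> to
    \<open>L b c d\<close>, while \<open>Q\<close> contributes n + 1 + 1 + 1 copies of it.\<close>
  have "k = 3 / (of_nat CARD('n) + 3)"
  proof -
    have "\<exists>b c d. L b c d \<noteq> 0"
    proof (rule ccontr)
      assume "\<not> ?thesis"
      then have "delta (undefined::'n) undefined = 0"
        using normalised[of undefined undefined] by simp
      then show False by (simp add: delta_def)
    qed
    then obtain b c d where "L b c d \<noteq> 0" by blast
    have row: "(\<Sum>a\<in>UNIV. \<Sum>e\<in>UNIV. \<Sum>f\<in>UNIV. U a e f * (L e a b * L f c d)) = L b c d" for b c d
    proof -
      have "(\<Sum>a\<in>UNIV. \<Sum>e\<in>UNIV. \<Sum>f\<in>UNIV. U a e f * (L e a b * L f c d))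
        = (\<Sum>f\<in>UNIV. \<Sum>a\<in>UNIV. \<Sum>e\<in>UNIV. (U f a e * L b a e) * L f c d)"
      proof -
        have eq: "U a e f * (L e a b * L f c d) = (U f a e * L b a e) * L f c d" for a e f
        proof -
          have "U f a e = U a f e" by (rule U(1))
          also have "\<dots> = U a e f" by (rule U(2))
          finally show ?thesis by (simp only: Lsym(5)[of e a b] mult.assoc)
        qed
        have "(\<Sum>a\<in>UNIV. \<Sum>e\<in>UNIV. \<Sum>f\<in>UNIV. U a e f * (L e a b * L f c d))
          = (\<Sum>a\<in>UNIV. \<Sum>f\<in>UNIV. \<Sum>e\<in>UNIV. (U f a e * L b a e) * L f c d)"
          unfolding eq by (rule sum.cong[OF refl], rule sum.swap)
        also have "\<dots> = (\<Sum>f\<in>UNIV. \<Sum>a\<in>UNIV. \<Sum>e\<in>UNIV. (U f a e * L b a e) * L f c d)"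
          by (rule sum.swap)
        finally show ?thesis .
      qed
      also have "\<dots> = (\<Sum>f\<in>UNIV. delta f b * L f c d)"
        by (simp only: sum_distrib_right[symmetric] normalised)
      finally show ?thesis by (simp only: sum_delta_complex)
    qed
    have "(\<Sum>a\<in>UNIV. P a a b c d) = 3 * L b c d"
      unfolding P sum.distrib row by (simp add: Lsym)
    moreover have "(\<Sum>a\<in>UNIV. Q a a b c d) = (of_nat CARD('n) + 3) * L b c d"
      unfolding Q_def sum.distrib sum_delta_complex by (simp add: delta_def Lsym algebra_simps)
    moreover have "(\<Sum>a\<in>UNIV. P a a b c d) = k * (\<Sum>a\<in>UNIV. Q a a b c d)"
      using eq by (simp add: sum_distrib_left)
    ultimately have "3 = k * (of_nat CARD('n) + 3)"
      using \<open>L b c d \<noteq> 0\<close> by simp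
    moreover have "of_nat CARD('n) + 3 \<noteq> (0::complex)"
      using of_nat_neq_0[of "CARD('n) + 2", where ?'a = complex] by (simp add: add.commute)
    ultimately show ?thesis by (simp add: field_simps)
  qed
  then show ?thesis
    using eq[of g a b c d] unfolding P_def Q_def by simp
qed

lemma cubic_pair_of_adjoint_identity:
  fixes U L :: "'n::finite \<Rightarrow> 'n \<Rightarrow> 'n \<Rightarrow> complex"
  assumes U: "\<And>a b c. U b a c = U a b c" "\<And>a b c. U a c b = U a b c"
    and L: "\<And>a b c. L b a c = L a b c" "\<And>a b c. L a c b = L a b c"
    and normalised: "\<And>a b. (\<Sum>x\<in>UNIV. \<Sum>y\<in>UNIV. U a x y * L b x y) = delta a b"
    and adj: "adjoint_identity UNIV U L \<mu>" "adjoint_identity UNIV L U \<nu>"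
  shows "cubic_pair U L (3 / (of_nat CARD('n) + 3))"
proof
  have n': "(\<Sum>x\<in>UNIV. \<Sum>y\<in>UNIV. L a x y * U b x y) = delta a b" for a b
    using normalised[of b a] by (simp add: mult.commute delta_commute[of a])
  show "(\<Sum>e\<in>UNIV. \<Sum>f\<in>UNIV. U g e f * (L e a b * L f c d + L e a c * L f b d + L e a d * L f b c))
      = 3 / (of_nat CARD('n) + 3) * (delta g a * L b c d + delta g b * L a c d + delta g c * L a b d + delta g d * L a b c)"
    for g a b c d by (rule springer_of_adjoint_identity[OF U L normalised adj(1)])
  show "(\<Sum>e\<in>UNIV. \<Sum>f\<in>UNIV. L g e f * (U e a b * U f c d + U e a c * U f b d + U e a d * U f b c))
      = 3 / (of_nat CARD('n) + 3) * (delta g a * U b c d + delta g b * U a c d + delta g c * U a b d + delta g d * U a b c)"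
    for g a b c d by (rule springer_of_adjoint_identity[OF L U n' adj(2)])
qed (rule U L normalised)+

section \<open>Bases of eigenvectors\<close>

lemma eigenvectors_sum_eq_0:
  fixes A :: "complex^'n::finite^'n" and b :: "'i \<Rightarrow> complex^'n" and \<nu> :: "'i \<Rightarrow> complex"
  assumes "finite K" "\<And>k. k \<in> K \<Longrightarrow> A *v b k = \<nu> k *s b k" "\<And>k. k \<in> K \<Longrightarrow> b k \<noteq> 0" "inj_on \<nu> K"
    and "(\<Sum>k\<in>K. c k *s b k) = 0" "k \<in> K"
  shows "c k = 0"
  using assms
proof (induction K arbitrary: c k rule: finite_induct)
  case (insert j K)
  have s: "c j *s b j + (\<Sum>i\<in>K. c i *s b i) = 0"
    using insert by simp
  have "A *v (c j *s b j + (\<Sum>i\<in>K. c i *s b i)) = c j *s (\<nu> j *s b j) + (\<Sum>i\<in>K. c i *s (\<nu> i *s b i))"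
    using insert.prems(1) by (simp add: matrix_vector_right_distrib vec.linear_sum[OF matrix_vector_mul_linear_gen] vec.scale)
  then have "0 = c j *s (\<nu> j *s b j) + (\<Sum>i\<in>K. c i *s (\<nu> i *s b i)) - \<nu> j *s (c j *s b j + (\<Sum>i\<in>K. c i *s b i))"
    unfolding s by simp
  also have "\<dots> = (\<Sum>i\<in>K. (c i * (\<nu> i - \<nu> j)) *s b i)"
    by (simp add: vec_eq_iff sum_distrib_left algebra_simps sum_subtractf)
  finally have "(\<Sum>i\<in>K. (c i * (\<nu> i - \<nu> j)) *s b i) = 0" by simp
  then have 0: "c i * (\<nu> i - \<nu> j) = 0" if "i \<in> K" for i
    using insert.IH[of "\<lambda>i. c i * (\<nu> i - \<nu> j)" i] insert.prems that by (auto simp: inj_on_def)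
  have K: "c i = 0" if "i \<in> K" for i
    using 0[OF that] insert.prems(3) insert.hyps that by (auto simp: inj_on_def)
  then have "c j *s b j = 0" using s by simp
  then have "c j = 0" using insert.prems(2)[of j] by (simp add: vec.scale_eq_0_iff)
  then show ?case using K insert.prems by auto
qed simp

lemma eigenvectors_independent:
  fixes A :: "complex^'n::finite^'n" and b :: "'i \<Rightarrow> complex^'n" and \<nu> :: "'i \<Rightarrow> complex"
  assumes "finite K" "\<And>k. k \<in> K \<Longrightarrow> A *v b k = \<nu> k *s b k" "\<And>k. k \<in> K \<Longrightarrow> b k \<noteq> 0" "inj_on \<nu> K"
  shows "inj_on b K" "vec.independent (b ` K)"
proof -
  show inj: "inj_on b K"
  proof (rule inj_onI)
    fix i j assume ij: "i \<in> K" "j \<in> K" "b i = b j"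
    then have "\<nu> i *s b i = \<nu> j *s b i"
      using assms(2) by metis
    then have "(\<nu> i - \<nu> j) *s b i = 0" by (simp only: vec.scale_left_diff_distrib) simp
    then have "\<nu> i = \<nu> j" using assms(3)[of i] ij(1) by (simp only: vec.scale_eq_0_iff) simp
    then show "i = j" using assms(4) ij by (auto simp: inj_on_def)
  qed
  show "vec.independent (b ` K)"
    unfolding vec.dependent_finite[OF finite_imageI[OF assms(1)]]
  proof clarsimp
    fix u k assume s: "(\<Sum>v\<in>b ` K. u v *s v) = 0" and k: "k \<in> K" "u (b k) \<noteq> 0"
    have "(\<Sum>k\<in>K. u (b k) *s b k) = 0"
      using s by (simp add: sum.reindex[OF inj])
    from eigenvectors_sum_eq_0[OF assms this k(1)] k(2) show False by simp
  qed
qed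

text \<open>Mostly applied by contradiction: too many distinct eigenvalues force some vector of a
  string to vanish, or exclude a representation of small dimension.\<close>

lemma eigenvectors_card_le:
  fixes A :: "complex^'n::finite^'n" and b :: "'i \<Rightarrow> complex^'n" and \<nu> :: "'i \<Rightarrow> complex"
  assumes "finite K" "\<And>k. k \<in> K \<Longrightarrow> A *v b k = \<nu> k *s b k" "\<And>k. k \<in> K \<Longrightarrow> b k \<noteq> 0" "inj_on \<nu> K"
  shows "card K \<le> CARD('n)"
proof -
  note ind = eigenvectors_independent[OF assms]
  have "card (b ` K) \<le> vec.dim (UNIV :: (complex^'n) set)"
    by (rule vec.independent_card_le_dim) (simp_all add: ind)
  then show ?thesis
    using card_image[OF ind(1)] by (simp add: vec.dim_UNIV card_cart_basis)
qed

text \<open>The functionals \<open>b'\<close> are the coordinates with respect to \<open>b\<close>.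
  Tensors with lower indices will be evaluated on \<open>b\<close>, those with upper indices on
  \<open>b'\<close>.\<close>

lemma eigenbasis_dual:
  fixes A :: "complex^'n::finite^'n" and b :: "'i \<Rightarrow> complex^'n" and \<nu> :: "'i \<Rightarrow> complex"
  assumes "finite K" "\<And>k. k \<in> K \<Longrightarrow> A *v b k = \<nu> k *s b k" "\<And>k. k \<in> K \<Longrightarrow> b k \<noteq> 0" "inj_on \<nu> K"
    and card: "card K = CARD('n)"
  obtains b' :: "'i \<Rightarrow> 'n \<Rightarrow> complex" where
    "\<And>i j. i \<in> K \<Longrightarrow> j \<in> K \<Longrightarrow> (\<Sum>a\<in>UNIV. b' i a * b j $ a) = delta i j"
    "\<And>a c. (\<Sum>k\<in>K. b k $ a * b' k c) = delta a c"
proof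
  note ind = eigenvectors_independent[OF assms(1-4)]
  have span: "vec.span (b ` K) = UNIV"
    using vec.card_ge_dim_independent[of "b ` K" UNIV] ind card
    by (simp add: card_image vec.dim_UNIV card_cart_basis top.extremum_uniqueI)
  define \<phi> where "\<phi> k v = vec.representation (b ` K) v (b k)" for k v
  define b' where "b' k a = \<phi> k (axis a 1)" for k a
  have expand: "(\<Sum>k\<in>K. \<phi> k v *s b k) = v" for v
    using vec.sum_representation_eq[OF ind(2), of v "b ` K"] assms(1) span
    by (simp add: \<phi>_def sum.reindex[OF ind(1)])
  have lin: "\<phi> k (x + y) = \<phi> k x + \<phi> k y" "\<phi> k (c *s x) = c * \<phi> k x" for k x y c
    using vec.representation_add[OF ind(2)] vec.representation_scale[OF ind(2)] span by (simp_all add: \<phi>_def)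
  have zero: "\<phi> k 0 = 0" for k
    using lin(2)[of k 0 0] by simp
  have sum: "\<phi> k (\<Sum>a\<in>S. f a) = (\<Sum>a\<in>S. \<phi> k (f a))" for k S and f :: "'n \<Rightarrow> complex^'n"
    by (induction S rule: infinite_finite_induct) (simp_all add: zero lin)
  have b': "(\<Sum>a\<in>UNIV. b' k a * v $ a) = \<phi> k v" for k v
  proof -
    have "\<phi> k v = \<phi> k (\<Sum>a\<in>UNIV. v $ a *s axis a 1)"
      by (simp add: basis_expansion)
    then show ?thesis by (simp add: sum lin b'_def mult.commute)
  qed
  show "(\<Sum>a\<in>UNIV. b' i a * b j $ a) = delta i j" if "i \<in> K" "j \<in> K" for i j
    unfolding b' using vec.representation_basis[OF ind(2), of "b j"] that ind(1)
    by (auto simp: \<phi>_def delta_def inj_on_def)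
  show "(\<Sum>k\<in>K. b k $ a * b' k c) = delta a c" for a c
    using arg_cong[OF expand[of "axis c 1"], of "\<lambda>v. v $ a"]
    by (simp add: b'_def axis_def delta_def mult.commute)
qed

section \<open>Trilinear forms and the adjoint identity under a change of basis\<close>

definition tri :: "('n::finite \<Rightarrow> 'n \<Rightarrow> 'n \<Rightarrow> complex) \<Rightarrow> ('n \<Rightarrow> complex) \<Rightarrow> ('n \<Rightarrow> complex) \<Rightarrow> ('n \<Rightarrow> complex) \<Rightarrow> complex"
  where "tri t x y z = (\<Sum>a\<in>UNIV. \<Sum>b\<in>UNIV. \<Sum>c\<in>UNIV. t a b c * (x a * y b * z c))"

lemma tri_expand:
  fixes b b' :: "'i \<Rightarrow> 'n::finite \<Rightarrow> complex"
  assumes complete: "\<And>a c. (\<Sum>k\<in>K. b k a * b' k c) = delta a c"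
  shows "t a c e = (\<Sum>i\<in>K. \<Sum>j\<in>K. \<Sum>k\<in>K. tri t (b i) (b j) (b k) * (b' i a * b' j c * b' k e))"
proof -
  have lin: "tri t (\<lambda>p. \<Sum>i\<in>K. f i p) y z = (\<Sum>i\<in>K. tri t (f i) y z)"
    "tri t x (\<lambda>p. \<Sum>i\<in>K. f i p) z = (\<Sum>i\<in>K. tri t x (f i) z)"
    "tri t x y (\<lambda>p. \<Sum>i\<in>K. f i p) = (\<Sum>i\<in>K. tri t x y (f i))"
    "tri t (\<lambda>p. x p * s) y z = tri t x y z * s" "tri t x (\<lambda>p. y p * s) z = tri t x y z * s"
    "tri t x y (\<lambda>p. z p * s) = tri t x y z * s" for f :: "'i \<Rightarrow> 'n \<Rightarrow> complex" and x y z s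
  proof -
    have sw: "(\<Sum>p\<in>UNIV. \<Sum>i\<in>K. g p i) = (\<Sum>i\<in>K. \<Sum>p\<in>UNIV. g p i)" for g :: "'n \<Rightarrow> 'i \<Rightarrow> complex"
      by (rule sum.swap)
    show "tri t (\<lambda>p. \<Sum>i\<in>K. f i p) y z = (\<Sum>i\<in>K. tri t (f i) y z)"
      "tri t x (\<lambda>p. \<Sum>i\<in>K. f i p) z = (\<Sum>i\<in>K. tri t x (f i) z)"
      "tri t x y (\<lambda>p. \<Sum>i\<in>K. f i p) = (\<Sum>i\<in>K. tri t x y (f i))"
      by (simp_all only: tri_def sum_distrib_left sum_distrib_right sw)
    show "tri t (\<lambda>p. x p * s) y z = tri t x y z * s" "tri t x (\<lambda>p. y p * s) z = tri t x y z * s"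
      "tri t x y (\<lambda>p. z p * s) = tri t x y z * s"
      by (simp_all add: tri_def sum_distrib_right sum_distrib_left mult_ac)
  qed
  have "t a c e = tri t (\<lambda>p. delta p a) (\<lambda>p. delta p c) (\<lambda>p. delta p e)"
    unfolding tri_def mult.assoc[symmetric] by (simp only: sum_delta_complex sum_distrib_right[symmetric])
  also have "\<dots> = (\<Sum>i\<in>K. \<Sum>j\<in>K. \<Sum>k\<in>K. tri t (b i) (b j) (b k) * b' k e * b' j c * b' i a)"
    unfolding complete[symmetric] lin sum_distrib_right ..
  finally show ?thesis by (simp add: mult_ac)
qed

text \<open>The left side contains \<open>L\<close> twice and \<open>U\<close> once, hence the
  scalar \<open>C * C * C'\<close>; the cubic form on the right absorbs one
  \<open>C\<close>.\<close>

lemma adjoint_identity_basis_change: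
  fixes b b' :: "'i \<Rightarrow> 'n::finite \<Rightarrow> complex"
  assumes fin: "finite K"
    and orth: "\<And>i j. i \<in> K \<Longrightarrow> j \<in> K \<Longrightarrow> (\<Sum>a\<in>UNIV. b' i a * b j a) = delta i j"
    and complete: "\<And>a c. (\<Sum>k\<in>K. b k a * b' k c) = delta a c"
    and L: "\<And>i j k. i \<in> K \<Longrightarrow> j \<in> K \<Longrightarrow> k \<in> K \<Longrightarrow> tri L (b i) (b j) (b k) = C * tL i j k"
    and U: "\<And>i j k. i \<in> K \<Longrightarrow> j \<in> K \<Longrightarrow> k \<in> K \<Longrightarrow> tri U (b' i) (b' j) (b' k) = C' * tU i j k"
    and adj: "adjoint_identity K tU tL \<mu>"
  shows "adjoint_identity UNIV U L (C * C' * \<mu>)"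
  unfolding adjoint_identity_def
proof (intro allI ballI)
  fix x :: "'n \<Rightarrow> complex" and g :: 'n
  have complete': "(\<Sum>k\<in>K. b' k a * b k c) = delta a c" for a c
    using complete[of c a] by (simp add: mult.commute delta_commute[of a])
  define \<xi> where "\<xi> i = (\<Sum>a\<in>UNIV. b' i a * x a)" for i
  \<comment> \<open>Stated for an arbitrary pair of dual bases, since it serves \<open>L\<close>
    with \<open>b, b'\<close> and \<open>U\<close> with the two exchanged.\<close>
  have expand: "sharp UNIV t y a = c * (\<Sum>i\<in>K. e' i a * sharp K s (\<lambda>j. \<Sum>p\<in>UNIV. e' j p * y p) i)"
    if "\<And>a d. (\<Sum>k\<in>K. e k a * e' k d) = delta a d"
      "\<And>i j k. i \<in> K \<Longrightarrow> j \<in> K \<Longrightarrow> k \<in> K \<Longrightarrow> tri t (e i) (e j) (e k) = c * s i j k"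
    for e e' :: "'i \<Rightarrow> 'n \<Rightarrow> complex" and t s y a c
  proof -
    have t: "t a p q = (\<Sum>i\<in>K. \<Sum>j\<in>K. \<Sum>k\<in>K. (c * s i j k) * (e' i a * e' j p * e' k q))" for a p q
      unfolding tri_expand[OF that(1), of t a p q] using that(2) by (intro sum.cong refl) simp
    have "sharp UNIV t y a = (\<Sum>(p, q)\<in>UNIV. \<Sum>(i, j, k)\<in>K \<times> K \<times> K. c * (e' i a * (s i j k * ((e' j p * y p) * (e' k q * y q)))))"
      unfolding sharp_def t sum_UNIV_pair prod.case sum.cartesian_product[symmetric] sum_distrib_right
      by (simp add: mult_ac)
    also have "\<dots> = (\<Sum>(i, j, k)\<in>K \<times> K \<times> K. \<Sum>(p, q)\<in>UNIV. c * (e' i a * (s i j k * ((e' j p * y p) * (e' k q * y q)))))"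
      unfolding split_def by (rule sum.swap)
    also have "\<dots> = c * (\<Sum>i\<in>K. e' i a * sharp K s (\<lambda>j. \<Sum>p\<in>UNIV. e' j p * y p) i)"
      unfolding sharp_def sum_UNIV_pair prod.case sum.cartesian_product[symmetric]
      unfolding sum_distrib_right unfolding sum_distrib_left ..
    finally show ?thesis .
  qed
  have sL: "sharp UNIV L x a = C * (\<Sum>i\<in>K. b' i a * sharp K tL \<xi> i)" for a
    unfolding \<xi>_def by (rule expand[OF complete L])
  have b_sL: "(\<Sum>p\<in>UNIV. b j p * sharp UNIV L x p) = C * sharp K tL \<xi> j" if "j \<in> K" for j
  proof -
    have "(\<Sum>p\<in>UNIV. b j p * sharp UNIV L x p) = C * (\<Sum>p\<in>UNIV. \<Sum>i\<in>K. (b' i p * b j p) * sharp K tL \<xi> i)"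
      unfolding sL sum_distrib_left by (simp add: mult_ac)
    also have "(\<Sum>p\<in>UNIV. \<Sum>i\<in>K. (b' i p * b j p) * sharp K tL \<xi> i) = (\<Sum>i\<in>K. (\<Sum>p\<in>UNIV. b' i p * b j p) * sharp K tL \<xi> i)"
      unfolding sum_distrib_right by (rule sum.swap)
    also have "\<dots> = (\<Sum>i\<in>K. if i = j then sharp K tL \<xi> i else 0)"
      using orth that by (intro sum.cong refl) (simp add: delta_def)
    finally show ?thesis using fin that by simp
  qed
  have sq: "sharp K tU (\<lambda>j. \<Sum>p\<in>UNIV. b j p * sharp UNIV L x p) i = C\<^sup>2 * sharp K tU (sharp K tL \<xi>) i" for i
    unfolding sharp_def[of K tU] sum_distrib_left[of "C\<^sup>2"]
    by (intro sum.cong refl) (simp only: b_sL power2_eq_square mult_ac)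
  define N where "N = (\<Sum>b\<in>K. \<xi> b * sharp K tL \<xi> b)"
  have "sharp UNIV U (sharp UNIV L x) g
    = C' * (\<Sum>i\<in>K. b i g * sharp K tU (\<lambda>j. \<Sum>p\<in>UNIV. b j p * sharp UNIV L x p) i)"
    by (rule expand[OF complete' U])
  also have "\<dots> = C' * (\<Sum>i\<in>K. b i g * (C\<^sup>2 * sharp K tU (sharp K tL \<xi>) i))"
    by (simp add: sq)
  also have "\<dots> = C' * (\<Sum>i\<in>K. b i g * (C\<^sup>2 * (\<mu> * N * \<xi> i)))"
    using adj by (simp add: adjoint_identity_def N_def)
  also have "\<dots> = C * C' * \<mu> * (C * N) * (\<Sum>i\<in>K. b i g * \<xi> i)"
    by (simp add: sum_distrib_left power2_eq_square mult_ac)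
  also have "(\<Sum>i\<in>K. b i g * \<xi> i) = (\<Sum>a\<in>UNIV. (\<Sum>i\<in>K. b i g * b' i a) * x a)"
    unfolding \<xi>_def sum_distrib_left sum_distrib_right
    by (subst sum.swap) (simp add: mult.assoc)
  also have "\<dots> = x g"
    unfolding complete by (simp only: sum_delta_complex)
  also have "C * N = (\<Sum>b\<in>UNIV. x b * sharp UNIV L x b)"
    unfolding sL N_def \<xi>_def sum_distrib_left sum_distrib_right
    by (subst sum.swap) (simp add: mult_ac)
  finally show "sharp UNIV U (sharp UNIV L x) g = C * C' * \<mu> * (\<Sum>b\<in>UNIV. x b * sharp UNIV L x b) * x g" .
qed

section \<open>Cubic forms determined by root vectors\<close>

type_synonym key = "nat \<times> nat \<times> nat"

definition sort3 :: "key \<Rightarrow> key"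
  where "sort3 = (\<lambda>(a, b, c). (min a (min b c), max (min a b) (min (max a b) c), max a (max b c)))"

lemma sort3_cases:
  "sort3 (a, b, c) \<in> {(a, b, c), (a, c, b), (b, a, c), (b, c, a), (c, a, b), (c, b, a)}"
  by (auto simp: sort3_def min_def max_def)

lemma sort3_eq_iff:
  assumes "p \<le> q" "q \<le> r"
  shows "sort3 (a, b, c) = (p, q, r) \<longleftrightarrow>
    a = p \<and> (b = q \<and> c = r \<or> b = r \<and> c = q) \<or> a = q \<and> (b = p \<and> c = r \<or> b = r \<and> c = p)
      \<or> a = r \<and> (b = p \<and> c = q \<or> b = q \<and> c = p)"
  using assms by (auto simp: sort3_def min_def max_def)

text \<open>A cubic form is given by a table of the coefficients \<open>t a b c\<close>, \<open>a \<le> b \<le> c\<close>, of its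
  polarisation.\<close>

type_synonym cubic_table = "(key \<times> int) list"

text \<open>Entries with equal keys add up. This makes the coefficient additive in the table, so
  that identities can be proved by induction on the list.\<close>

definition cubic_coeff :: "cubic_table \<Rightarrow> key \<Rightarrow> int"
  where "cubic_coeff tab k = (\<Sum>(k', v)\<leftarrow>tab. if k' = k then v else 0)"

definition cubic_of :: "cubic_table \<Rightarrow> nat \<Rightarrow> nat \<Rightarrow> nat \<Rightarrow> complex"
  where "cubic_of tab a b c = of_int (cubic_coeff tab (sort3 (a, b, c)))"

lemma cubic_coeff_eq_0: "k \<notin> fst ` set tab \<Longrightarrow> cubic_coeff tab k = 0"
  by (induction tab) (auto simp: cubic_coeff_def)

text \<open>An entry stands for all permutations of its key. Once one leg is \<open>a\<close>, the
  other two can be ordered in two ways unless they coincide. If \<open>a\<close> occurs repeatedly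
  in the key, the first matching case already leaves the right pair.\<close>

definition gradient :: "cubic_table \<Rightarrow> (nat \<Rightarrow> complex) \<Rightarrow> nat \<Rightarrow> complex"
  where "gradient tab x a = (\<Sum>((p, q, r), v)\<leftarrow>tab.
    let m = (\<lambda>y z. of_int (if y = z then v else 2 * v) * (x y * x z)) in
      if a = p then m q r else if a = q then m p r else if a = r then m p q else 0)"

definition keys_ok :: "nat \<Rightarrow> cubic_table \<Rightarrow> bool"
  where "keys_ok N tab \<longleftrightarrow> list_all (\<lambda>((p, q, r), v). p \<le> q \<and> q \<le> r \<and> r < N) tab"

lemma sharp_cubic_of:
  assumes "keys_ok N tab" "a < N"
  shows "sharp {..<N} (cubic_of tab) x a = gradient tab x a"
  using assms(1)
proof (induction tab)
  case Nil
  then show ?case by (simp add: sharp_def cubic_of_def cubic_coeff_def gradient_def)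
next
  case (Cons e tab)
  obtain p q r v where e: "e = ((p, q, r), v)" by (metis prod_cases4 surj_pair)
  have pqr: "p \<le> q" "q \<le> r" "r < N" and ok: "keys_ok N tab"
    using Cons.prems by (auto simp: keys_ok_def e)
  have pair: "(\<Sum>b<N. \<Sum>c<N. (if b = y \<and> c = z \<or> b = z \<and> c = y then of_int v else 0) * (x b * x c))
    = of_int (if y = z then v else 2 * v) * (x y * x z)" if "y < N" "z < N" for y z
  proof -
    have one: "(\<Sum>b<N. \<Sum>c<N. (if b = y \<and> c = z then of_int v else 0) * (x b * x c)) = of_int v * (x y * x z)"
      if "y < N" "z < N" for y z
    proof -
      have "(if b = y \<and> c = z then of_int v else 0) * (x b * x c)
        = (if b = y then (if c = z then of_int v * (x y * x z) else 0) else 0)" for b c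
        by simp
      then have "(\<Sum>b<N. \<Sum>c<N. (if b = y \<and> c = z then of_int v else 0) * (x b * x c))
        = (\<Sum>b<N. if b = y then (\<Sum>c<N. if c = z then of_int v * (x y * x z) else 0) else 0)"
        by (simp only:) (rule sum.cong, simp_all)
      then show ?thesis using that by simp
    qed
    show ?thesis
    proof (cases "y = z")
      case True
      then show ?thesis using one[OF that] by simp
    next
      case False
      have "(if b = y \<and> c = z \<or> b = z \<and> c = y then of_int v else 0) * (x b * x c)
        = (if b = y \<and> c = z then of_int v else 0) * (x b * x c) + (if b = z \<and> c = y then of_int v else 0) * (x b * x c)" for b c
        using False by auto
      then show ?thesis
        using False one[OF that] one[OF that(2,1)] by (simp add: sum.distrib algebra_simps)
    qed
  qed
  have "sharp {..<N} (cubic_of (e # tab)) x a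
    = (\<Sum>b<N. \<Sum>c<N. (if sort3 (a, b, c) = (p, q, r) then of_int v else 0) * (x b * x c)) + sharp {..<N} (cubic_of tab) x a"
    unfolding sharp_def sum.distrib[symmetric]
    by (intro sum.cong refl) (auto simp: cubic_of_def cubic_coeff_def e algebra_simps)
  also have "(\<Sum>b<N. \<Sum>c<N. (if sort3 (a, b, c) = (p, q, r) then of_int v else 0) * (x b * x c))
    = (let m = (\<lambda>y z. of_int (if y = z then v else 2 * v) * (x y * x z)) in
      if a = p then m q r else if a = q then m p r else if a = r then m p q else 0)"
  proof -
    consider "a = p" | "a \<noteq> p" "a = q" | "a \<noteq> p" "a \<noteq> q" "a = r" | "a \<noteq> p" "a \<noteq> q" "a \<noteq> r" by blast
    then show ?thesis
    proof cases
      case 1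
      have "sort3 (a, b, c) = (p, q, r) \<longleftrightarrow> b = q \<and> c = r \<or> b = r \<and> c = q" for b c
        unfolding sort3_eq_iff[OF pqr(1,2)] using 1 by auto
      then show ?thesis using 1 pqr pair[of q r] by simp
    next
      case 2
      have "sort3 (a, b, c) = (p, q, r) \<longleftrightarrow> b = p \<and> c = r \<or> b = r \<and> c = p" for b c
        unfolding sort3_eq_iff[OF pqr(1,2)] using 2 by auto
      then show ?thesis using 2 pqr pair[of p r] by simp
    next
      case 3
      have "sort3 (a, b, c) = (p, q, r) \<longleftrightarrow> b = p \<and> c = q \<or> b = q \<and> c = p" for b c
        unfolding sort3_eq_iff[OF pqr(1,2)] using 3 by auto
      then show ?thesis using 3 pqr pair[of p q] by simp
    next
      case 4
      have "sort3 (a, b, c) \<noteq> (p, q, r)" for b c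
        unfolding sort3_eq_iff[OF pqr(1,2)] using 4 by auto
      then show ?thesis using 4 by simp
    qed
  qed
  finally show ?case
    using Cons.IH[OF ok] by (simp add: gradient_def e)
qed

text \<open>The factors 1, 3 and 6 are the numbers of distinct permutations of a sorted key; for
  such a key \<open>p = r\<close> means that all three indices agree.\<close>

definition cubic_value :: "cubic_table \<Rightarrow> (nat \<Rightarrow> complex) \<Rightarrow> complex"
  where "cubic_value tab x = (\<Sum>((p, q, r), v)\<leftarrow>tab.
    of_int (if p = r then v else if p = q \<or> q = r then 3 * v else 6 * v) * (x p * x q * x r))"

text \<open>Euler's formula without the usual factor 3, because \<open>gradient\<close> is one third
  of the derivative.\<close>

lemma euler_cubic:
  assumes "keys_ok N tab"
  shows "(\<Sum>b<N. x b * gradient tab x b) = cubic_value tab x"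
  using assms
proof (induction tab)
  case (Cons e tab)
  obtain p q r v where e: "e = ((p, q, r), v)" by (metis prod_cases4 surj_pair)
  have pqr: "p \<le> q" "q \<le> r" "r < N" and ok: "keys_ok N tab"
    using Cons.prems by (auto simp: keys_ok_def e)
  define m where "m y z = of_int (if y = z then v else 2 * v) * (x y * x z)" for y z
  have single: "(\<Sum>b<N. if b = y then z else 0) = z" if "y < N" for y and z :: complex
    using that by simp
  have "(\<Sum>b<N. x b * (if b = p then m q r else if b = q then m p r else if b = r then m p q else 0))
    = (\<Sum>b<N. (if b = p then x p * m q r else 0) + (if b = q then if p = q then 0 else x q * m p r else 0)
        + (if b = r then if r = p \<or> r = q then 0 else x r * m p q else 0))"
    by (intro sum.cong refl) auto
  also have "\<dots> = x p * m q r + (if p = q then 0 else x q * m p r) + (if r = p \<or> r = q then 0 else x r * m p q)"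
    using pqr by (simp only: sum.distrib single le_less_trans)
  also have "\<dots> = of_int (if p = r then v else if p = q \<or> q = r then 3 * v else 6 * v) * (x p * x q * x r)"
    using pqr by (auto simp: m_def algebra_simps)
  finally have "(\<Sum>b<N. x b * (if b = p then m q r else if b = q then m p r else if b = r then m p q else 0)) = \<dots>" .
  moreover have "gradient (e # tab) x b
    = (if b = p then m q r else if b = q then m p r else if b = r then m p q else 0) + gradient tab x b" for b
    by (simp add: gradient_def e m_def Let_def)
  moreover have "cubic_value (e # tab) x
    = of_int (if p = r then v else if p = q \<or> q = r then 3 * v else 6 * v) * (x p * x q * x r) + cubic_value tab x"
    by (simp add: cubic_value_def e)
  ultimately show ?case
    using Cons.IH[OF ok] by (simp only: distrib_left sum.distrib)
qed (simp add: gradient_def cubic_value_def)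

lemma adjoint_identity_of_gradient:
  assumes "keys_ok N tabU" "keys_ok N tabL"
    and "\<And>x. \<forall>a<N. gradient tabU (gradient tabL x) a = \<mu> * cubic_value tabL x * x a"
  shows "adjoint_identity {..<N} (cubic_of tabU) (cubic_of tabL) \<mu>"
  unfolding adjoint_identity_def
proof (intro allI ballI)
  fix x a assume a: "a \<in> {..<N}"
  have "sharp {..<N} (cubic_of tabU) (sharp {..<N} (cubic_of tabL) x) a
    = sharp {..<N} (cubic_of tabU) (gradient tabL x) a"
    unfolding sharp_def[of _ "cubic_of tabU"] by (intro sum.cong refl) (simp add: sharp_cubic_of[OF assms(2)])
  also have "\<dots> = \<mu> * (\<Sum>b<N. x b * gradient tabL x b) * x a"
    using a assms(3)[of x] sharp_cubic_of[OF assms(1)] euler_cubic[OF assms(2)] by simp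
  finally show "sharp {..<N} (cubic_of tabU) (sharp {..<N} (cubic_of tabL) x) a
    = \<mu> * (\<Sum>b\<in>{..<N}. x b * sharp {..<N} (cubic_of tabL) x b) * x a"
    by (simp add: sharp_cubic_of[OF assms(2)])
qed

lemma all_less_numeral: "(\<forall>a<numeral k. P a) \<longleftrightarrow> P (pred_numeral k) \<and> (\<forall>a<pred_numeral k. P a)"
  by (simp add: numeral_eq_Suc All_less_Suc)

text \<open>An edge \<open>(s, k, l, c)\<close> says that the operator number \<open>s\<close> maps the basis vector number \<open>k\<close>
  to a combination of basis vectors in which number \<open>l\<close> has the coefficient \<open>c\<close>.\<close>

type_synonym edges = "(nat \<times> nat \<times> nat \<times> int) list"

definition edge_terms :: "edges \<Rightarrow> nat \<Rightarrow> nat \<Rightarrow> (nat \<times> int) list"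
  where "edge_terms D s k = map (\<lambda>(s', k', l, c). (l, c)) (filter (\<lambda>(s', k', l, c). s' = s \<and> k' = k) D)"

text \<open>These are the edges of the transposed matrix, hence of the action on the dual
  basis.\<close>

definition reverse_edges :: "edges \<Rightarrow> edges"
  where "reverse_edges = map (\<lambda>(s, k, l, c). (s, l, k, c))"

definition derivation_terms :: "edges \<Rightarrow> nat \<Rightarrow> key \<Rightarrow> (key \<times> int) list"
  where "derivation_terms D s = (\<lambda>(i, j, k).
    map (\<lambda>(l, c). (sort3 (l, j, k), c)) (edge_terms D s i)
    @ map (\<lambda>(l, c). (sort3 (i, l, k), c)) (edge_terms D s j)
    @ map (\<lambda>(l, c). (sort3 (i, j, l), c)) (edge_terms D s k))"

text \<open>A certificate \<open>(k, s, i)\<close> refers to the invariance equation of the operator number \<open>s\<close> at the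
  triple \<open>i\<close>: it determines the coefficient at \<open>k\<close> from those found before.\<close>

fun determines :: "nat \<Rightarrow> nat \<Rightarrow> edges \<Rightarrow> cubic_table \<Rightarrow> key list \<Rightarrow> (key \<times> nat \<times> key) list \<Rightarrow> bool" where
  "determines N r D tab known [] \<longleftrightarrow> list_all (\<lambda>(k, v). List.member known k) tab"
| "determines N r D tab known ((k, s, (a, b, c)) # cert) \<longleftrightarrow>
    (let ts = derivation_terms D s (a, b, c) in
      s < r \<and> a < N \<and> b < N \<and> c < N
      \<and> list_all (\<lambda>(k', c). k' = k \<or> List.member known k') ts
      \<and> (\<Sum>(k', c)\<leftarrow>ts. c * cubic_coeff tab k') = 0
      \<and> (\<Sum>(k', c)\<leftarrow>ts. if k' = k then c else 0) \<noteq> 0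
      \<and> determines N r D tab (k # known) cert)"

fun all_tails :: "('a \<Rightarrow> 'a list \<Rightarrow> bool) \<Rightarrow> 'a list \<Rightarrow> bool" where
  "all_tails P [] \<longleftrightarrow> True"
| "all_tails P (x # xs) \<longleftrightarrow> P x (x # xs) \<and> all_tails P xs"

lemma all_tails_drop: "all_tails P xs \<Longrightarrow> i < length xs \<Longrightarrow> P (xs ! i) (drop i xs)"
  by (induction xs arbitrary: i) (auto simp: less_Suc_eq_0_disj)

text \<open>The tails contain their own head, so the nesting runs through all
  \<open>a \<le> b \<le> c\<close>, repetitions included; only triples of total weight zero reach
  the lookup.\<close>

definition covers :: "int list \<Rightarrow> cubic_table \<Rightarrow> bool"
  where "covers nus tab \<longleftrightarrow>
    all_tails (\<lambda>(a, x). all_tails (\<lambda>(b, y) V. let t = - (x + y) in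
        list_all (\<lambda>(c, z). List.member (map fst tab) (a, b, c)) (filter (\<lambda>(c, z). z = t) V)))
      (List.enumerate 0 nus)"

text \<open>The table itself satisfies the equation of each certificate, hence so does the deviation
  of \<open>T\<close> from \<open>C\<close> times the table. It vanishes at the known keys, and its
  coefficient at the new key is nonzero.\<close>

lemma determines_sound:
  fixes T :: "key \<Rightarrow> complex"
  assumes inv: "\<And>s a b c. s < r \<Longrightarrow> a < N \<Longrightarrow> b < N \<Longrightarrow> c < N \<Longrightarrow>
      (\<Sum>(k, x)\<leftarrow>derivation_terms D s (a, b, c). of_int x * T k) = 0"
    and "determines N r D tab known cert" "\<forall>k\<in>set known. T k = C * of_int (cubic_coeff tab k)"
  shows "\<forall>k\<in>fst ` set tab. T k = C * of_int (cubic_coeff tab k)"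
  using assms(2,3)
proof (induction cert arbitrary: known)
  case Nil
  then show ?case by (auto simp: list_all_iff)
next
  case (Cons e cert)
  obtain k s a b c where e: "e = (k, s, (a, b, c))" by (metis prod_cases5)
  define ts where "ts = derivation_terms D s (a, b, c)"
  have le: "s < r" "a < N" "b < N" "c < N"
    and known: "\<forall>(k', c)\<in>set ts. k' = k \<or> k' \<in> set known"
    and coeffs: "(\<Sum>(k', c)\<leftarrow>ts. c * cubic_coeff tab k') = 0"
    and nz: "(\<Sum>(k', c)\<leftarrow>ts. if k' = k then c else 0) \<noteq> 0"
    and rest: "determines N r D tab (k # known) cert"
    using Cons.prems(1) by (auto simp: e Let_def list_all_iff ts_def)
  define d where "d k' = T k' - C * of_int (cubic_coeff tab k')" for k'
  have "(\<Sum>(k', c)\<leftarrow>ts. of_int c * d k') = (\<Sum>(k', c)\<leftarrow>ts. of_int c * T k') - C * of_int (\<Sum>(k', c)\<leftarrow>ts. c * cubic_coeff tab k')"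
    by (induction ts) (auto simp: d_def algebra_simps)
  also have "\<dots> = 0"
    using inv[OF le] coeffs by (simp add: ts_def)
  finally have "(\<Sum>(k', c)\<leftarrow>ts. of_int c * d k') = 0" .
  moreover have "(\<Sum>(k', c)\<leftarrow>ts. of_int c * d k') = of_int (\<Sum>(k', c)\<leftarrow>ts. if k' = k then c else 0) * d k"
    using known
  proof (induction ts)
    case (Cons y ts)
    obtain k' c where y: "y = (k', c)" by (cases y)
    show ?case
    proof (cases "k' = k")
      case False
      then have "d k' = 0" using Cons.prems \<open>\<forall>k\<in>set known. _\<close> by (auto simp: y d_def)
      then show ?thesis using Cons False by (simp add: y)
    qed (use Cons in \<open>simp add: y algebra_simps\<close>)
  qed simp
  ultimately have "d k = 0" using nz by simp
  then have "\<forall>k\<in>set (k # known). T k = C * of_int (cubic_coeff tab k)"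
    using Cons.prems(2) by (simp add: d_def)
  from Cons.IH[OF rest this] show ?case .
qed

text \<open>A triple outside the table has nonzero total weight, which kills its coefficient; the
  triples inside are reached from \<open>k0\<close> by the certificates.\<close>

lemma determined_up_to_scalar:
  fixes t :: "nat \<Rightarrow> nat \<Rightarrow> nat \<Rightarrow> complex"
  assumes sym: "\<And>a b c. t b a c = t a b c" "\<And>a b c. t a c b = t a b c"
    and weight: "\<And>a b c. a < N \<Longrightarrow> b < N \<Longrightarrow> c < N \<Longrightarrow> of_int (nus ! a + nus ! b + nus ! c) * t a b c = 0"
    and inv: "\<And>s a b c. s < r \<Longrightarrow> a < N \<Longrightarrow> b < N \<Longrightarrow> c < N \<Longrightarrow>
      (\<Sum>(l, x)\<leftarrow>edge_terms D s a. of_int x * t l b c) + (\<Sum>(l, x)\<leftarrow>edge_terms D s b. of_int x * t a l c)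
        + (\<Sum>(l, x)\<leftarrow>edge_terms D s c. of_int x * t a b l) = 0"
    and "length nus = N" "covers nus tab" "determines N r D tab [k0] cert" "cubic_coeff tab k0 \<noteq> 0"
  shows "\<exists>C. \<forall>a<N. \<forall>b<N. \<forall>c<N. t a b c = C * cubic_of tab a b c"
proof -
  define T where "T = (\<lambda>(a, b, c). t a b c)"
  have T: "T (sort3 (a, b, c)) = t a b c" for a b c
    using sort3_cases[of a b c] sym by (auto simp: T_def)
  define C where "C = T k0 / of_int (cubic_coeff tab k0)"
  have keys: "\<forall>k\<in>fst ` set tab. T k = C * of_int (cubic_coeff tab k)"
  proof (rule determines_sound)
    show "(\<Sum>(k, x)\<leftarrow>derivation_terms D s (a, b, c). of_int x * T k) = 0"
      if "s < r" "a < N" "b < N" "c < N" for s a b c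
      using inv[OF that] by (simp add: derivation_terms_def comp_def split_def T add.assoc)
  qed (use assms in \<open>auto simp: C_def\<close>)
  have "t a b c = C * cubic_of tab a b c" if "a < N" "b < N" "c < N" for a b c
  proof (cases "sort3 (a, b, c) \<in> fst ` set tab")
    case True
    then show ?thesis using keys[rule_format, OF True] T[of a b c] by (simp add: cubic_of_def)
  next
    case False
    obtain p q s where pqs: "sort3 (a, b, c) = (p, q, s)" by (metis prod_cases3)
    have le: "p \<le> q" "q \<le> s" "p < N" "q < N" "s < N"
      using pqs that by (auto simp: sort3_def min_def max_def split: if_splits)
    define V where "V = List.enumerate 0 nus"
    have V: "length V = N" "V ! i = (i, nus ! i)" if "i < N" for i
      using that assms(5) by (simp_all add: V_def nth_enumerate_eq)
    have "all_tails (\<lambda>(b, y) V. let t = - (nus ! p + y) in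
        list_all (\<lambda>(c, z). List.member (map fst tab) (p, b, c)) (filter (\<lambda>(c, z). z = t) V)) (drop p V)"
      using all_tails_drop[of _ V p] assms(6) V[OF le(3)] le unfolding covers_def V_def[symmetric] by fastforce
    \<comment> \<open>Within the tail that starts at \<open>p\<close>, the index \<open>q\<close>
      has position \<open>q - p\<close>.\<close>
    from all_tails_drop[OF this, of "q - p"]
    have "list_all (\<lambda>(c, z). List.member (map fst tab) (p, q, c)) (filter (\<lambda>(c, z). z = - (nus ! p + nus ! q)) (drop q V))"
      using V[OF le(4)] le by (simp add: Let_def)
    moreover have "drop q V ! (s - q) = (s, nus ! s)" "s - q < length (drop q V)"
      using V[OF le(5)] le by simp_all
    then have "(s, nus ! s) \<in> set (drop q V)"
      by (metis nth_mem)
    ultimately have "nus ! s \<noteq> - (nus ! p + nus ! q)"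
      using False by (auto simp: list_all_iff pqs)
    then have "nus ! p + nus ! q + nus ! s \<noteq> 0" by linarith
    then have "t p q s = 0"
      using weight[OF le(3-5)] by (simp flip: of_int_add)
    then have "t a b c = 0"
      using T[of a b c] by (simp add: pqs T_def)
    then show ?thesis using cubic_coeff_eq_0[OF False] by (simp add: cubic_of_def)
  qed
  then show ?thesis by blast
qed


section \<open>Invariant cubic tensors in a basis of weight vectors\<close>

lemma tri_derivation:
  assumes "\<And>a b c. (\<Sum>k\<in>UNIV. Y $ k $ a * t k b c + Y $ k $ b * t a k c + Y $ k $ c * t a b k) = 0"
  shows "tri t (\<lambda>a. \<Sum>k\<in>UNIV. Y $ a $ k * x k) y z + tri t x (\<lambda>a. \<Sum>k\<in>UNIV. Y $ a $ k * y k) z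
    + tri t x y (\<lambda>a. \<Sum>k\<in>UNIV. Y $ a $ k * z k) = 0"
proof -
  have 1: "tri t (\<lambda>a. \<Sum>k\<in>UNIV. Y $ a $ k * x k) y z
    = (\<Sum>a\<in>UNIV. \<Sum>b\<in>UNIV. \<Sum>c\<in>UNIV. (\<Sum>k\<in>UNIV. Y $ k $ a * t k b c) * (x a * y b * z c))"
  proof -
    have "tri t (\<lambda>a. \<Sum>k\<in>UNIV. Y $ a $ k * x k) y z
      = (\<Sum>a\<in>UNIV. \<Sum>(b, c)\<in>UNIV. \<Sum>k\<in>UNIV. t a b c * (Y $ a $ k * x k * y b * z c))"
      unfolding tri_def sum_UNIV_pair prod.case by (simp add: sum_distrib_left sum_distrib_right)
    also have "\<dots> = (\<Sum>(b, c)\<in>UNIV. \<Sum>a\<in>UNIV. \<Sum>k\<in>UNIV. t a b c * (Y $ a $ k * x k * y b * z c))"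
      unfolding split_def by (rule sum.swap)
    also have "\<dots> = (\<Sum>(b, c)\<in>UNIV. \<Sum>k\<in>UNIV. \<Sum>a\<in>UNIV. t a b c * (Y $ a $ k * x k * y b * z c))"
      unfolding split_def by (intro sum.cong refl sum.swap)
    also have "\<dots> = (\<Sum>k\<in>UNIV. \<Sum>(b, c)\<in>UNIV. \<Sum>a\<in>UNIV. t a b c * (Y $ a $ k * x k * y b * z c))"
      unfolding split_def by (rule sum.swap)
    finally show ?thesis
      unfolding sum_UNIV_pair prod.case sum_distrib_right by (simp add: mult_ac)
  qed
  have 2: "tri t x (\<lambda>a. \<Sum>k\<in>UNIV. Y $ a $ k * y k) z
    = (\<Sum>a\<in>UNIV. \<Sum>b\<in>UNIV. \<Sum>c\<in>UNIV. (\<Sum>k\<in>UNIV. Y $ k $ b * t a k c) * (x a * y b * z c))"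
  proof -
    have "(\<Sum>b\<in>UNIV. \<Sum>c\<in>UNIV. t a b c * (x a * (\<Sum>k\<in>UNIV. Y $ b $ k * y k) * z c))
      = (\<Sum>b\<in>UNIV. \<Sum>c\<in>UNIV. (\<Sum>k\<in>UNIV. Y $ k $ b * t a k c) * (x a * y b * z c))" for a
    proof -
      have "(\<Sum>b\<in>UNIV. \<Sum>c\<in>UNIV. t a b c * (x a * (\<Sum>k\<in>UNIV. Y $ b $ k * y k) * z c))
        = (\<Sum>c\<in>UNIV. \<Sum>b\<in>UNIV. \<Sum>k\<in>UNIV. t a b c * (x a * (Y $ b $ k * y k) * z c))"
        by (subst sum.swap) (simp add: sum_distrib_left sum_distrib_right)
      also have "\<dots> = (\<Sum>c\<in>UNIV. \<Sum>k\<in>UNIV. \<Sum>b\<in>UNIV. t a b c * (x a * (Y $ b $ k * y k) * z c))"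
        by (intro sum.cong refl sum.swap)
      also have "\<dots> = (\<Sum>k\<in>UNIV. \<Sum>c\<in>UNIV. \<Sum>b\<in>UNIV. t a b c * (x a * (Y $ b $ k * y k) * z c))"
        by (rule sum.swap)
      also have "\<dots> = (\<Sum>k\<in>UNIV. \<Sum>c\<in>UNIV. (\<Sum>b\<in>UNIV. Y $ b $ k * t a b c) * (x a * y k * z c))"
        unfolding sum_distrib_right by (simp only: mult_ac)
      finally show ?thesis .
    qed
    then show ?thesis unfolding tri_def by simp
  qed
  have 3: "tri t x y (\<lambda>a. \<Sum>k\<in>UNIV. Y $ a $ k * z k)
    = (\<Sum>a\<in>UNIV. \<Sum>b\<in>UNIV. \<Sum>c\<in>UNIV. (\<Sum>k\<in>UNIV. Y $ k $ c * t a b k) * (x a * y b * z c))"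
  proof -
    have "(\<Sum>c\<in>UNIV. t a b c * (x a * y b * (\<Sum>k\<in>UNIV. Y $ c $ k * z k)))
      = (\<Sum>c\<in>UNIV. (\<Sum>k\<in>UNIV. Y $ k $ c * t a b k) * (x a * y b * z c))" for a b
      unfolding sum_distrib_left sum_distrib_right by (subst sum.swap) (simp add: mult_ac)
    then show ?thesis unfolding tri_def by simp
  qed
  have "(\<Sum>k\<in>UNIV. Y $ k $ a * t k b c) * w + (\<Sum>k\<in>UNIV. Y $ k $ b * t a k c) * w + (\<Sum>k\<in>UNIV. Y $ k $ c * t a b k) * w = 0"
    for a b c w
    using assms[of a b c] by (simp add: sum.distrib distrib_right[symmetric])
  then show ?thesis
    unfolding 1 2 3 sum.distrib[symmetric] by simp
qed

lemma tri_sum_list: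
  "tri t (\<lambda>a. \<Sum>(l, c)\<leftarrow>ls. of_int c * f l a) y z = (\<Sum>(l, c)\<leftarrow>ls. of_int c * tri t (f l) y z)"
  "tri t x (\<lambda>a. \<Sum>(l, c)\<leftarrow>ls. of_int c * f l a) z = (\<Sum>(l, c)\<leftarrow>ls. of_int c * tri t x (f l) z)"
  "tri t x y (\<lambda>a. \<Sum>(l, c)\<leftarrow>ls. of_int c * f l a) = (\<Sum>(l, c)\<leftarrow>ls. of_int c * tri t x y (f l))"
proof -
  have lin: "tri t (\<lambda>a. c * x a + x' a) y z = c * tri t x y z + tri t x' y z"
    "tri t x (\<lambda>a. c * y a + y' a) z = c * tri t x y z + tri t x y' z"
    "tri t x y (\<lambda>a. c * z a + z' a) = c * tri t x y z + tri t x y z'" for c x x' y y' z z'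
    by (simp_all add: tri_def sum_distrib_left sum.distrib[symmetric] algebra_simps)
  have zero: "tri t (\<lambda>a. 0) y z = 0" "tri t x (\<lambda>a. 0) z = 0" "tri t x y (\<lambda>a. 0) = 0" for x y z
    by (simp_all add: tri_def)
  show "tri t (\<lambda>a. \<Sum>(l, c)\<leftarrow>ls. of_int c * f l a) y z = (\<Sum>(l, c)\<leftarrow>ls. of_int c * tri t (f l) y z)"
    by (induction ls) (auto simp: lin zero)
  show "tri t x (\<lambda>a. \<Sum>(l, c)\<leftarrow>ls. of_int c * f l a) z = (\<Sum>(l, c)\<leftarrow>ls. of_int c * tri t x (f l) z)"
    by (induction ls) (auto simp: lin zero)
  show "tri t x y (\<lambda>a. \<Sum>(l, c)\<leftarrow>ls. of_int c * f l a) = (\<Sum>(l, c)\<leftarrow>ls. of_int c * tri t x y (f l))"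
    by (induction ls) (auto simp: lin zero)
qed

lemma invariant_cubic_determined:
  fixes t :: "'n::finite \<Rightarrow> 'n \<Rightarrow> 'n \<Rightarrow> complex" and b :: "nat \<Rightarrow> 'n \<Rightarrow> complex" and h :: "complex^'n^'n"
  assumes sym: "\<And>a b c. t b a c = t a b c" "\<And>a b c. t a c b = t a b c"
    and inv: "\<And>Y a b c. Y = h \<or> (\<exists>s<r. Y = F s) \<Longrightarrow>
      (\<Sum>k\<in>UNIV. Y $ k $ a * t k b c + Y $ k $ b * t a k c + Y $ k $ c * t a b k) = 0"
    and h: "\<And>k a. k < N \<Longrightarrow> (\<Sum>c\<in>UNIV. h $ a $ c * b k c) = of_int (nus ! k) * b k a"
    and F: "\<And>s k a. s < r \<Longrightarrow> k < N \<Longrightarrow> (\<Sum>c\<in>UNIV. F s $ a $ c * b k c) = (\<Sum>(l, c)\<leftarrow>edge_terms D s k. of_int c * b l a)"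
    and "length nus = N" "covers nus tab" "determines N r D tab [k0] cert" "cubic_coeff tab k0 \<noteq> 0"
  shows "\<exists>C. \<forall>i<N. \<forall>j<N. \<forall>k<N. tri t (b i) (b j) (b k) = C * cubic_of tab i j k"
proof (rule determined_up_to_scalar)
  show "tri t (b j) (b i) (b k) = tri t (b i) (b j) (b k)" for i j k
    unfolding tri_def by (subst sum.swap) (simp add: sym mult_ac)
  show "tri t (b i) (b k) (b j) = tri t (b i) (b j) (b k)" for i j k
    unfolding tri_def by (rule sum.cong[OF refl], subst sum.swap) (simp add: sym mult_ac)
  show "of_int (nus ! i + nus ! j + nus ! k) * tri t (b i) (b j) (b k) = 0" if "i < N" "j < N" "k < N" for i j k
    \<comment> \<open>With singleton lists, \<open>tri_sum_list\<close> expresses homogeneity in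
      each argument.\<close>
    using tri_derivation[of h t "b i" "b j" "b k"] inv[of h] that
      tri_sum_list(1)[where t = t and ls = "[(i, nus ! i)]" and f = b] tri_sum_list(2)[where t = t and ls = "[(j, nus ! j)]" and f = b]
      tri_sum_list(3)[where t = t and ls = "[(k, nus ! k)]" and f = b]
    by (simp add: h distrib_right)
  show "(\<Sum>(l, x)\<leftarrow>edge_terms D s i. of_int x * tri t (b l) (b j) (b k)) + (\<Sum>(l, x)\<leftarrow>edge_terms D s j. of_int x * tri t (b i) (b l) (b k))
        + (\<Sum>(l, x)\<leftarrow>edge_terms D s k. of_int x * tri t (b i) (b j) (b l)) = 0"
    if "s < r" "i < N" "j < N" "k < N" for s i j k
    using tri_derivation[of "F s" t "b i" "b j" "b k"] inv[of "F s"] that by (auto simp: F tri_sum_list)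
qed fact+


text \<open>The two tensors are computed on dual bases: \<open>dL\<close> on \<open>b\<close> with
  the lowering operators and the edges \<open>DL\<close>, \<open>dU\<close> on \<open>b'\<close>
  with the transposed raising operators and the edges \<open>DU\<close>. The two lists agree
  whenever raising is the transpose of lowering in the chosen basis; the symmetric tensors are the
  case where they differ.\<close>

lemma cubic_pair_of_weight_basis:
  fixes dU dL :: "'n::finite cubic" and L :: "(complex^'n^'n) set" and b :: "nat \<Rightarrow> complex^'n"
  assumes d: "d_tensors L dU dL"
    and card: "CARD('n) = 3 * m + 3" "N = 3 * m + 3"
    and b: "\<And>k. k < N \<Longrightarrow> b k \<noteq> 0"
    and h: "h \<in> L" "\<And>k. k < N \<Longrightarrow> h *v b k = of_int (nus ! k) *s b k" "length nus = N" "distinct nus"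
    and F: "\<And>s. s < r \<Longrightarrow> F s \<in> L"
      "\<And>s k. s < r \<Longrightarrow> k < N \<Longrightarrow> F s *v b k = (\<Sum>(l, c)\<leftarrow>edge_terms DL s k. of_int c *s b l)"
    and E: "\<And>s. s < r \<Longrightarrow> E s \<in> L"
      "\<And>s k. s < r \<Longrightarrow> k < N \<Longrightarrow> E s *v b k = (\<Sum>(l, c)\<leftarrow>edge_terms (reverse_edges DU) s k. of_int c *s b l)"
    and DU: "list_all (\<lambda>(s, k, l, c). k < N \<and> l < N) DU"
    and covers: "covers nus tabL" "covers nus tabU"
    and det: "determines N r DL tabL [k0] certL" "cubic_coeff tabL k0 \<noteq> 0"
      "determines N r DU tabU [k1] certU" "cubic_coeff tabU k1 \<noteq> 0"
    and adj: "adjoint_identity {..<N} (cubic_of tabU) (cubic_of tabL) \<mu>"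
      "adjoint_identity {..<N} (cubic_of tabL) (cubic_of tabU) \<mu>'"
  shows "cubic_pair (tensor dU) (tensor dL) (1 / (of_nat m + 2))"
proof -
  have dU: "dU \<in> sym3_invariants L" and dL: "dL \<in> sym3_invariants (dual_rep L)"
    using d vec.span_base[of dU "{dU}"] vec.span_base[of dL "{dL}"] by (auto simp: d_tensors_def)
  have symU: "tensor dU b a c = tensor dU a b c" "tensor dU a c b = tensor dU a b c" for a b c
    using dU unfolding sym3_invariants_def tensor_def by blast+
  have symL: "tensor dL b a c = tensor dL a b c" "tensor dL a c b = tensor dL a b c" for a b c
    using dL unfolding sym3_invariants_def tensor_def by blast+
  have invU: "(\<Sum>k\<in>UNIV. X $ a $ k * tensor dU k b c + X $ b $ k * tensor dU a k c + X $ c $ k * tensor dU a b k) = 0"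
    if "X \<in> L" for a b c X
    using dU that unfolding sym3_invariants_def tensor_def by blast
  have invL': "(\<Sum>k\<in>UNIV. (- transpose X) $ a $ k * tensor dL k b c + (- transpose X) $ b $ k * tensor dL a k c
      + (- transpose X) $ c $ k * tensor dL a b k) = 0" if "X \<in> L" for a b c X
    using dL that unfolding sym3_invariants_def tensor_def dual_rep_def by blast
  \<comment> \<open>The invariance equation is homogeneous in the operator, so the sign of the dual
    action drops out.\<close>
  have invL: "(\<Sum>k\<in>UNIV. X $ k $ a * tensor dL k b c + X $ k $ b * tensor dL a k c + X $ k $ c * tensor dL a b k) = 0"
    if "X \<in> L" for a b c X
  proof -
    have "(\<Sum>k\<in>UNIV. X $ k $ a * tensor dL k b c + X $ k $ b * tensor dL a k c + X $ k $ c * tensor dL a b k)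
      = - (\<Sum>k\<in>UNIV. (- transpose X) $ a $ k * tensor dL k b c + (- transpose X) $ b $ k * tensor dL a k c
      + (- transpose X) $ c $ k * tensor dL a b k)"
      by (simp add: transpose_def sum_negf[symmetric] algebra_simps)
    then show ?thesis using invL'[OF that, of a b c] by simp
  qed
  have normalised: "(\<Sum>x\<in>UNIV. \<Sum>y\<in>UNIV. tensor dU a x y * tensor dL b x y) = delta a b" for a b
    using d by (simp add: d_tensors_def tensor_def delta_def)
  have inj: "inj_on (\<lambda>k. complex_of_int (nus ! k)) {..<N}"
    using h(3,4) by (auto simp: inj_on_def nth_eq_iff_index_eq)
  obtain b' :: "nat \<Rightarrow> 'n \<Rightarrow> complex" where
    orth: "\<And>i j. i \<in> {..<N} \<Longrightarrow> j \<in> {..<N} \<Longrightarrow> (\<Sum>a\<in>UNIV. b' i a * b j $ a) = delta i j"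
    and complete: "\<And>a c. (\<Sum>k\<in>{..<N}. b k $ a * b' k c) = delta a c"
    using eigenbasis_dual[of "{..<N}" h b "\<lambda>k. of_int (nus ! k)"] b h inj card by auto
  have expand: "v c = (\<Sum>j<N. (\<Sum>a\<in>UNIV. v a * b j $ a) * b' j c)" for v :: "'n \<Rightarrow> complex" and c
  proof -
    have "(\<Sum>j<N. (\<Sum>a\<in>UNIV. v a * b j $ a) * b' j c) = (\<Sum>a\<in>UNIV. v a * (\<Sum>j<N. b j $ a * b' j c))"
      unfolding sum_distrib_left sum_distrib_right by (subst sum.swap) (simp add: mult_ac)
    also have "\<dots> = v c"
      unfolding complete by (simp only: sum_delta_complex)
    finally show ?thesis by simp
  qed
  have pair: "(\<Sum>a\<in>UNIV. (\<Sum>c\<in>UNIV. transpose X $ a $ c * b' i c) * b j $ a) = (\<Sum>c\<in>UNIV. b' i c * (X *v b j) $ c)"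
    for X :: "complex^'n^'n" and i j
    unfolding transpose_def matrix_vector_mult_def
    by (simp add: sum_distrib_left sum_distrib_right, subst sum.swap) (simp add: mult_ac)
  \<comment> \<open>The transpose has the same eigenvalue on the dual vector, so one list of weights
    serves both tensors; the sign of the dual action does not affect which sums are zero.\<close>
  have h': "(\<Sum>c\<in>UNIV. transpose h $ a $ c * b' i c) = of_int (nus ! i) * b' i a" if "i < N" for i a
  proof -
    have "(\<Sum>c\<in>UNIV. transpose h $ a $ c * b' i c) = (\<Sum>j<N. (\<Sum>c\<in>UNIV. b' i c * (h *v b j) $ c) * b' j a)"
      by (subst expand) (simp only: pair)
    also have "\<dots> = (\<Sum>j<N. if j = i then of_int (nus ! i) * b' i a else 0)"
    proof (rule sum.cong[OF refl])
      fix j assume j: "j \<in> {..<N}"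
      have "(\<Sum>c\<in>UNIV. b' i c * (h *v b j) $ c) = of_int (nus ! j) * (\<Sum>c\<in>UNIV. b' i c * b j $ c)"
        using h(2)[of j] j by (simp add: sum_distrib_left mult_ac)
      then show "(\<Sum>c\<in>UNIV. b' i c * (h *v b j) $ c) * b' j a = (if j = i then of_int (nus ! i) * b' i a else 0)"
        using orth[of i j] j that by (auto simp: delta_def)
    qed
    finally show ?thesis using that by simp
  qed
  have E': "(\<Sum>c\<in>UNIV. transpose (E s) $ a $ c * b' i c) = (\<Sum>(l, c)\<leftarrow>edge_terms DU s i. of_int c * b' l a)"
    if "s < r" "i < N" for s i a
  proof -
    have Eb: "(\<Sum>c\<in>UNIV. b' i c * (E s *v b j) $ c) = (\<Sum>(l, c)\<leftarrow>edge_terms (reverse_edges DU) s j. of_int c * delta i l)"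
      if j: "j < N" for j
    proof -
      have "(\<Sum>c\<in>UNIV. b' i c * (\<Sum>(l, c)\<leftarrow>ls. of_int c *s b l) $ c) = (\<Sum>(l, c)\<leftarrow>ls. of_int c * (\<Sum>a\<in>UNIV. b' i a * b l $ a))" for ls
        by (induction ls) (auto simp: algebra_simps sum.distrib sum_distrib_left)
      then have "(\<Sum>c\<in>UNIV. b' i c * (E s *v b j) $ c)
        = (\<Sum>(l, c)\<leftarrow>edge_terms (reverse_edges DU) s j. of_int c * (\<Sum>a\<in>UNIV. b' i a * b l $ a))"
        unfolding E(2)[OF \<open>s < r\<close> j] .
      moreover have "l < N" if "(l, c) \<in> set (edge_terms (reverse_edges DU) s j)" for l c
        using DU that by (auto simp: edge_terms_def reverse_edges_def list_all_iff)
      ultimately show ?thesis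
        using orth \<open>i < N\<close> by (auto intro!: arg_cong[of _ _ sum_list])
    qed
    have "(\<Sum>c\<in>UNIV. transpose (E s) $ a $ c * b' i c)
      = (\<Sum>j<N. (\<Sum>(l, c)\<leftarrow>edge_terms (reverse_edges DU) s j. of_int c * delta i l) * b' j a)"
      by (subst expand) (simp only: pair, simp add: Eb)
    also have "\<dots> = (\<Sum>(l, c)\<leftarrow>edge_terms DU s i. of_int c * b' l a)"
      using DU
    proof (induction DU)
      case (Cons e DU)
      obtain s' k l c where e: "e = (s', k, l, c)" by (metis prod_cases4)
      have "(\<Sum>(l, c)\<leftarrow>edge_terms (reverse_edges (e # DU)) s j. of_int c * delta i l) * b' j a
        = (if j = l then (if s' = s \<and> k = i then of_int c * b' l a else 0) else 0)
          + (\<Sum>(l, c)\<leftarrow>edge_terms (reverse_edges DU) s j. of_int c * delta i l) * b' j a" for j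
        by (auto simp: e edge_terms_def reverse_edges_def delta_def algebra_simps)
      then show ?case
        using Cons by (simp add: sum.distrib e) (simp add: edge_terms_def)
    qed (simp add: edge_terms_def reverse_edges_def)
    finally show ?thesis .
  qed
  obtain C where C: "\<forall>i<N. \<forall>j<N. \<forall>k<N. tri (tensor dL) (($) (b i)) (($) (b j)) (($) (b k)) = C * cubic_of tabL i j k"
  proof -
    have 1: "(\<Sum>k\<in>UNIV. Y $ k $ x * tensor dL k y z + Y $ k $ y * tensor dL x k z + Y $ k $ z * tensor dL x y k) = 0"
      if "Y = h \<or> (\<exists>s<r. Y = F s)" for Y x y z
      using invL that h(1) F(1) by auto
    have 2: "(\<Sum>c\<in>UNIV. h $ a $ c * b k $ c) = of_int (nus ! k) * b k $ a" if "k < N" for k a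
      using arg_cong[OF h(2)[OF that], of "\<lambda>v. v $ a"] by (simp add: matrix_vector_mult_def)
    have 3: "(\<Sum>c\<in>UNIV. F s $ a $ c * b k $ c) = (\<Sum>(l, c)\<leftarrow>edge_terms DL s k. of_int c * b l $ a)" if "s < r" "k < N" for s k a
    proof -
      have "(\<Sum>(l, c)\<leftarrow>ls. of_int c *s b l) $ a = (\<Sum>(l, c)\<leftarrow>ls. of_int c * b l $ a)" for ls
        by (induction ls) auto
      then show ?thesis
        using arg_cong[OF F(2)[OF that], of "\<lambda>v. v $ a"] by (simp add: matrix_vector_mult_def)
    qed
    show ?thesis
      using invariant_cubic_determined[where t = "tensor dL" and b = "\<lambda>k. ($) (b k)" and F = F and r = r,
          OF symL 1 2 3 h(3) covers(1) det(1,2)] that by blast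
  qed
  obtain C' where C': "\<forall>i<N. \<forall>j<N. \<forall>k<N. tri (tensor dU) (b' i) (b' j) (b' k) = C' * cubic_of tabU i j k"
  proof -
    have 1: "(\<Sum>k\<in>UNIV. Y $ k $ x * tensor dU k y z + Y $ k $ y * tensor dU x k z + Y $ k $ z * tensor dU x y k) = 0"
      if "Y = transpose h \<or> (\<exists>s<r. Y = transpose (E s))" for Y x y z
      using invU that h(1) E(1) by (auto simp: transpose_def)
    show ?thesis
      using invariant_cubic_determined[where t = "tensor dU" and b = b' and F = "\<lambda>s. transpose (E s)" and r = r,
          OF symU 1 h' E' h(3) covers(2) det(3,4)] that by blast
  qed
  have orth': "(\<Sum>a\<in>UNIV. b i $ a * b' j a) = delta i j" if "i \<in> {..<N}" "j \<in> {..<N}" for i j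
    using orth[OF that(2,1)] by (simp add: mult.commute delta_commute)
  have complete': "(\<Sum>k\<in>{..<N}. b' k a * b k $ c) = delta a c" for a c
    using complete[of c a] by (simp add: mult.commute delta_commute)
  have "adjoint_identity UNIV (tensor dU) (tensor dL) (C * C' * \<mu>)"
    by (rule adjoint_identity_basis_change[where b = "\<lambda>k. ($) (b k)", OF _ orth complete _ _ adj(1)]) (use C C' in auto)
  moreover have "adjoint_identity UNIV (tensor dL) (tensor dU) (C' * C * \<mu>')"
    by (rule adjoint_identity_basis_change[where b = b' and b' = "\<lambda>k. ($) (b k)", OF _ orth' complete' _ _ adj(2)]) (use C C' in auto)
  ultimately have "cubic_pair (tensor dU) (tensor dL) (3 / (of_nat CARD('n) + 3))"
    by (rule cubic_pair_of_adjoint_identity[OF symU symL normalised])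
  moreover have "3 / (of_nat CARD('n) + 3) = 1 / (of_nat m + 2 :: complex)"
  proof -
    have "of_nat CARD('n) + 3 = 3 * (of_nat m + 2 :: complex)"
      unfolding card by simp
    then show ?thesis
      by (simp only:) (rule mult_divide_mult_cancel_left[of 3 1 "of_nat m + 2 :: complex", simplified mult_1_right], simp)
  qed
  ultimately show ?thesis by simp
qed

section \<open>Operators on spaces of tensors\<close>

definition unit_matrix :: "'k \<Rightarrow> 'k \<Rightarrow> complex^'k^'k"
  where "unit_matrix p q = (\<chi> a b. if a = p \<and> b = q then 1 else 0)"

definition diagonal_matrix :: "('k \<Rightarrow> complex) \<Rightarrow> complex^'k^'k"
  where "diagonal_matrix d = (\<chi> a b. if a = b then d a else 0)"

definition unit_tensor :: "'k::finite \<Rightarrow> 'l::finite \<Rightarrow> complex^('k \<times> 'l)"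
  where "unit_tensor i j = axis (i, j) 1"

lemma unit_tensor_nth [simp]: "unit_tensor i j $ (a, b) = (if a = i \<and> b = j then 1 else 0)"
  by (auto simp: unit_tensor_def axis_def)

lemma unit_matrix_in_sl: "p \<noteq> q \<Longrightarrow> unit_matrix p q \<in> sl"
  by (auto simp: sl_def unit_matrix_def trace_def intro!: sum.neutral)

lemma diagonal_matrix_in_sl: "(\<Sum>i\<in>UNIV. d i) = 0 \<Longrightarrow> diagonal_matrix d \<in> sl"
  by (simp add: sl_def diagonal_matrix_def trace_def)

lemma zero_in_sl: "0 \<in> sl"
  by (simp add: sl_def trace_def)

lemma tensor_act_add: "tensor_act X Y (s + t) = tensor_act X Y s + tensor_act X Y t"
  by (simp add: tensor_act_def vec_eq_iff sum.distrib algebra_simps)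

lemma tensor_act_scale: "tensor_act X Y (c *s t) = c *s tensor_act X Y t"
  by (simp add: tensor_act_def vec_eq_iff sum_distrib_left algebra_simps)

lemma tensor_act_unit_tensor:
  "tensor_act X Y (unit_tensor i j) $ (a, b) = (if b = j then X $ a $ i else 0) + (if a = i then Y $ b $ j else 0)"
proof -
  have "(\<Sum>k\<in>UNIV. X $ a $ k * unit_tensor i j $ (k, b)) = (\<Sum>k\<in>UNIV. if k = i then (if b = j then X $ a $ i else 0) else 0)"
    by (intro sum.cong refl) auto
  moreover have "(\<Sum>l\<in>UNIV. Y $ b $ l * unit_tensor i j $ (a, l)) = (\<Sum>l\<in>UNIV. if l = j then (if a = i then Y $ b $ j else 0) else 0)"
    by (intro sum.cong refl) auto
  ultimately show ?thesis by (simp add: tensor_act_def)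
qed

lemma tensor_act_unit_matrix:
  "tensor_act (unit_matrix p q) (unit_matrix p' q') (unit_tensor i j)
    = (if i = q then unit_tensor p j else 0) + (if j = q' then unit_tensor i p' else 0)"
  "tensor_act (unit_matrix p q) 0 (unit_tensor i j) = (if i = q then unit_tensor p j else 0)"
  "tensor_act 0 (unit_matrix p' q') (unit_tensor i j) = (if j = q' then unit_tensor i p' else 0)"
  by (auto simp: vec_eq_iff tensor_act_unit_tensor unit_matrix_def)

lemma tensor_act_diagonal_matrix:
  "tensor_act (diagonal_matrix d) (diagonal_matrix d') (unit_tensor i j) = (d i + d' j) *s unit_tensor i j"
  by (auto simp: vec_eq_iff tensor_act_unit_tensor diagonal_matrix_def)

text \<open>For \<open>\<epsilon> = 1\<close> and \<open>i = j\<close> this is twice the unit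
  tensor. Hence an elementary matrix sends the vector of \<open>(i, i)\<close> to twice that of
  \<open>(i, j)\<close>, but the vector of \<open>(i, j)\<close> to that of \<open>(j, j)\<close>;
  this is the source of the coefficients 2 in \<open>sym2_edges\<close>.\<close>

definition pair_tensor :: "complex \<Rightarrow> 'k::finite \<Rightarrow> 'k \<Rightarrow> complex^('k \<times> 'k)"
  where "pair_tensor \<epsilon> i j = unit_tensor i j + \<epsilon> *s unit_tensor j i"

lemma tensor_act_pair_tensor:
  "tensor_act (unit_matrix p q) (unit_matrix p q) (pair_tensor \<epsilon> i j)
    = (if i = q then pair_tensor \<epsilon> p j else 0) + (if j = q then pair_tensor \<epsilon> i p else 0)"
  "tensor_act (diagonal_matrix d) (diagonal_matrix d) (pair_tensor \<epsilon> i j) = (d i + d j) *s pair_tensor \<epsilon> i j"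
  by (simp_all add: pair_tensor_def tensor_act_add tensor_act_scale tensor_act_unit_matrix tensor_act_diagonal_matrix
      vec_eq_iff algebra_simps)

lemma pair_tensor_swap: "pair_tensor 1 j i = pair_tensor 1 i j"
  by (simp add: pair_tensor_def)

lemma pair_tensor_same: "pair_tensor (-1) i i = 0"
  by (simp add: pair_tensor_def)

lemma pair_tensor_nonzero:
  "pair_tensor 1 i j \<noteq> 0" "i \<noteq> j \<Longrightarrow> pair_tensor (-1) i j \<noteq> 0"
proof -
  have *: "pair_tensor \<epsilon> i j $ (i, j) = 1 + (if i = j then \<epsilon> else 0)" for \<epsilon>
    by (simp add: pair_tensor_def)
  have "pair_tensor 1 i j $ (i, j) \<noteq> 0"
    unfolding * by simp
  then show "pair_tensor 1 i j \<noteq> 0" by auto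
  assume "i \<noteq> j"
  then have "pair_tensor (-1) i j $ (i, j) \<noteq> 0"
    unfolding * by simp
  then show "pair_tensor (-1) i j \<noteq> 0" by auto
qed

lemma pair_tensor_in: "pair_tensor 1 i j \<in> sym2" "pair_tensor (-1) i j \<in> ext2"
proof -
  have "unit_tensor j i $ (a, b) = unit_tensor i j $ (b, a)" for a b
    by (simp only: unit_tensor_nth conj_commute)
  then have *: "pair_tensor \<epsilon> i j $ (a, b) = unit_tensor i j $ (a, b) + \<epsilon> * unit_tensor i j $ (b, a)" for \<epsilon> a b
    unfolding pair_tensor_def by (simp only: vector_add_component vector_smult_component)
  show "pair_tensor 1 i j \<in> sym2" "pair_tensor (-1) i j \<in> ext2"
    unfolding sym2_def ext2_def mem_Collect_eq * by (simp_all del: unit_tensor_nth)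
qed

lemma tensor_act_swap:
  assumes "\<And>i j. t $ (j, i) = c * t $ (i, j)"
  shows "tensor_act X X t $ (j, i) = c * tensor_act X X t $ (i, j)"
proof -
  have "tensor_act X X t $ (j, i) = (\<Sum>k\<in>UNIV. X $ j $ k * t $ (k, i)) + (\<Sum>l\<in>UNIV. X $ i $ l * t $ (j, l))"
    by (simp add: tensor_act_def)
  also have "\<dots> = (\<Sum>k\<in>UNIV. X $ j $ k * (c * t $ (i, k))) + (\<Sum>l\<in>UNIV. X $ i $ l * (c * t $ (l, j)))"
    by (intro arg_cong2[of _ _ _ _ "(+)"] sum.cong refl arg_cong2[of _ _ _ _ "(*)"] assms)
  also have "\<dots> = c * tensor_act X X t $ (i, j)"
    by (simp add: tensor_act_def sum_distrib_left algebra_simps)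
  finally show ?thesis .
qed

lemma tensor_act_sym2:
  assumes "t \<in> sym2" shows "tensor_act X X t \<in> sym2"
proof -
  have "\<forall>i j. t $ (j, i) = t $ (i, j)"
    using assms unfolding sym2_def mem_Collect_eq .
  then have "t $ (j, i) = 1 * t $ (i, j)" for i j
    unfolding mult_1 by blast
  from tensor_act_swap[of t 1, OF this] show ?thesis
    unfolding sym2_def mem_Collect_eq mult_1 by blast
qed

lemma tensor_act_ext2:
  assumes "t \<in> ext2" shows "tensor_act X X t \<in> ext2"
proof -
  have "\<forall>i j. t $ (j, i) = - t $ (i, j)"
    using assms unfolding ext2_def mem_Collect_eq .
  then have "t $ (j, i) = (-1) * t $ (i, j)" for i j
    unfolding mult_minus1 by blast
  from tensor_act_swap[of t "-1", OF this] show ?thesis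
    unfolding ext2_def mem_Collect_eq mult_minus1 by blast
qed

section \<open>Matrices of operators in an arbitrary basis\<close>

lemma is_basis_coordinates:
  fixes e :: "'n::finite \<Rightarrow> complex^'w::finite"
  assumes "is_basis e W" "w \<in> W"
  shows "\<exists>x :: complex^'n. w = (\<Sum>a\<in>UNIV. x $ a *s e a)"
proof -
  have "inj e" "w \<in> vec.span (range e)"
    using assms by (auto simp: is_basis_def)
  then obtain u where "(\<Sum>v\<in>range e. u v *s v) = w"
    using vec.span_finite[of "range e"] by auto
  then have "w = (\<Sum>a\<in>UNIV. (\<chi> a. u (e a)) $ a *s e a)"
    using \<open>inj e\<close> by (simp add: sum.reindex)
  then show ?thesis by blast
qed

lemma is_basis_unique:
  fixes e :: "'n::finite \<Rightarrow> complex^'w::finite"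
  assumes "is_basis e W" "(\<Sum>a\<in>UNIV. x $ a *s e a) = (\<Sum>a\<in>UNIV. y $ a *s e a)"
  shows "x = y"
proof -
  have e: "inj e" "vec.independent (range e)"
    using assms(1) by (auto simp: is_basis_def)
  have "(\<Sum>v\<in>range e. (x - y) $ (inv e v) *s v) = (\<Sum>a\<in>UNIV. (x - y) $ a *s e a)"
    using e(1) by (simp add: sum.reindex)
  also have "\<dots> = 0"
    using assms(2) by (simp add: vec.scale_left_diff_distrib sum_subtractf)
  finally have "(x - y) $ (inv e (e a)) = 0" for a
    by (intro vec.independentD[OF e(2), of "range e" "\<lambda>v. (x - y) $ (inv e v)" "e a"]) auto
  then show ?thesis using e(1) by (simp add: vec_eq_iff)
qed

text \<open>The tables speak of explicit vectors \<open>f\<close>, the matrices of an arbitrary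
  basis \<open>e\<close>. The coordinate map \<open>\<Phi>\<close> is injective and intertwines an
  operator with its matrix, so each expansion of \<open>T (f k)\<close> transfers to coordinate
  vectors.\<close>

lemma operator_matrices_transport:
  fixes e :: "'n::finite \<Rightarrow> complex^'w::finite" and f :: "nat \<Rightarrow> complex^'w"
  assumes basis: "is_basis e W" and f: "\<And>k. f k \<in> W"
    and \<T>: "\<forall>T\<in>\<T>. (\<forall>x y. T (x + y) = T x + T y) \<and> (\<forall>c x. T (c *s x) = c *s T x) \<and> (\<forall>w\<in>W. T w \<in> W)"
  shows "\<exists>b mat. (\<forall>k. f k \<noteq> 0 \<longrightarrow> b k \<noteq> 0) \<and> (\<forall>T\<in>\<T>. mat T \<in> operator_matrices e \<T> \<and>
    (\<forall>k ls. T (f k) = (\<Sum>(l, c)\<leftarrow>ls. of_int c *s f l) \<longrightarrow> mat T *v b k = (\<Sum>(l, c)\<leftarrow>ls. of_int c *s b l)))"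
proof -
  have lin: "T (x + y) = T x + T y" "T (c *s x) = c *s T x" and W: "w \<in> W \<Longrightarrow> T w \<in> W" if "T \<in> \<T>" for T x y c w
    using \<T> that by blast+
  define \<Phi> where "\<Phi> x = (\<Sum>a\<in>UNIV. x $ a *s e a)" for x :: "complex^'n"
  have \<Phi>: "\<Phi> (x + y) = \<Phi> x + \<Phi> y" "\<Phi> (c *s x) = c *s \<Phi> x" "\<Phi> 0 = 0" for x y c
    by (simp_all add: \<Phi>_def vec.scale_left_distrib sum.distrib vec.scale_sum_right)
  have "\<exists>x. \<Phi> x = f k" for k
    using is_basis_coordinates[OF basis f] by (metis \<Phi>_def)
  then obtain b where b: "\<Phi> (b k) = f k" for k by metis
  have \<Phi>_list: "\<Phi> (\<Sum>(l, c)\<leftarrow>ls. of_int c *s b l) = (\<Sum>(l, c)\<leftarrow>ls. of_int c *s f l)" for ls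
    by (induction ls) (auto simp: \<Phi> b)
  have b0: "b k \<noteq> 0" if "f k \<noteq> 0" for k
    using that b[of k] \<Phi>(3) by auto
  have ex: "\<exists>M. M \<in> operator_matrices e \<T> \<and> (\<forall>k ls. T (f k) = (\<Sum>(l, c)\<leftarrow>ls. of_int c *s f l) \<longrightarrow>
      M *v b k = (\<Sum>(l, c)\<leftarrow>ls. of_int c *s b l))" if T: "T \<in> \<T>" for T
  proof -
    have "e c \<in> W" for c
      using basis vec.span_superset[of "range e"] by (auto simp: is_basis_def)
    then have "\<exists>x :: complex^'n. T (e c) = (\<Sum>a\<in>UNIV. x $ a *s e a)" for c
      using is_basis_coordinates[OF basis W[OF T]] by blast
    then obtain m where m: "T (e c) = (\<Sum>a\<in>UNIV. (m c :: complex^'n) $ a *s e a)" for c by metis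
    define M where "M = (\<chi> a c. m c $ a)"
    have M: "T (e c) = (\<Sum>a\<in>UNIV. M $ a $ c *s e a)" for c
      unfolding m by (simp add: M_def)
    have "T 0 = 0" using lin(2)[OF T, of 0 0] by simp
    then have T_sum: "T (\<Sum>a\<in>S. g a) = (\<Sum>a\<in>S. T (g a))" for S and g :: "'n \<Rightarrow> complex^'w"
      by (induction S rule: infinite_finite_induct) (simp_all add: lin(1)[OF T])
    have TM: "T (\<Phi> x) = \<Phi> (M *v x)" for x
    proof -
      have "T (\<Phi> x) = (\<Sum>c\<in>UNIV. \<Sum>a\<in>UNIV. (x $ c * M $ a $ c) *s e a)"
        unfolding \<Phi>_def T_sum by (simp add: lin(2)[OF T] M vec.scale_sum_right)
      also have "\<dots> = (\<Sum>a\<in>UNIV. \<Sum>c\<in>UNIV. (x $ c * M $ a $ c) *s e a)"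
        by (rule sum.swap)
      also have "\<dots> = \<Phi> (M *v x)"
        by (simp add: \<Phi>_def matrix_vector_mult_def vec.scale_sum_left mult.commute)
      finally show ?thesis .
    qed
    have "M \<in> operator_matrices e \<T>"
      using T M unfolding operator_matrices_def by blast
    moreover have "M *v b k = (\<Sum>(l, c)\<leftarrow>ls. of_int c *s b l)" if "T (f k) = (\<Sum>(l, c)\<leftarrow>ls. of_int c *s f l)" for k ls
    proof -
      have "\<Phi> (M *v b k) = \<Phi> (\<Sum>(l, c)\<leftarrow>ls. of_int c *s b l)"
        unfolding TM[symmetric] b \<Phi>_list by (rule that)
      then show ?thesis
        unfolding \<Phi>_def by (rule is_basis_unique[OF basis])
    qed
    ultimately show ?thesis by blast
  qed
  have "\<forall>T. \<exists>M. T \<in> \<T> \<longrightarrow> M \<in> operator_matrices e \<T> \<and> (\<forall>k ls. T (f k) = (\<Sum>(l, c)\<leftarrow>ls. of_int c *s f l) \<longrightarrow>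
      M *v b k = (\<Sum>(l, c)\<leftarrow>ls. of_int c *s b l))"
    using ex by blast
  from choice[OF this] obtain mat where "\<forall>T. T \<in> \<T> \<longrightarrow> mat T \<in> operator_matrices e \<T> \<and>
    (\<forall>k ls. T (f k) = (\<Sum>(l, c)\<leftarrow>ls. of_int c *s f l) \<longrightarrow> mat T *v b k = (\<Sum>(l, c)\<leftarrow>ls. of_int c *s b l))" ..
  then show ?thesis using b0 by (intro exI[of _ b] exI[of _ mat]) simp
qed

lemma cubic_pair_of_operators:
  fixes dU dL :: "'n::finite cubic" and e :: "'n \<Rightarrow> complex^'w::finite" and f :: "nat \<Rightarrow> complex^'w"
  assumes d: "d_tensors (operator_matrices e \<T>) dU dL"
    and basis: "is_basis e W" and f: "\<And>k. f k \<in> W" "\<And>k. k < N \<Longrightarrow> f k \<noteq> 0"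
    and \<T>: "\<forall>T\<in>\<T>. (\<forall>x y. T (x + y) = T x + T y) \<and> (\<forall>c x. T (c *s x) = c *s T x) \<and> (\<forall>w\<in>W. T w \<in> W)"
    and card: "CARD('n) = 3 * m + 3" "N = 3 * m + 3"
    and h: "h \<in> \<T>" "\<And>k. k < N \<Longrightarrow> h (f k) = of_int (nus ! k) *s f k" "length nus = N" "distinct nus"
    and F: "\<And>s. s < r \<Longrightarrow> F s \<in> \<T>"
      "\<And>s k. s < r \<Longrightarrow> k < N \<Longrightarrow> F s (f k) = (\<Sum>(l, c)\<leftarrow>edge_terms DL s k. of_int c *s f l)"
    and E: "\<And>s. s < r \<Longrightarrow> E s \<in> \<T>"
      "\<And>s k. s < r \<Longrightarrow> k < N \<Longrightarrow> E s (f k) = (\<Sum>(l, c)\<leftarrow>edge_terms (reverse_edges DU) s k. of_int c *s f l)"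
    and checks: "list_all (\<lambda>(s, k, l, c). k < N \<and> l < N) DU"
      "covers nus tabL" "covers nus tabU"
      "determines N r DL tabL [k0] certL" "cubic_coeff tabL k0 \<noteq> 0"
      "determines N r DU tabU [k1] certU" "cubic_coeff tabU k1 \<noteq> 0"
      "adjoint_identity {..<N} (cubic_of tabU) (cubic_of tabL) \<mu>"
      "adjoint_identity {..<N} (cubic_of tabL) (cubic_of tabU) \<mu>'"
  shows "cubic_pair (tensor dU) (tensor dL) (1 / (of_nat m + 2))"
proof -
  obtain b :: "nat \<Rightarrow> complex^'n" and mat where b: "\<forall>k. f k \<noteq> 0 \<longrightarrow> b k \<noteq> 0"
    and mat: "\<forall>T\<in>\<T>. mat T \<in> operator_matrices e \<T> \<and> (\<forall>k ls. T (f k) = (\<Sum>(l, c)\<leftarrow>ls. of_int c *s f l) \<longrightarrow>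
      mat T *v b k = (\<Sum>(l, c)\<leftarrow>ls. of_int c *s b l))"
    using operator_matrices_transport[where f = f and \<T> = \<T>, OF basis f(1) \<T>] by (elim exE conjE)
  have mat: "mat T \<in> operator_matrices e \<T>"
    "T (f k) = (\<Sum>(l, c)\<leftarrow>ls. of_int c *s f l) \<Longrightarrow> mat T *v b k = (\<Sum>(l, c)\<leftarrow>ls. of_int c *s b l)"
    if "T \<in> \<T>" for T k ls
    using mat[rule_format, OF that] by simp_all
  show ?thesis
  proof (rule cubic_pair_of_weight_basis[where b = b and h = "mat h" and F = "\<lambda>s. mat (F s)" and E = "\<lambda>s. mat (E s)"
        and nus = nus and r = r and DL = DL and DU = DU, OF d card])
    show "b k \<noteq> 0" if "k < N" for k using b f(2) that by blast
    show "mat h \<in> operator_matrices e \<T>" using mat(1) h(1) .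
    show "mat h *v b k = of_int (nus ! k) *s b k" if "k < N" for k
      using mat(2)[OF h(1), of k "[(k, nus ! k)]"] h(2)[OF that] by simp
    show "mat (F s) \<in> operator_matrices e \<T>" if "s < r" for s using mat(1) F(1) that .
    show "mat (E s) \<in> operator_matrices e \<T>" if "s < r" for s using mat(1) E(1) that .
    show "mat (F s) *v b k = (\<Sum>(l, c)\<leftarrow>edge_terms DL s k. of_int c *s b l)" if "s < r" "k < N" for s k
      using mat(2)[OF F(1)[OF that(1)] F(2)[OF that]] .
    show "mat (E s) *v b k = (\<Sum>(l, c)\<leftarrow>edge_terms (reverse_edges DU) s k. of_int c *s b l)" if "s < r" "k < N" for s k
      using mat(2)[OF E(1)[OF that(1)] E(2)[OF that]] .
  qed (rule h(3,4) checks)+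
qed

section \<open>Symmetric tensors, tensors and bivectors\<close>

text \<open>The weights are the values of a traceless diagonal matrix, chosen such that they are distinct
  and that only the triples of basis vectors in the cubic table have weights of sum zero.\<close>

definition sym2_weights :: "int list" where
  "sym2_weights =
    [-8, -3, 2, -1, 4, 6]"

definition sym2_edges :: "edges" where
  "sym2_edges =
    [(0, 0, 1, 2), (0, 1, 2, 1), (0, 3, 4, 1), (1, 1, 3, 1), (1, 2, 4, 2), (1, 4, 5, 1)]"

text \<open>Three times the determinant of the symmetric matrix with diagonal
  \<open>2 * x 0\<close>, \<open>2 * x 2\<close>, \<open>2 * x 5\<close> and off-diagonal entries
  \<open>x 1\<close>, \<open>x 3\<close>, \<open>x 4\<close>; the diagonal is doubled because the
  basis vectors there are.\<close>

definition sym2_cubic :: "cubic_table" where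
  "sym2_cubic =
    [((0, 2, 5), 4), ((0, 4, 4), -2), ((1, 1, 5), -2), ((1, 3, 4), 1), ((2, 3, 3), -2)]"

text \<open>For instance, operator 0 maps vector 0 to twice vector 1 and vector 1 to vector 2, so
  its equation at \<open>(0, 1, 5)\<close> reads \<open>2 * t 1 1 5 + t 0 2 5 = 0\<close>.\<close>

definition sym2_certificate :: "(key \<times> nat \<times> key) list" where
  "sym2_certificate =
    [((1, 1, 5), 0, (0, 1, 5)), ((0, 4, 4), 1, (0, 2, 4)), ((1, 3, 4), 1, (1, 1, 4)), ((2, 3, 3), 1,
     (1, 2, 3))]"

definition sym2_dual_edges :: "edges" where
  "sym2_dual_edges =
    [(0, 0, 1, 1), (0, 1, 2, 2), (0, 3, 4, 1), (1, 1, 3, 1), (1, 2, 4, 1), (1, 4, 5, 2)]"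

text \<open>Six times the determinant of the symmetric matrix with entries \<open>x 0\<close>, ...,
  \<open>x 5\<close>: in the dual coordinates the diagonal is not doubled.\<close>

definition sym2_dual_cubic :: "cubic_table" where
  "sym2_dual_cubic =
    [((0, 2, 5), 1), ((0, 4, 4), -2), ((1, 1, 5), -2), ((1, 3, 4), 2), ((2, 3, 3), -2)]"

definition sym2_dual_certificate :: "(key \<times> nat \<times> key) list" where
  "sym2_dual_certificate =
    [((1, 1, 5), 0, (0, 1, 5)), ((0, 4, 4), 1, (0, 2, 4)), ((1, 3, 4), 1, (1, 1, 4)), ((2, 3, 3), 1,
     (1, 2, 3))]"

text \<open>The constant can be read off from diagonal matrices: component 0 of the left side is 2 *
  8 * 8 = 128 times \<open>x 0 * x 0 * x 2 * x 5\<close>, and the cubic form is 24 times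
  \<open>x 0 * x 2 * x 5\<close>.\<close>

lemma sym2_adjoint: "adjoint_identity {..<6} (cubic_of sym2_dual_cubic) (cubic_of sym2_cubic) (16/3)"
proof (rule adjoint_identity_of_gradient)
  show "keys_ok 6 sym2_dual_cubic" "keys_ok 6 sym2_cubic"
    by code_simp+
  fix x
  \<comment> \<open>As long as \<open>y\<close> and \<open>z\<close> are opaque, unfolding the outer
    gradient produces quadratic forms in \<open>y\<close> only; the polynomials in \<open>x\<close>
    are substituted afterwards.\<close>
  define y where "y = gradient sym2_cubic x"
  define z where "z = cubic_value sym2_cubic x"
  have "\<forall>a<6. gradient sym2_dual_cubic y a = 16/3 * z * x a"
    unfolding gradient_def[of _ y] sym2_dual_cubic_def
    apply (simp add: all_less_numeral del: One_nat_def)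
    unfolding y_def z_def gradient_def cubic_value_def sym2_cubic_def
    apply (simp del: One_nat_def)
    apply (intro conjI; algebra)
    done
  then show "\<forall>a<6. gradient sym2_dual_cubic (gradient sym2_cubic x) a = 16/3 * cubic_value sym2_cubic x * x a"
    unfolding y_def z_def .
qed

lemma sym2_dual_adjoint: "adjoint_identity {..<6} (cubic_of sym2_cubic) (cubic_of sym2_dual_cubic) (16/3)"
proof (rule adjoint_identity_of_gradient)
  show "keys_ok 6 sym2_cubic" "keys_ok 6 sym2_dual_cubic"
    by code_simp+
  fix x
  define y where "y = gradient sym2_dual_cubic x"
  define z where "z = cubic_value sym2_dual_cubic x"
  have "\<forall>a<6. gradient sym2_cubic y a = 16/3 * z * x a"
    unfolding gradient_def[of _ y] sym2_cubic_def
    apply (simp add: all_less_numeral del: One_nat_def)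
    unfolding y_def z_def gradient_def cubic_value_def sym2_dual_cubic_def
    apply (simp del: One_nat_def)
    apply (intro conjI; algebra)
    done
  then show "\<forall>a<6. gradient sym2_cubic (gradient sym2_dual_cubic x) a = 16/3 * cubic_value sym2_dual_cubic x * x a"
    unfolding y_def z_def .
qed

section \<open>Tensors: the determinant of a 3 by 3 matrix\<close>

definition bivector_weights :: "int list" where
  "bivector_weights =
    [-10, -12, 19, -11, -13, 18, -6, -8, 23]"

text \<open>Vector \<open>3 * i + j\<close> is the tensor of \<open>(i, j)\<close>; the operators 0,
  1 act on the first factor and 2, 3 on the second.\<close>

definition bivector_edges :: "edges" where
  "bivector_edges =
    [(0, 0, 3, 1), (0, 1, 4, 1), (0, 2, 5, 1), (1, 3, 6, 1), (1, 4, 7, 1), (1, 5, 8, 1), (2, 0, 1,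
     1), (2, 3, 4, 1), (2, 6, 7, 1), (3, 1, 2, 1), (3, 4, 5, 1), (3, 7, 8, 1)]"

definition bivector_cubic :: "cubic_table" where
  "bivector_cubic =
    [((0, 4, 8), 1), ((0, 5, 7), -1), ((1, 3, 8), -1), ((1, 5, 6), 1), ((2, 3, 7), 1), ((2, 4, 6),
     -1)]"

definition bivector_certificate :: "(key \<times> nat \<times> key) list" where
  "bivector_certificate =
    [((1, 3, 8), 0, (0, 1, 8)), ((0, 5, 7), 1, (0, 4, 5)), ((1, 5, 6), 1, (1, 3, 5)), ((2, 3, 7), 3,
     (1, 3, 7)), ((2, 4, 6), 3, (1, 4, 6))]"

text \<open>On a vector supported on one key with coefficient 1 or -1 and distinct indices, the left
  side acquires 2 * 2 * 2 = 8 and the cubic form 6, hence 4/3. The same count gives the constants of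
  the Pfaffian and of the e6 form.\<close>

lemma bivector_adjoint: "adjoint_identity {..<9} (cubic_of bivector_cubic) (cubic_of bivector_cubic) (4/3)"
proof (rule adjoint_identity_of_gradient)
  show "keys_ok 9 bivector_cubic" "keys_ok 9 bivector_cubic"
    by code_simp+
  fix x
  define y where "y = gradient bivector_cubic x"
  define z where "z = cubic_value bivector_cubic x"
  have "\<forall>a<9. gradient bivector_cubic y a = 4/3 * z * x a"
    unfolding gradient_def[of _ y] bivector_cubic_def
    apply (simp add: all_less_numeral del: One_nat_def)
    unfolding y_def z_def gradient_def cubic_value_def bivector_cubic_def
    apply (simp del: One_nat_def)
    apply (intro conjI; algebra)
    done
  then show "\<forall>a<9. gradient bivector_cubic (gradient bivector_cubic x) a = 4/3 * cubic_value bivector_cubic x * x a"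
    unfolding y_def z_def .
qed

section \<open>Bivectors: the Pfaffian of a 6 by 6 matrix\<close>

definition ext2_weights :: "int list" where
  "ext2_weights =
    [-23, -17, -9, -19, 24, -18, -10, -20, 23, -4, -14, 29, -6, 37, 27]"

definition ext2_edges :: "edges" where
  "ext2_edges =
    [(0, 1, 5, 1), (0, 2, 6, 1), (0, 3, 7, 1), (0, 4, 8, 1), (1, 0, 1, 1), (1, 6, 9, 1), (1, 7, 10,
     1), (1, 8, 11, 1), (2, 1, 2, 1), (2, 5, 6, 1), (2, 10, 12, 1), (2, 11, 13, 1), (3, 2, 3, 1),
     (3, 6, 7, 1), (3, 9, 10, 1), (3, 13, 14, 1), (4, 3, 4, 1), (4, 7, 8, 1), (4, 10, 11, 1), (4,
     12, 13, 1)]"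

text \<open>The keys are the fifteen perfect matchings of six points, one for each term of the
  Pfaffian.\<close>

definition ext2_cubic :: "cubic_table" where
  "ext2_cubic =
    [((0, 9, 14), 1), ((0, 10, 13), -1), ((0, 11, 12), 1), ((1, 6, 14), -1), ((1, 7, 13), 1), ((1,
     8, 12), -1), ((2, 5, 14), 1), ((2, 7, 11), -1), ((2, 8, 10), 1), ((3, 5, 13), -1), ((3, 6, 11),
     1), ((3, 8, 9), -1), ((4, 5, 12), 1), ((4, 6, 10), -1), ((4, 7, 9), 1)]"

definition ext2_certificate :: "(key \<times> nat \<times> key) list" where
  "ext2_certificate =
    [((1, 6, 14), 1, (0, 6, 14)), ((2, 5, 14), 2, (1, 5, 14)), ((0, 10, 13), 3, (0, 9, 13)), ((1, 7,
     13), 3, (1, 6, 13)), ((3, 5, 13), 3, (2, 5, 13)), ((0, 11, 12), 4, (0, 10, 12)), ((1, 8, 12),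
     4, (1, 7, 12)), ((4, 5, 12), 4, (3, 5, 12)), ((2, 7, 11), 2, (1, 7, 11)), ((2, 8, 10), 2, (1,
     8, 10)), ((3, 6, 11), 2, (3, 5, 11)), ((4, 6, 10), 2, (4, 5, 10)), ((3, 8, 9), 3, (2, 8, 9)),
     ((4, 7, 9), 3, (4, 6, 9))]"

lemma ext2_adjoint: "adjoint_identity {..<15} (cubic_of ext2_cubic) (cubic_of ext2_cubic) (4/3)"
proof (rule adjoint_identity_of_gradient)
  show "keys_ok 15 ext2_cubic" "keys_ok 15 ext2_cubic"
    by code_simp+
  fix x
  define y where "y = gradient ext2_cubic x"
  define z where "z = cubic_value ext2_cubic x"
  have "\<forall>a<15. gradient ext2_cubic y a = 4/3 * z * x a"
    unfolding gradient_def[of _ y] ext2_cubic_def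
    apply (simp add: all_less_numeral del: One_nat_def)
    unfolding y_def z_def gradient_def cubic_value_def ext2_cubic_def
    apply (simp del: One_nat_def)
    apply (intro conjI; algebra)
    done
  then show "\<forall>a<15. gradient ext2_cubic (gradient ext2_cubic x) a = 4/3 * cubic_value ext2_cubic x * x a"
    unfolding y_def z_def .
qed


section \<open>The cubic pairs of the three classical cases\<close>

lemma enumeration_of_type:
  assumes "CARD('k) = N"
  obtains \<iota> :: "nat \<Rightarrow> 'k::finite" where "\<And>i j. i < N \<Longrightarrow> j < N \<Longrightarrow> \<iota> i = \<iota> j \<longleftrightarrow> i = j"
    and "\<And>ds :: int list. length ds = N \<Longrightarrow> sum_list ds = 0 \<Longrightarrow>
      \<exists>d :: 'k \<Rightarrow> complex. diagonal_matrix d \<in> sl \<and> (\<forall>i<N. d (\<iota> i) = of_int (ds ! i))"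
proof -
  obtain \<iota> :: "nat \<Rightarrow> 'k" where \<iota>: "bij_betw \<iota> {0..<N} UNIV"
    using ex_bij_betw_nat_finite[of "UNIV :: 'k set"] assms by auto
  show ?thesis
  proof
    show "\<iota> i = \<iota> j \<longleftrightarrow> i = j" if "i < N" "j < N" for i j
      using \<iota> that by (auto simp: bij_betw_def inj_on_def)
  next
    fix ds :: "int list" assume ds: "length ds = N" "sum_list ds = 0"
    define d where "d x = (of_int (ds ! inv_into {0..<N} \<iota> x) :: complex)" for x
    have d: "d (\<iota> i) = of_int (ds ! i)" if "i < N" for i
      using \<iota> that by (simp add: d_def bij_betw_def)
    have "(\<Sum>x\<in>UNIV. d x) = (\<Sum>i = 0..<N. d (\<iota> i))"
      using sum.reindex_bij_betw[OF \<iota>, of d] by simp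
    also have "\<dots> = of_int (\<Sum>i = 0..<N. ds ! i)"
      by (simp add: d)
    also have "\<dots> = 0"
      using ds by (simp add: sum_list_sum_nth)
    finally have "diagonal_matrix d \<in> sl" by (rule diagonal_matrix_in_sl)
    then show "\<exists>d :: 'k \<Rightarrow> complex. diagonal_matrix d \<in> sl \<and> (\<forall>i<N. d (\<iota> i) = of_int (ds ! i))"
      using d by blast
  qed
qed

lemma cubic_pair_sym2:
  fixes dU dL :: "'n::finite cubic" and e :: "'n \<Rightarrow> complex^(3 \<times> 3)"
  assumes d: "d_tensors (operator_matrices e {tensor_act X X | X. X \<in> sl}) dU dL"
    and basis: "is_basis e sym2" and card: "CARD('n) = 3 * 1 + 3"
  shows "cubic_pair (tensor dU) (tensor dL) (1 / (of_nat 1 + 2))"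
proof -
  obtain \<iota> :: "nat \<Rightarrow> 3" where \<iota>: "\<And>i j. i < 3 \<Longrightarrow> j < 3 \<Longrightarrow> \<iota> i = \<iota> j \<longleftrightarrow> i = j"
    and diag: "\<And>ds :: int list. length ds = 3 \<Longrightarrow> sum_list ds = 0 \<Longrightarrow>
      \<exists>d :: 3 \<Rightarrow> complex. diagonal_matrix d \<in> sl \<and> (\<forall>i<3. d (\<iota> i) = of_int (ds ! i))"
    using enumeration_of_type[where 'k = 3 and N = 3] by auto
  obtain \<delta> :: "3 \<Rightarrow> complex" where \<delta>: "diagonal_matrix \<delta> \<in> sl" "\<forall>i<3. \<delta> (\<iota> i) = of_int ([-4, 1, 3] ! i)"
    using diag[of "[-4, 1, 3]"] by auto
  define v where "v i j = pair_tensor 1 (\<iota> i) (\<iota> j)" for i j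
  define f where "f k = (case [(0, 0), (0, 1), (1, 1), (0, 2), (1, 2), (2, 2)] ! k of (i, j) \<Rightarrow> v i j)" for k :: nat
  let ?A = "\<lambda>X :: complex^3^3. tensor_act X X"
  let ?F = "\<lambda>s. ?A (unit_matrix (\<iota> (s + 1)) (\<iota> s))" and ?E = "\<lambda>s. ?A (unit_matrix (\<iota> s) (\<iota> (s + 1)))"
  have act: "?A (unit_matrix (\<iota> p) (\<iota> q)) (v i j) = (if i = q then v p j else 0) + (if j = q then v i p else 0)"
    if "i < 3" "j < 3" "q < 3" for p q i j
    using \<iota> that by (simp add: v_def tensor_act_pair_tensor)
  \<comment> \<open>Simplification collects \<open>v + v\<close> as a componentwise product with the
    numeral 2, which has to be read as a scalar multiple.\<close>
  have two: "2 * x = 2 *s x" for x :: "complex^(3 \<times> 3)"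
    by (simp add: vec_eq_iff)
  have v_swap: "v j i = v i j" for i j
    by (simp add: v_def pair_tensor_swap)
  show ?thesis
  proof (rule cubic_pair_of_operators[where f = f and h = "?A (diagonal_matrix \<delta>)" and F = ?F and E = ?E and N = 6
        and W = sym2 and r = 2 and nus = sym2_weights and DL = sym2_edges and DU = sym2_dual_edges
        and certL = sym2_certificate and certU = sym2_dual_certificate
        and \<mu> = "16/3" and \<mu>' = "16/3" and ?k0.0 = "(0, 2, 5)" and ?k1.0 = "(0, 2, 5)", OF d basis])
    show "f k \<in> sym2" for k
      by (simp add: f_def v_def pair_tensor_in split: prod.split)
    show "f k \<noteq> 0" for k
      by (simp add: f_def v_def pair_tensor_nonzero split: prod.split)
    show "\<forall>T\<in>{tensor_act X X |X. X \<in> sl}.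
       (\<forall>x y. T (x + y) = T x + T y) \<and> (\<forall>c x. T (c *s x) = c *s T x) \<and> (\<forall>w\<in>sym2. T w \<in> sym2)"
      by (auto simp: tensor_act_add tensor_act_scale tensor_act_sym2)
    show "?A (diagonal_matrix \<delta>) \<in> {tensor_act X X |X. X \<in> sl}"
      using \<delta>(1) by blast
    have "\<forall>k<6. ?A (diagonal_matrix \<delta>) (f k) = of_int (sym2_weights ! k) *s f k"
      using \<delta>(2) unfolding all_less_numeral
      by (simp add: all_less_numeral f_def v_def tensor_act_pair_tensor sym2_weights_def del: One_nat_def)
    then show "?A (diagonal_matrix \<delta>) (f k) = of_int (sym2_weights ! k) *s f k" if "k < 6" for k
      using that by blast
    show "?F s \<in> {tensor_act X X |X. X \<in> sl}" "?E s \<in> {tensor_act X X |X. X \<in> sl}" if "s < 2" for s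
      using unit_matrix_in_sl[of "\<iota> (s + 1)" "\<iota> s"] unit_matrix_in_sl[of "\<iota> s" "\<iota> (s + 1)"] \<iota>[of s "s + 1"] that by auto
    have "\<forall>s<2. \<forall>k<6. ?F s (f k) = (\<Sum>(l, c)\<leftarrow>edge_terms sym2_edges s k. of_int c *s f l)"
      by (simp add: all_less_numeral f_def act edge_terms_def sym2_edges_def v_swap two del: One_nat_def)
    then show "?F s (f k) = (\<Sum>(l, c)\<leftarrow>edge_terms sym2_edges s k. of_int c *s f l)" if "s < 2" "k < 6" for s k
      using that by blast
    have "\<forall>s<2. \<forall>k<6. ?E s (f k) = (\<Sum>(l, c)\<leftarrow>edge_terms (reverse_edges sym2_dual_edges) s k. of_int c *s f l)"
      by (simp add: all_less_numeral f_def act edge_terms_def reverse_edges_def sym2_dual_edges_def v_swap two del: One_nat_def)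
    then show "?E s (f k) = (\<Sum>(l, c)\<leftarrow>edge_terms (reverse_edges sym2_dual_edges) s k. of_int c *s f l)" if "s < 2" "k < 6" for s k
      using that by blast
    show "adjoint_identity {..<6} (cubic_of sym2_dual_cubic) (cubic_of sym2_cubic) (16 / 3)"
      "adjoint_identity {..<6} (cubic_of sym2_cubic) (cubic_of sym2_dual_cubic) (16 / 3)"
      by (rule sym2_adjoint sym2_dual_adjoint)+
    show "length sym2_weights = 6" "distinct sym2_weights" "list_all (\<lambda>(s, k, l, c). k < 6 \<and> l < 6) sym2_dual_edges"
      "covers sym2_weights sym2_cubic" "covers sym2_weights sym2_dual_cubic"
      "determines 6 2 sym2_edges sym2_cubic [(0, 2, 5)] sym2_certificate" "cubic_coeff sym2_cubic (0, 2, 5) \<noteq> 0"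
      "determines 6 2 sym2_dual_edges sym2_dual_cubic [(0, 2, 5)] sym2_dual_certificate" "cubic_coeff sym2_dual_cubic (0, 2, 5) \<noteq> 0"
      by code_simp+
  qed (use card in auto)
qed

lemma cubic_pair_bivector:
  fixes dU dL :: "'n::finite cubic" and e :: "'n \<Rightarrow> complex^(3 \<times> 3)"
  assumes d: "d_tensors (operator_matrices e {tensor_act X Y | X Y. X \<in> sl \<and> Y \<in> sl}) dU dL"
    and basis: "is_basis e UNIV" and card: "CARD('n) = 3 * 2 + 3"
  shows "cubic_pair (tensor dU) (tensor dL) (1 / (of_nat 2 + 2))"
proof -
  obtain \<iota> :: "nat \<Rightarrow> 3" where \<iota>: "\<And>i j. i < 3 \<Longrightarrow> j < 3 \<Longrightarrow> \<iota> i = \<iota> j \<longleftrightarrow> i = j"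
    and diag: "\<And>ds :: int list. length ds = 3 \<Longrightarrow> sum_list ds = 0 \<Longrightarrow>
      \<exists>d :: 3 \<Rightarrow> complex. diagonal_matrix d \<in> sl \<and> (\<forall>i<3. d (\<iota> i) = of_int (ds ! i))"
    using enumeration_of_type[where 'k = 3 and N = 3] by auto
  obtain \<delta> :: "3 \<Rightarrow> complex" where \<delta>: "diagonal_matrix \<delta> \<in> sl" "\<forall>i<3. \<delta> (\<iota> i) = of_int ([-1, -2, 3] ! i)"
    using diag[of "[-1, -2, 3]"] by auto
  obtain \<epsilon> :: "3 \<Rightarrow> complex" where \<epsilon>: "diagonal_matrix \<epsilon> \<in> sl" "\<forall>i<3. \<epsilon> (\<iota> i) = of_int ([-9, -11, 20] ! i)"
    using diag[of "[-9, -11, 20]"] by auto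
  define v where "v i j = unit_tensor (\<iota> i) (\<iota> j)" for i j
  define f where "f k = (case [(0, 0), (0, 1), (0, 2), (1, 0), (1, 1), (1, 2), (2, 0), (2, 1), (2, 2)] ! k of (i, j) \<Rightarrow> v i j)" for k :: nat
  let ?D = "tensor_act (diagonal_matrix \<delta>) (diagonal_matrix \<epsilon>)"
  define F where "F s = (if s < 2 then tensor_act (unit_matrix (\<iota> (s + 1)) (\<iota> s)) 0
    else tensor_act 0 (unit_matrix (\<iota> (s - 1)) (\<iota> (s - 2))))" for s
  define E where "E s = (if s < 2 then tensor_act (unit_matrix (\<iota> s) (\<iota> (s + 1))) 0
    else tensor_act 0 (unit_matrix (\<iota> (s - 2)) (\<iota> (s - 1))))" for s
  have act: "tensor_act (unit_matrix (\<iota> p) (\<iota> q)) 0 (v i j) = (if i = q then v p j else 0)"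
    "tensor_act 0 (unit_matrix (\<iota> p) (\<iota> q)) (v i j) = (if j = q then v i p else 0)"
    if "i < 3" "j < 3" "q < 3" for p q i j
    using \<iota> that by (simp_all add: v_def tensor_act_unit_matrix)
  have checks: "length bivector_weights = 9" "distinct bivector_weights" "list_all (\<lambda>(s, k, l, c). k < 9 \<and> l < 9) bivector_edges"
      "covers bivector_weights bivector_cubic"
      "determines 9 4 bivector_edges bivector_cubic [(0, 4, 8)] bivector_certificate" "cubic_coeff bivector_cubic (0, 4, 8) \<noteq> 0"
      by code_simp+
  show ?thesis
  proof (rule cubic_pair_of_operators[where f = f and h = ?D and F = F and E = E and N = 9
        and W = UNIV and r = 4 and nus = bivector_weights and DL = bivector_edges and DU = bivector_edges
        and certL = bivector_certificate and certU = bivector_certificate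
        and \<mu> = "4/3" and \<mu>' = "4/3" and ?k0.0 = "(0, 4, 8)" and ?k1.0 = "(0, 4, 8)", OF d basis])
    show "f k \<noteq> 0" for k
      by (auto simp: f_def v_def unit_tensor_def axis_eq_0_iff split: prod.split)
    show "\<forall>T\<in>{tensor_act X Y | X Y. X \<in> sl \<and> Y \<in> sl}.
       (\<forall>x y. T (x + y) = T x + T y) \<and> (\<forall>c x. T (c *s x) = c *s T x) \<and> (\<forall>w\<in>UNIV. T w \<in> UNIV)"
      by (auto simp: tensor_act_add tensor_act_scale)
    show "?D \<in> {tensor_act X Y | X Y. X \<in> sl \<and> Y \<in> sl}"
      using \<delta>(1) \<epsilon>(1) by blast
    have "\<forall>k<9. ?D (f k) = of_int (bivector_weights ! k) *s f k"
      using \<delta>(2) \<epsilon>(2) unfolding all_less_numeral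
      by (simp add: all_less_numeral f_def v_def tensor_act_diagonal_matrix bivector_weights_def del: One_nat_def)
    then show "?D (f k) = of_int (bivector_weights ! k) *s f k" if "k < 9" for k
      using that by blast
    have mem: "tensor_act X Y \<in> {tensor_act X Y | X Y. X \<in> sl \<and> Y \<in> sl}" if "X \<in> sl" "Y \<in> sl" for X Y :: "complex^3^3"
      using that by blast
    have unit: "unit_matrix (\<iota> p) (\<iota> q) \<in> sl" if "p < 3" "q < 3" "p \<noteq> q" for p q
      using that \<iota> by (intro unit_matrix_in_sl) simp
    have "\<forall>s<4. F s \<in> {tensor_act X Y | X Y. X \<in> sl \<and> Y \<in> sl} \<and> E s \<in> {tensor_act X Y | X Y. X \<in> sl \<and> Y \<in> sl}"
      unfolding all_less_numeral F_def E_def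
      by (simp del: mem_Collect_eq add: all_less_numeral mem unit zero_in_sl)
    then show "F s \<in> {tensor_act X Y | X Y. X \<in> sl \<and> Y \<in> sl}" "E s \<in> {tensor_act X Y | X Y. X \<in> sl \<and> Y \<in> sl}" if "s < 4" for s
      using that by blast+
    have "\<forall>s<4. \<forall>k<9. F s (f k) = (\<Sum>(l, c)\<leftarrow>edge_terms bivector_edges s k. of_int c *s f l)"
      by (simp add: all_less_numeral f_def act edge_terms_def bivector_edges_def F_def E_def numeral_2_eq_2[symmetric])
    then show "F s (f k) = (\<Sum>(l, c)\<leftarrow>edge_terms bivector_edges s k. of_int c *s f l)" if "s < 4" "k < 9" for s k
      using that by blast
    have "\<forall>s<4. \<forall>k<9. E s (f k) = (\<Sum>(l, c)\<leftarrow>edge_terms (reverse_edges bivector_edges) s k. of_int c *s f l)"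
      by (simp add: all_less_numeral f_def act edge_terms_def reverse_edges_def bivector_edges_def F_def E_def numeral_2_eq_2[symmetric])
    then show "E s (f k) = (\<Sum>(l, c)\<leftarrow>edge_terms (reverse_edges bivector_edges) s k. of_int c *s f l)" if "s < 4" "k < 9" for s k
      using that by blast
    show "adjoint_identity {..<9} (cubic_of bivector_cubic) (cubic_of bivector_cubic) (4 / 3)"
      "adjoint_identity {..<9} (cubic_of bivector_cubic) (cubic_of bivector_cubic) (4 / 3)"
      by (rule bivector_adjoint)+
  qed (rule checks | simp add: card)+
qed

lemma cubic_pair_ext2:
  fixes dU dL :: "'n::finite cubic" and e :: "'n \<Rightarrow> complex^(6 \<times> 6)"
  assumes d: "d_tensors (operator_matrices e {tensor_act X X | X. X \<in> sl}) dU dL"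
    and basis: "is_basis e ext2" and card: "CARD('n) = 3 * 4 + 3"
  shows "cubic_pair (tensor dU) (tensor dL) (1 / (of_nat 4 + 2))"
proof -
  obtain \<iota> :: "nat \<Rightarrow> 6" where \<iota>: "\<And>i j. i < 6 \<Longrightarrow> j < 6 \<Longrightarrow> \<iota> i = \<iota> j \<longleftrightarrow> i = j"
    and diag: "\<And>ds :: int list. length ds = 6 \<Longrightarrow> sum_list ds = 0 \<Longrightarrow>
      \<exists>d :: 6 \<Rightarrow> complex. diagonal_matrix d \<in> sl \<and> (\<forall>i<6. d (\<iota> i) = of_int (ds ! i))"
    using enumeration_of_type[where 'k = 6 and N = 6] by auto
  obtain \<delta> :: "6 \<Rightarrow> complex" where \<delta>: "diagonal_matrix \<delta> \<in> sl" "\<forall>i<6. \<delta> (\<iota> i) = of_int ([-11, -12, -6, 2, -8, 35] ! i)"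
    using diag[of "[-11, -12, -6, 2, -8, 35]"] by auto
  define v where "v i j = pair_tensor (-1) (\<iota> i) (\<iota> j)" for i j
  define f where "f k = (case [(0, 1), (0, 2), (0, 3), (0, 4), (0, 5), (1, 2), (1, 3), (1, 4), (1, 5), (2, 3), (2, 4), (2, 5), (3, 4), (3, 5), (4, 5)] ! k of (i, j) \<Rightarrow> v i j)" for k :: nat
  let ?A = "\<lambda>X :: complex^6^6. tensor_act X X"
  let ?F = "\<lambda>s. ?A (unit_matrix (\<iota> (s + 1)) (\<iota> s))" and ?E = "\<lambda>s. ?A (unit_matrix (\<iota> s) (\<iota> (s + 1)))"
  have act: "?A (unit_matrix (\<iota> p) (\<iota> q)) (v i j) = (if i = q then v p j else 0) + (if j = q then v i p else 0)"
    if "i < 6" "j < 6" "q < 6" for p q i j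
    using \<iota> that by (simp add: v_def tensor_act_pair_tensor)
  have v_same: "v i i = 0" for i
    by (simp add: v_def pair_tensor_same)
  have checks: "length ext2_weights = 15" "distinct ext2_weights" "list_all (\<lambda>(s, k, l, c). k < 15 \<and> l < 15) ext2_edges"
      "covers ext2_weights ext2_cubic"
      "determines 15 5 ext2_edges ext2_cubic [(0, 9, 14)] ext2_certificate" "cubic_coeff ext2_cubic (0, 9, 14) \<noteq> 0"
      by code_simp+
  show ?thesis
  proof (rule cubic_pair_of_operators[where f = f and h = "?A (diagonal_matrix \<delta>)" and F = ?F and E = ?E and N = 15
        and W = ext2 and r = 5 and nus = ext2_weights and DL = ext2_edges and DU = ext2_edges
        and certL = ext2_certificate and certU = ext2_certificate
        and \<mu> = "4/3" and \<mu>' = "4/3" and ?k0.0 = "(0, 9, 14)" and ?k1.0 = "(0, 9, 14)", OF d basis])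
    show "f k \<in> ext2" for k
      by (simp add: f_def v_def pair_tensor_in split: prod.split)
    have "\<forall>k<15. f k \<noteq> 0"
      using \<iota> by (simp add: all_less_numeral f_def v_def pair_tensor_nonzero del: One_nat_def)
    then show "f k \<noteq> 0" if "k < 15" for k
      using that by blast
    show "\<forall>T\<in>{tensor_act X X |X. X \<in> sl}.
       (\<forall>x y. T (x + y) = T x + T y) \<and> (\<forall>c x. T (c *s x) = c *s T x) \<and> (\<forall>w\<in>ext2. T w \<in> ext2)"
      by (auto simp: tensor_act_add tensor_act_scale tensor_act_ext2)
    show "?A (diagonal_matrix \<delta>) \<in> {tensor_act X X |X. X \<in> sl}"
      using \<delta>(1) by blast
    have "\<forall>k<15. ?A (diagonal_matrix \<delta>) (f k) = of_int (ext2_weights ! k) *s f k"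
      using \<delta>(2) unfolding all_less_numeral
      by (simp add: all_less_numeral f_def v_def tensor_act_pair_tensor ext2_weights_def del: One_nat_def)
    then show "?A (diagonal_matrix \<delta>) (f k) = of_int (ext2_weights ! k) *s f k" if "k < 15" for k
      using that by blast
    show "?F s \<in> {tensor_act X X |X. X \<in> sl}" "?E s \<in> {tensor_act X X |X. X \<in> sl}" if "s < 5" for s
      using unit_matrix_in_sl[of "\<iota> (s + 1)" "\<iota> s"] unit_matrix_in_sl[of "\<iota> s" "\<iota> (s + 1)"] \<iota>[of s "s + 1"] that by auto
    have "\<forall>s<5. \<forall>k<15. ?F s (f k) = (\<Sum>(l, c)\<leftarrow>edge_terms ext2_edges s k. of_int c *s f l)"
      by (simp add: all_less_numeral f_def act edge_terms_def ext2_edges_def v_same del: One_nat_def)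
    then show "?F s (f k) = (\<Sum>(l, c)\<leftarrow>edge_terms ext2_edges s k. of_int c *s f l)" if "s < 5" "k < 15" for s k
      using that by blast
    have "\<forall>s<5. \<forall>k<15. ?E s (f k) = (\<Sum>(l, c)\<leftarrow>edge_terms (reverse_edges ext2_edges) s k. of_int c *s f l)"
      by (simp add: all_less_numeral f_def act edge_terms_def reverse_edges_def ext2_edges_def v_same del: One_nat_def)
    then show "?E s (f k) = (\<Sum>(l, c)\<leftarrow>edge_terms (reverse_edges ext2_edges) s k. of_int c *s f l)" if "s < 5" "k < 15" for s k
      using that by blast
    show "adjoint_identity {..<15} (cubic_of ext2_cubic) (cubic_of ext2_cubic) (4 / 3)"
      "adjoint_identity {..<15} (cubic_of ext2_cubic) (cubic_of ext2_cubic) (4 / 3)"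
      by (rule ext2_adjoint)+
  qed (rule checks | simp add: card)+
qed

section \<open>Eigenvectors and highest weights\<close>

definition poly_action :: "complex^'n^'n \<Rightarrow> complex^'n \<Rightarrow> complex poly \<Rightarrow> complex^'n::finite"
  where "poly_action A x p = (\<Sum>i\<le>degree p. coeff p i *s ((*v) A ^^ i) x)"

lemma poly_action_eq_sum:
  assumes "degree p \<le> N"
  shows "poly_action A x p = (\<Sum>i\<le>N. coeff p i *s ((*v) A ^^ i) x)"
  unfolding poly_action_def using assms by (intro sum.mono_neutral_left) (auto simp: coeff_eq_0)

lemma poly_action_add: "poly_action A x (p + q) = poly_action A x p + poly_action A x q"
proof -
  let ?N = "max (degree p) (degree q)"
  have "degree (p + q) \<le> ?N" by (rule degree_add_le_max)
  then show ?thesis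
    by (simp add: poly_action_eq_sum[of _ ?N] vec.scale_left_distrib sum.distrib)
qed

lemma poly_action_smult: "poly_action A x (smult c p) = c *s poly_action A x p"
  using degree_smult_le[of c p]
  by (simp add: poly_action_eq_sum[of _ "degree p"] vec.scale_sum_right)

lemma poly_action_shift: "poly_action A x (pCons 0 p) = A *v poly_action A x p"
proof -
  have "poly_action A x (pCons 0 p) = (\<Sum>i\<le>Suc (degree p). coeff (pCons 0 p) i *s ((*v) A ^^ i) x)"
    by (rule poly_action_eq_sum) (simp add: degree_pCons_le)
  also have "\<dots> = (\<Sum>i\<le>degree p. coeff p i *s (A *v (((*v) A ^^ i) x)))"
    by (subst sum.atMost_Suc_shift) simp
  also have "\<dots> = A *v poly_action A x p"
    by (simp add: poly_action_def vec.linear_sum[OF matrix_vector_mul_linear_gen] vec.scale)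
  finally show ?thesis .
qed

lemma poly_action_linear_factor:
  "poly_action A x ([:- z, 1:] * p) = A *v poly_action A x p - z *s poly_action A x p"
proof -
  have "[:- z, 1:] * p = smult (- z) p + pCons 0 p"
    by (simp add: mult_pCons_left)
  then show ?thesis
    by (simp only: poly_action_add poly_action_smult poly_action_shift) (simp add: vec_eq_iff)
qed

lemma poly_action_in:
  assumes "vec.subspace U" "x \<in> U" "\<And>y. y \<in> U \<Longrightarrow> A *v y \<in> U"
  shows "poly_action A x p \<in> U"
proof -
  have "((*v) A ^^ i) x \<in> U" for i
    by (induction i) (use assms in auto)
  then show ?thesis
    unfolding poly_action_def using assms(1) by (intro vec.subspace_sum vec.subspace_scale) auto
qed

text \<open>One iterate more than the dimension makes the iterates dependent. Two equal iterates are
  a separate case, because linear dependence is a property of their set.\<close>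

lemma annihilating_poly_exists:
  fixes x :: "complex^'n::finite"
  shows "\<exists>p. p \<noteq> 0 \<and> poly_action A x p = 0"
proof (cases "inj_on (\<lambda>i. ((*v) A ^^ i) x) {..CARD('n)}")
  case False
  then obtain i j where ij: "i \<noteq> j" "((*v) A ^^ i) x = ((*v) A ^^ j) x"
    by (auto simp: inj_on_def)
  have act: "poly_action A x (monom 1 i) = ((*v) A ^^ i) x" for i
  proof -
    have "poly_action A x (monom 1 i) = (\<Sum>k\<le>i. if k = i then ((*v) A ^^ k) x else 0)"
      unfolding poly_action_def by (rule sum.cong) (auto simp: degree_monom_eq)
    then show ?thesis by simp
  qed
  have "coeff (monom 1 i + smult (-1) (monom 1 j) :: complex poly) i \<noteq> 0"
    using ij(1) by simp
  then have "monom 1 i + smult (-1) (monom 1 j) \<noteq> (0 :: complex poly)" by (metis coeff_0)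
  then show ?thesis
    using ij by (intro exI[of _ "monom 1 i + smult (-1) (monom 1 j)"]) (simp only: poly_action_add poly_action_smult act, simp)
next
  case True
  let ?v = "\<lambda>i. ((*v) A ^^ i) x"
  have "vec.dependent (?v ` {..CARD('n)})"
  proof (rule ccontr)
    assume "\<not> ?thesis"
    then have "card (?v ` {..CARD('n)}) \<le> vec.dim (UNIV :: (complex^'n) set)"
      by (intro vec.independent_card_le_dim) auto
    then show False
      using True by (simp add: card_image vec.dim_UNIV card_cart_basis)
  qed
  then obtain u v where u: "v \<in> ?v ` {..CARD('n)}" "u v \<noteq> 0" "(\<Sum>w\<in>?v ` {..CARD('n)}. u w *s w) = 0"
    by (subst (asm) vec.dependent_finite) auto
  define p where "p = (\<Sum>i\<le>CARD('n). monom (u (?v i)) i)"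
  have c: "coeff p i = (if i \<le> CARD('n) then u (?v i) else 0)" for i
    by (simp add: p_def coeff_sum)
  have "degree p \<le> CARD('n)"
    by (rule degree_le) (simp add: c)
  then have "poly_action A x p = (\<Sum>i\<le>CARD('n). u (?v i) *s ?v i)"
    by (simp add: poly_action_eq_sum c)
  also have "\<dots> = 0"
    using u(3) by (simp add: sum.reindex[OF True])
  finally have "poly_action A x p = 0" .
  moreover obtain i where "i \<le> CARD('n)" "v = ?v i"
    using u(1) by auto
  then have "coeff p i \<noteq> 0"
    using u(2) by (simp add: c)
  then have "p \<noteq> 0" by auto
  ultimately show ?thesis by blast
qed

text \<open>An annihilating polynomial of least degree has a root \<open>z\<close>; by minimality
  the cofactor applied to \<open>x\<close> is nonzero, and it lies in the eigenspace of
  \<open>z\<close>.\<close>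

lemma eigenvector_in_invariant_subspace:
  fixes A :: "complex^'n::finite^'n"
  assumes U: "vec.subspace U" "x \<in> U" "x \<noteq> 0" "\<And>y. y \<in> U \<Longrightarrow> A *v y \<in> U"
  obtains y z where "y \<in> U" "y \<noteq> 0" "A *v y = z *s y"
proof -
  obtain p0 where "p0 \<noteq> 0 \<and> poly_action A x p0 = 0"
    using annihilating_poly_exists[of A x] by blast
  note arg_min = arg_min_nat_lemma[of "\<lambda>p. p \<noteq> 0 \<and> poly_action A x p = 0" p0 degree, OF this]
  obtain p where p: "p \<noteq> 0" "poly_action A x p = 0"
    and min: "\<And>q. q \<noteq> 0 \<Longrightarrow> poly_action A x q = 0 \<Longrightarrow> degree p \<le> degree q"
    using arg_min by blast
  have "degree p \<noteq> 0"
  proof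
    assume "degree p = 0"
    then obtain c where "p = [:c:]" by (rule degree_eq_zeroE)
    then show False using p U(3) by (simp add: poly_action_def vec.scale_eq_0_iff)
  qed
  then obtain z where "poly p z = 0"
    using fundamental_theorem_of_algebra[of p] unfolding constant_degree by blast
  then obtain q where q: "p = [:- z, 1:] * q"
    unfolding poly_eq_0_iff_dvd by (rule dvdE)
  have "q \<noteq> 0" using p(1) q by auto
  then have "degree p = Suc (degree q)"
    unfolding q by (subst degree_mult_eq) auto
  then have "poly_action A x q \<noteq> 0"
    using min[OF \<open>q \<noteq> 0\<close>] by auto
  moreover have "A *v poly_action A x q = z *s poly_action A x q"
    using p(2) unfolding q poly_action_linear_factor by simp
  moreover have "poly_action A x q \<in> U"
    using poly_action_in U by blast
  ultimately show thesis using that by blast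
qed

text \<open>An eigenspace of one operator within \<open>U\<close> is preserved by the operators
  commuting with it, so the induction continues inside it.\<close>

lemma common_eigenvector:
  fixes As :: "(complex^'n::finite^'n) list"
  assumes "vec.subspace U" "U \<noteq> {0}" "\<forall>A\<in>set As. \<forall>y\<in>U. A *v y \<in> U"
    and "\<forall>A\<in>set As. \<forall>B\<in>set As. A ** B = B ** A"
  shows "\<exists>y\<in>U. y \<noteq> 0 \<and> (\<forall>A\<in>set As. \<exists>z. A *v y = z *s y)"
  using assms
proof (induction As arbitrary: U)
  case Nil
  then show ?case using vec.subspace_0[of U] by auto
next
  case (Cons A As)
  obtain x where x: "x \<in> U" "x \<noteq> 0"
    using Cons.prems(1,2) vec.subspace_0[of U] by auto
  have "A *v y \<in> U" if "y \<in> U" for y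
    using Cons.prems(3) that by simp
  from eigenvector_in_invariant_subspace[OF Cons.prems(1) x this]
  obtain y z where y: "y \<in> U" "y \<noteq> 0" "A *v y = z *s y" .
  define V where "V = {w \<in> U. A *v w = z *s w}"
  have "vec.subspace V"
    unfolding vec.subspace_def
  proof (intro conjI ballI allI)
    show "0 \<in> V"
      using vec.subspace_0[OF Cons.prems(1)] by (simp add: V_def)
    show "v + w \<in> V" if "v \<in> V" "w \<in> V" for v w
      using that vec.subspace_add[OF Cons.prems(1), of v w]
      by (simp add: V_def matrix_vector_right_distrib vec.scale_right_distrib)
    show "c *s w \<in> V" if "w \<in> V" for c w
      using that vec.subspace_scale[OF Cons.prems(1), of w c]
      by (simp add: V_def vec.scale mult.commute)
  qed
  moreover have "V \<noteq> {0}" using y unfolding V_def by blast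
  moreover have "\<forall>B\<in>set As. \<forall>w\<in>V. B *v w \<in> V"
  proof (intro ballI)
    fix B w assume B: "B \<in> set As" and w: "w \<in> V"
    have "A ** B = B ** A"
      using Cons.prems(4) B by (meson list.set_intros)
    then have "A *v (B *v w) = B *v (A *v w)"
      by (simp add: matrix_vector_mul_assoc)
    also have "\<dots> = z *s (B *v w)"
      using w by (simp add: V_def vec.scale)
    finally show "B *v w \<in> V"
      using Cons.prems(3) B w unfolding V_def by (metis (mono_tags, lifting) list.set_intros(2) mem_Collect_eq)
  qed
  moreover have "\<forall>A\<in>set As. \<forall>B\<in>set As. A ** B = B ** A"
    using Cons.prems(4) by (meson list.set_intros)
  ultimately obtain w where w: "w \<in> V" "w \<noteq> 0" "\<forall>A\<in>set As. \<exists>z. A *v w = z *s w"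
    using Cons.IH[of V] by blast
  then show ?case
    unfolding V_def by (intro bexI[of _ w]) (simp, blast+)
qed

text \<open>The highest weight of a finite-dimensional representation of \<open>sl\<^sub>2\<close> is a natural number,
  since otherwise the lowering operator would produce infinitely many eigenvalues.\<close>

lemma sl2_highest_weight:
  fixes e f h :: "complex^'n::finite^'n"
  assumes ef: "\<And>x. e *v (f *v x) = f *v (e *v x) + h *v x"
    and hf: "\<And>x. h *v (f *v x) = f *v (h *v x) - 2 *s (f *v x)"
    and x: "x \<noteq> 0" "e *v x = 0" "h *v x = \<mu> *s x"
  shows "\<exists>n. \<mu> = of_nat n"
proof -
  define y where "y k = ((*v) f ^^ k) x" for k
  have y: "y 0 = x" "y (Suc k) = f *v y k" for k by (simp_all add: y_def)
  have hy: "h *v y k = (\<mu> - 2 * of_nat k) *s y k" for k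
  proof (induction k)
    case (Suc k)
    show ?case
      unfolding y(2) hf Suc vec.scale by (simp add: vec_eq_iff algebra_simps)
  qed (simp add: y x)
  have ey: "e *v y (Suc k) = (of_nat (Suc k) * (\<mu> - of_nat k)) *s y k" for k
  proof (induction k)
    case 0
    then show ?case using x by (simp add: y ef)
  next
    case (Suc k)
    have "e *v y (Suc (Suc k)) = f *v (e *v y (Suc k)) + h *v y (Suc k)"
      by (simp only: y(2)[of "Suc k"] ef)
    then show ?case
      unfolding Suc hy vec.scale by (simp add: y(2) vec_eq_iff algebra_simps)
  qed
  have "\<exists>k. y k = 0"
  proof (rule ccontr)
    assume "\<not> ?thesis"
    then have "card {..CARD('n)} \<le> CARD('n)"
      by (intro eigenvectors_card_le[of _ h y "\<lambda>k. \<mu> - 2 * of_nat k"]) (auto simp: hy inj_on_def)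
    then show False by simp
  qed
  \<comment> \<open>At the first zero \<open>y (Suc j)\<close> of the lowering string, raising
    returns \<open>y j\<close> with the factor \<open>(j + 1) * (\<mu> - j)\<close>, which must
    therefore vanish.\<close>
  define k where "k = (LEAST k. y k = 0)"
  have k: "y k = 0" unfolding k_def using \<open>\<exists>k. y k = 0\<close> by (rule LeastI_ex)
  then have "k \<noteq> 0" using x y by metis
  then obtain j where j: "k = Suc j" by (cases k) auto
  then have "y j \<noteq> 0"
    using not_less_Least[of j "\<lambda>k. y k = 0"] by (simp add: k_def)
  moreover have "(of_nat (Suc j) * (\<mu> - of_nat j)) *s y j = 0"
    using ey[of j] k j by simp
  ultimately have "\<mu> = of_nat j"
    by (simp only: vec.scale_eq_0_iff mult_eq_0_iff of_nat_eq_0_iff) auto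
  then show ?thesis ..
qed

section \<open>Representations of $e_6$\<close>

text \<open>Lowering sequences that start at a sum of fundamental weights, whose numbers (in Bourbaki's
  numbering) form the name of the sequence.  An entry \<open>(q, s)\<close> lowers the weight number \<open>q\<close> of the
  list obtained so far by the simple root number \<open>s + 1\<close>.\<close>

definition steps_2 :: "(nat \<times> nat) list" where
  "steps_2 =
    [(0, 1), (1, 3), (2, 2), (2, 4), (3, 0), (3, 4), (4, 5), (5, 4), (6, 3), (6, 5), (8, 3), (8, 5),
     (9, 1), (9, 5), (11, 1), (11, 2), (11, 5), (13, 5), (14, 4), (15, 2), (15, 5), (16, 5), (17,
     4), (18, 4), (20, 3), (20, 5), (21, 4)]"

definition steps_3 :: "(nat \<times> nat) list" where
  "steps_3 =
    [(0, 2), (1, 0), (1, 3), (2, 3), (3, 1), (3, 4), (4, 1), (4, 2), (4, 4), (5, 4), (6, 5), (7, 2),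
     (7, 4), (8, 4), (9, 5), (10, 3), (10, 5), (12, 3), (12, 4), (13, 3), (13, 5), (14, 3), (14, 5),
     (16, 2), (16, 5), (18, 4), (19, 5)]"

definition steps_4 :: "(nat \<times> nat) list" where
  "steps_4 =
    [(0, 3), (1, 1), (1, 2), (1, 4), (2, 2), (2, 4), (3, 0), (3, 4), (4, 5), (5, 0), (5, 3), (5, 4),
     (6, 3), (6, 5), (7, 4), (8, 3), (8, 5), (10, 3), (10, 4), (11, 4), (12, 5), (13, 5), (15, 3),
     (15, 5), (16, 5), (18, 2), (18, 4)]"

definition steps_5 :: "(nat \<times> nat) list" where
  "steps_5 =
    [(0, 4), (1, 3), (1, 5), (2, 1), (2, 2), (2, 5), (4, 2), (4, 5), (5, 0), (5, 5), (6, 4), (7, 0),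
     (7, 3), (7, 5), (8, 4), (9, 5), (10, 4), (12, 3), (12, 5), (13, 4), (13, 5), (14, 4), (15, 3),
     (16, 4), (17, 3), (18, 2), (18, 4)]"

definition steps_16 :: "(nat \<times> nat) list" where
  "steps_16 =
    [(0, 0), (0, 5), (1, 2), (1, 5), (2, 4), (3, 3), (3, 5), (4, 4), (5, 3), (6, 1), (6, 4), (6, 5),
     (7, 4), (8, 3), (9, 1), (9, 2), (10, 4), (10, 5), (11, 5), (14, 1), (15, 2), (17, 3), (17, 5),
     (21, 3), (22, 2), (22, 5), (24, 4)]"

definition steps_11 :: "(nat \<times> nat) list" where
  "steps_11 =
    [(0, 0), (1, 2), (2, 0), (2, 3), (3, 3), (4, 1), (4, 4), (5, 1), (5, 2), (5, 4), (6, 4), (7, 5),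
     (8, 2), (8, 4), (9, 4), (10, 5), (11, 3), (11, 5), (13, 3), (13, 4), (14, 3), (14, 5), (15, 3),
     (15, 5), (17, 2), (17, 5), (19, 4)]"

definition steps_66 :: "(nat \<times> nat) list" where
  "steps_66 =
    [(0, 5), (1, 4), (2, 3), (2, 5), (3, 1), (3, 2), (3, 5), (5, 2), (5, 5), (6, 0), (6, 5), (7, 4),
     (8, 0), (8, 3), (8, 5), (9, 4), (10, 5), (11, 4), (13, 3), (13, 5), (14, 4), (14, 5), (15, 4),
     (16, 3), (17, 4), (18, 3), (19, 2)]"

definition steps_1 :: "(nat \<times> nat) list" where
  "steps_1 =
    [(0, 0), (1, 2), (2, 3), (3, 1), (3, 4), (4, 4), (5, 5), (6, 3), (6, 5), (8, 2), (8, 5), (10,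
     0), (10, 5), (11, 4), (12, 5), (13, 4), (15, 4), (16, 3), (17, 3), (18, 1), (19, 1), (19, 2),
     (21, 2), (23, 3), (24, 4), (25, 5)]"

text \<open>The arrows of the weight diagram that are not used in \<open>steps_1\<close>: \<open>((s, k, l), (t, m, k'))\<close>
  stands for a commuting square with the sides \<open>s\<close>, \<open>t\<close> and the vertices \<open>m\<close>, \<open>k\<close>, \<open>k'\<close>, \<open>l\<close>.\<close>

definition e6_squares :: "((nat \<times> nat \<times> nat) \<times> (nat \<times> nat \<times> nat)) list" where
  "e6_squares =
    [((0, 13, 15), (5, 10, 12)), ((0, 16, 17), (4, 13, 15)), ((0, 18, 19), (3, 16, 17)), ((0, 20,
     21), (1, 18, 19)), ((1, 5, 6), (4, 3, 4)), ((1, 7, 9), (5, 5, 6)), ((1, 22, 23), (2, 19, 21)),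
     ((2, 11, 13), (5, 8, 10)), ((2, 14, 16), (4, 11, 13)), ((3, 9, 11), (5, 6, 8))]"

definition e6_rows :: "int list list" where
  "e6_rows = [[2, 0, -1, 0, 0, 0], [0, 2, 0, -1, 0, 0], [-1, 0, 2, -1, 0, 0],
    [0, -1, -1, 2, -1, 0], [0, 0, 0, -1, 2, -1], [0, 0, 0, 0, -1, 2]]"

text \<open>The coefficients, in the coroots, of an element of the Cartan subalgebra on which the positive
  roots are positive and which separates the weights that occur below.  The simple roots take the
  values \<open>grading_steps\<close> on it.\<close>

definition grading :: "int list" where "grading = [139, 203, 276, 387, 273, 148]"

definition grading_steps :: "int list" where "grading_steps = [2, 19, 26, 22, 11, 23]"

definition grade :: "int list \<Rightarrow> int" where "grade w = sum_list (map2 (*) grading w)"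

lemma e6_cartan_rows: "s < 6 \<Longrightarrow> t < 6 \<Longrightarrow> e6_cartan (Suc s) (Suc t) = e6_rows ! s ! t"
proof -
  have "\<forall>s<6. \<forall>t<6. e6_cartan (Suc s) (Suc t) = e6_rows ! s ! t"
    by (simp add: all_less_numeral e6_cartan_def e6_edges_def e6_rows_def doubleton_eq_iff)
  then show "s < 6 \<Longrightarrow> t < 6 \<Longrightarrow> e6_cartan (Suc s) (Suc t) = e6_rows ! s ! t" by blast
qed

lemma sum_less_6:
  fixes f :: "nat \<Rightarrow> 'a::comm_monoid_add"
  shows "(\<Sum>j<6. f j) = f 0 + f 1 + f 2 + f 3 + f 4 + f 5"
  by (simp add: lessThan_nat_numeral lessThan_Suc add_ac)

lemma grading_rows: "s < 6 \<Longrightarrow> (\<Sum>j<6. grading ! j * e6_rows ! j ! s) = grading_steps ! s"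
proof -
  have "\<forall>s<6. (\<Sum>j<6. grading ! j * e6_rows ! j ! s) = grading_steps ! s"
    unfolding sum_less_6 by (simp add: all_less_numeral grading_def e6_rows_def grading_steps_def)
  then show "s < 6 \<Longrightarrow> (\<Sum>j<6. grading ! j * e6_rows ! j ! s) = grading_steps ! s" by blast
qed

lemma e6_rows_sym: "s < 6 \<Longrightarrow> t < 6 \<Longrightarrow> e6_rows ! s ! t = e6_rows ! t ! s"
proof -
  have "\<forall>s<6. \<forall>t<6. e6_rows ! s ! t = e6_rows ! t ! s"
    by (simp add: all_less_numeral e6_rows_def)
  then show "s < 6 \<Longrightarrow> t < 6 \<Longrightarrow> e6_rows ! s ! t = e6_rows ! t ! s" by blast
qed

lemma grade_eq_sum: "length w = 6 \<Longrightarrow> grade w = (\<Sum>j<6. grading ! j * w ! j)"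
  by (simp add: grade_def sum_list_sum_nth grading_def atLeast0LessThan sum_less_6 eval_nat_numeral)

lemma smult_mat_mult_vec: "(c *\<^sub>m A) *v x = c *s (A *v x)"
  by (simp add: vec_eq_iff matrix_vector_mult_def sum_distrib_left mult_ac)

lemma matrix_sum_mult_vec: "(\<Sum>j\<in>J. A j) *v x = (\<Sum>j\<in>J. A j *v x)" for A :: "'j \<Rightarrow> complex^'n::finite^'m"
  by (induction J rule: infinite_finite_induct) (simp_all add: matrix_vector_mult_add_rdistrib)

text \<open>\<open>descend ws st\<close> extends a list of weights of a representation by weights obtained by
  lowering: a weight \<open>\<mu>\<close> with \<open>\<mu>\<^sub>s > 0\<close> is followed by \<open>\<mu> - \<alpha>\<^sub>s\<close>.\<close>

fun descend :: "int list list \<Rightarrow> (nat \<times> nat) list \<Rightarrow> int list list option" where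
  "descend ws [] = Some ws"
| "descend ws ((q, s) # st) = (if q < length ws \<and> s < 6 \<and> ws ! q ! s > 0
    then descend (ws @ [map2 (-) (ws ! q) (e6_rows ! s)]) st else None)"

fun complete_squares :: "(nat \<times> nat \<times> nat) list \<Rightarrow> ((nat \<times> nat \<times> nat) \<times> (nat \<times> nat \<times> nat)) list \<Rightarrow>
    (nat \<times> nat \<times> nat) list option" where
  "complete_squares known [] = Some known"
| "complete_squares known (((s, k, l), (t, m, k')) # cert) =
    (if s < 6 \<and> t < 6 \<and> s \<noteq> t \<and> e6_rows ! s ! t = 0
      \<and> List.member known (s, m, k') \<and> List.member known (t, m, k) \<and> List.member known (t, k', l)
     then complete_squares ((s, k, l) # known) cert else None)"

section \<open>Weight vectors and highest weights in a representation of e6\<close>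

locale e6_rep =
  fixes E F H :: "nat \<Rightarrow> complex^'n::finite^'n"
  assumes relations: "e6_relations E F H"
begin

text \<open>Simple roots are numbered from 0 here.\<close>

definition lowering :: "nat \<Rightarrow> complex^'n^'n" where "lowering s = F (Suc s)"
definition raising :: "nat \<Rightarrow> complex^'n^'n" where "raising s = E (Suc s)"
definition coroot :: "nat \<Rightarrow> complex^'n^'n" where "coroot s = H (Suc s)"

definition grading_op :: "complex^'n^'n"
  where "grading_op = (\<Sum>j<6. of_int (grading ! j) *\<^sub>m coroot j)"

lemma bracket_mult_vec: "lie_bracket X Y = Z \<Longrightarrow> X *v (Y *v x) = Y *v (X *v x) + Z *v x"
  for X Y Z :: "complex^'n^'n"
  by (simp add: lie_bracket_def matrix_vector_mul_assoc flip: matrix_vector_mult_diff_rdistrib)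
    (metis add.commute diff_add_cancel matrix_vector_mult_diff_rdistrib)

lemma
  assumes "s < 6" "t < 6"
  shows coroot_commute: "coroot s ** coroot t = coroot t ** coroot s"
    and coroot_raising: "coroot s *v (raising t *v x) = raising t *v (coroot s *v x) + of_int (e6_rows ! s ! t) *s (raising t *v x)"
    and coroot_lowering: "coroot s *v (lowering t *v x) = lowering t *v (coroot s *v x) - of_int (e6_rows ! s ! t) *s (lowering t *v x)"
    and raising_lowering: "raising s *v (lowering t *v x) = lowering t *v (raising s *v x) + (if s = t then coroot s *v x else 0)"
    and lowering_commute: "s \<noteq> t \<Longrightarrow> e6_rows ! s ! t = 0 \<Longrightarrow> lowering s *v (lowering t *v x) = lowering t *v (lowering s *v x)"
proof -
  have r: "lie_bracket (H (Suc s)) (H (Suc t)) = 0"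
    "lie_bracket (H (Suc s)) (E (Suc t)) = of_int (e6_rows ! s ! t) *\<^sub>m E (Suc t)"
    "lie_bracket (H (Suc s)) (F (Suc t)) = - (of_int (e6_rows ! s ! t) *\<^sub>m F (Suc t))"
    "lie_bracket (E (Suc s)) (F (Suc t)) = (if s = t then H (Suc s) else 0)"
    "s \<noteq> t \<Longrightarrow> (lie_bracket (F (Suc s)) ^^ nat (1 - e6_rows ! s ! t)) (F (Suc t)) = 0"
  proof -
    have "Suc s \<in> {1..6}" "Suc t \<in> {1..6}" using assms by auto
    note r = relations[unfolded e6_relations_def, rule_format, OF this, unfolded e6_cartan_rows[OF assms]]
    show "lie_bracket (H (Suc s)) (H (Suc t)) = 0"
      "lie_bracket (H (Suc s)) (E (Suc t)) = of_int (e6_rows ! s ! t) *\<^sub>m E (Suc t)"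
      "lie_bracket (H (Suc s)) (F (Suc t)) = - (of_int (e6_rows ! s ! t) *\<^sub>m F (Suc t))"
      "lie_bracket (E (Suc s)) (F (Suc t)) = (if s = t then H (Suc s) else 0)"
      "s \<noteq> t \<Longrightarrow> (lie_bracket (F (Suc s)) ^^ nat (1 - e6_rows ! s ! t)) (F (Suc t)) = 0"
      using r by simp_all
  qed
  show "coroot s ** coroot t = coroot t ** coroot s"
    using r(1) by (simp add: coroot_def lie_bracket_def)
  show "coroot s *v (raising t *v x) = raising t *v (coroot s *v x) + of_int (e6_rows ! s ! t) *s (raising t *v x)"
    using bracket_mult_vec[OF r(2)] by (simp add: coroot_def raising_def smult_mat_mult_vec)
  have neg: "(- X) *v x = - (X *v x)" for X :: "complex^'n^'n"
    by (simp add: vec_eq_iff matrix_vector_mult_def sum_negf)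
  show "coroot s *v (lowering t *v x) = lowering t *v (coroot s *v x) - of_int (e6_rows ! s ! t) *s (lowering t *v x)"
    using bracket_mult_vec[OF r(3)] by (simp add: coroot_def lowering_def smult_mat_mult_vec neg)
  show "raising s *v (lowering t *v x) = lowering t *v (raising s *v x) + (if s = t then coroot s *v x else 0)"
    using bracket_mult_vec[OF r(4)] by (simp add: coroot_def lowering_def raising_def)
  show "s \<noteq> t \<Longrightarrow> e6_rows ! s ! t = 0 \<Longrightarrow> lowering s *v (lowering t *v x) = lowering t *v (lowering s *v x)"
    using bracket_mult_vec[of "F (Suc s)" "F (Suc t)" 0 x] r(5) by (simp add: lowering_def)
qed

definition is_weight_vector :: "(nat \<Rightarrow> complex) \<Rightarrow> complex^'n \<Rightarrow> bool"
  where "is_weight_vector \<mu> x \<longleftrightarrow> (\<forall>j<6. coroot j *v x = \<mu> j *s x)"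

lemma is_weight_vector_lowering:
  assumes "is_weight_vector \<mu> x" "s < 6"
  shows "is_weight_vector (\<lambda>j. \<mu> j - of_int (e6_rows ! s ! j)) (lowering s *v x)"
  unfolding is_weight_vector_def
proof (intro allI impI)
  fix j :: nat assume "j < 6"
  then have "coroot j *v x = \<mu> j *s x" using assms(1) by (simp add: is_weight_vector_def)
  then show "coroot j *v (lowering s *v x) = (\<mu> j - of_int (e6_rows ! s ! j)) *s (lowering s *v x)"
    using coroot_lowering[OF \<open>j < 6\<close> assms(2), of x] e6_rows_sym[OF \<open>j < 6\<close> assms(2)]
    by (simp add: vec.scale vec.scale_left_diff_distrib)
qed

text \<open>A vector killed by \<open>lowering s\<close> is a highest weight vector for the opposite
  triple \<open>lowering s\<close>, \<open>raising s\<close>, \<open>- coroot s\<close>, so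
  \<open>- \<mu> s\<close> would be a natural number.\<close>

lemma lowering_nonzero:
  assumes "is_weight_vector \<mu> x" "x \<noteq> 0" "s < 6" "\<And>n. \<mu> s \<noteq> - of_nat n"
  shows "lowering s *v x \<noteq> 0"
proof
  assume 0: "lowering s *v x = 0"
  have neg: "(- X) *v x = - (X *v x)" for X :: "complex^'n^'n" and x
    by (simp add: vec_eq_iff matrix_vector_mult_def sum_negf)
  have neg': "X *v (- x) = - (X *v x)" for X :: "complex^'n^'n" and x
    by (simp add: vec_eq_iff matrix_vector_mult_def sum_negf)
  have row: "e6_rows ! s ! s = 2"
  proof -
    have "\<forall>s<6. e6_rows ! s ! s = 2" by (simp add: all_less_numeral e6_rows_def)
    then show ?thesis using assms(3) by blast
  qed
  have "\<exists>n. - \<mu> s = of_nat n"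
  proof (rule sl2_highest_weight[of "lowering s" "raising s" "- coroot s" x])
    show "lowering s *v (raising s *v x) = raising s *v (lowering s *v x) + - coroot s *v x" for x
      using raising_lowering[OF assms(3,3), of x] by (simp add: neg)
    show "- coroot s *v (raising s *v x) = raising s *v (- coroot s *v x) - 2 *s (raising s *v x)" for x
      using coroot_raising[OF assms(3,3), of x] by (simp add: neg neg' row)
    show "- coroot s *v x = - \<mu> s *s x"
      using assms(1,3) by (simp add: is_weight_vector_def neg vec.scale_minus_left)
  qed (use assms 0 in auto)
  then show False using assms(4) by (metis add.inverse_inverse)
qed

lemma grading_op_weight: "is_weight_vector \<mu> x \<Longrightarrow> grading_op *v x = (\<Sum>j<6. of_int (grading ! j) * \<mu> j) *s x"
  by (simp add: grading_op_def matrix_sum_mult_vec smult_mat_mult_vec is_weight_vector_def vec.scale_sum_left)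

lemma grading_op_raising:
  assumes "s < 6"
  shows "grading_op *v (raising s *v x) = raising s *v (grading_op *v x) + of_int (grading_steps ! s) *s (raising s *v x)"
proof -
  have "grading_op *v (raising s *v x) = (\<Sum>j<6. of_int (grading ! j) *s (raising s *v (coroot j *v x)) +
      of_int (grading ! j * e6_rows ! j ! s) *s (raising s *v x))"
    unfolding grading_op_def matrix_sum_mult_vec smult_mat_mult_vec
    using assms by (intro sum.cong refl) (simp add: coroot_raising vec.scale_right_distrib)
  also have "\<dots> = raising s *v (grading_op *v x) + of_int (grading_steps ! s) *s (raising s *v x)"
    unfolding sum.distrib grading_rows[OF assms, symmetric] of_int_sum vec.scale_sum_left
    by (simp add: grading_op_def matrix_sum_mult_vec smult_mat_mult_vec vec.linear_sum[OF matrix_vector_mul_linear_gen] vec.scale)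
  finally show ?thesis .
qed

lemma grading_op_lowering:
  assumes "s < 6"
  shows "grading_op *v (lowering s *v x) = lowering s *v (grading_op *v x) - of_int (grading_steps ! s) *s (lowering s *v x)"
proof -
  have "grading_op *v (lowering s *v x) = (\<Sum>j<6. of_int (grading ! j) *s (lowering s *v (coroot j *v x)) -
      of_int (grading ! j * e6_rows ! j ! s) *s (lowering s *v x))"
    unfolding grading_op_def matrix_sum_mult_vec smult_mat_mult_vec
    using assms by (intro sum.cong refl) (simp add: coroot_lowering vec.scale_right_diff_distrib)
  also have "\<dots> = lowering s *v (grading_op *v x) - of_int (grading_steps ! s) *s (lowering s *v x)"
    unfolding sum_subtractf grading_rows[OF assms, symmetric] of_int_sum vec.scale_sum_left
    by (simp add: grading_op_def matrix_sum_mult_vec smult_mat_mult_vec vec.linear_sum[OF matrix_vector_mul_linear_gen] vec.scale)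
  finally show ?thesis .
qed

lemma grading_op_coroot:
  assumes "s < 6"
  shows "grading_op *v (coroot s *v x) = coroot s *v (grading_op *v x)"
proof -
  have "coroot j *v (coroot s *v x) = coroot s *v (coroot j *v x)" if "j < 6" for j
    using coroot_commute[OF that assms] by (simp add: matrix_vector_mul_assoc)
  then show ?thesis
    by (simp add: grading_op_def matrix_sum_mult_vec smult_mat_mult_vec vec.linear_sum[OF matrix_vector_mul_linear_gen] vec.scale)
qed

text \<open>Raising adds a positive integer to the eigenvalue of \<open>grading_op\<close>, so an
  eigenspace whose eigenvalue has maximal real part is killed by all raising operators. The
  commuting coroots have a common eigenvector in it.\<close>

lemma highest_weight_vector_exists:
  obtains x \<mu> where "x \<noteq> 0" "is_weight_vector \<mu> x" "\<And>s. s < 6 \<Longrightarrow> raising s *v x = 0"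
proof -
  define \<Lambda> where "\<Lambda> = {z. \<exists>y. y \<noteq> 0 \<and> grading_op *v y = z *s y}"
  have fin: "finite \<Lambda>"
  proof (rule ccontr)
    assume "infinite \<Lambda>"
    then obtain T where T: "finite T" "card T = Suc CARD('n)" "T \<subseteq> \<Lambda>"
      using infinite_arbitrarily_large by blast
    have "\<forall>z\<in>T. \<exists>y. y \<noteq> 0 \<and> grading_op *v y = z *s y"
      using T(3) unfolding \<Lambda>_def by blast
    from bchoice[OF this] obtain y where "\<forall>z\<in>T. y z \<noteq> 0 \<and> grading_op *v y z = z *s y z" ..
    then have "card T \<le> CARD('n)"
      by (intro eigenvectors_card_le[of T grading_op y "\<lambda>z. z"]) (use T in auto)
    then show False using T(2) by simp
  qed
  have "\<Lambda> \<noteq> {}"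
  proof -
    have "(axis undefined 1 :: complex^'n) \<noteq> 0" by (simp add: axis_eq_0_iff)
    from eigenvector_in_invariant_subspace[OF vec.subspace_UNIV UNIV_I this UNIV_I, of grading_op]
    obtain y z where "y \<noteq> 0" "grading_op *v y = z *s y" by metis
    then show ?thesis by (auto simp: \<Lambda>_def)
  qed
  then have "Max (Re ` \<Lambda>) \<in> Re ` \<Lambda>" using fin by (intro Max_in) auto
  then obtain z where z: "z \<in> \<Lambda>" "Re z = Max (Re ` \<Lambda>)" by (metis imageE)
  have max: "Re z' \<le> Re z" if "z' \<in> \<Lambda>" for z'
    unfolding z(2) using fin that by (intro Max_ge) auto
  define U where "U = {y. grading_op *v y = z *s y}"
  have "vec.subspace U"
    unfolding vec.subspace_def U_def
    by (auto simp: matrix_vector_right_distrib vec.scale_right_distrib vec.scale mult.commute)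
  moreover have "U \<noteq> {0}" using z(1) unfolding \<Lambda>_def U_def by auto
  moreover have "\<forall>A\<in>set (map coroot [0..<6]). \<forall>y\<in>U. A *v y \<in> U"
    by (auto simp: U_def grading_op_coroot vec.scale)
  moreover have "\<forall>A\<in>set (map coroot [0..<6]). \<forall>B\<in>set (map coroot [0..<6]). A ** B = B ** A"
    using coroot_commute by auto
  ultimately obtain x where x: "x \<in> U" "x \<noteq> 0" and ex: "\<forall>A\<in>set (map coroot [0..<6]). \<exists>z. A *v x = z *s x"
    using common_eigenvector[of U "map coroot [0..<6]"] by blast
  from ex have "\<forall>j. \<exists>\<mu>. j < 6 \<longrightarrow> coroot j *v x = \<mu> *s x" by simp
  from choice[OF this] obtain \<mu> where \<mu>: "\<forall>j. j < 6 \<longrightarrow> coroot j *v x = \<mu> j *s x" ..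
  show thesis
  proof (rule that[OF x(2), of \<mu>])
    show "is_weight_vector \<mu> x" using \<mu> by (simp add: is_weight_vector_def)
    fix s :: nat assume s: "s < 6"
    show "raising s *v x = 0"
    proof (rule ccontr)
      assume "raising s *v x \<noteq> 0"
      moreover have "grading_op *v (raising s *v x) = (z + of_int (grading_steps ! s)) *s (raising s *v x)"
        using grading_op_raising[OF s, of x] x(1) by (simp add: U_def vec.scale vec.scale_left_distrib)
      ultimately have "z + of_int (grading_steps ! s) \<in> \<Lambda>" by (auto simp: \<Lambda>_def)
      from max[OF this] have "grading_steps ! s \<le> 0" by simp
      moreover have "\<forall>s<6. grading_steps ! s > 0" by (simp add: all_less_numeral grading_steps_def)
      ultimately show False using s by (meson not_le)
    qed
  qed
qed

lemma highest_weight_natural: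
  assumes "is_weight_vector \<mu> x" "x \<noteq> 0" "s < 6" "raising s *v x = 0"
  shows "\<exists>n. \<mu> s = of_nat n"
proof (rule sl2_highest_weight[of "raising s" "lowering s" "coroot s" x])
  have row: "e6_rows ! s ! s = 2"
  proof -
    have "\<forall>s<6. e6_rows ! s ! s = 2" by (simp add: all_less_numeral e6_rows_def)
    then show ?thesis using assms(3) by blast
  qed
  show "raising s *v (lowering s *v x) = lowering s *v (raising s *v x) + coroot s *v x" for x
    using raising_lowering[OF assms(3,3)] by simp
  show "coroot s *v (lowering s *v x) = lowering s *v (coroot s *v x) - 2 *s (lowering s *v x)" for x
    using coroot_lowering[OF assms(3,3)] by (simp add: row)
qed (use assms in \<open>auto simp: is_weight_vector_def\<close>)

text \<open>The offset \<open>d\<close> lets the computation for one list of numerical weights serve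
  all highest weights with larger coordinates.\<close>

lemma descend_vectors:
  assumes "descend ws st = Some ws'" "length ys = length ws"
    and "\<forall>k<length ws. length (ws ! k) = 6 \<and> ys ! k \<noteq> 0 \<and> is_weight_vector (\<lambda>j. of_int (ws ! k ! j + d j)) (ys ! k)"
    and d: "\<And>j. j < 6 \<Longrightarrow> d j \<ge> 0"
  shows "\<exists>ys'. length ys' = length ws' \<and> length ws' = length ws + length st \<and>
    (\<forall>k<length ws'. length (ws' ! k) = 6 \<and> ys' ! k \<noteq> 0 \<and> is_weight_vector (\<lambda>j. of_int (ws' ! k ! j + d j)) (ys' ! k)) \<and>
    (\<forall>k<length ws. ys' ! k = ys ! k) \<and>
    (\<forall>i<length st. ys' ! (length ws + i) = lowering (snd (st ! i)) *v ys' ! fst (st ! i))"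
  using assms(1-3)
proof (induction st arbitrary: ws ys)
  case Nil
  then show ?case by auto
next
  case (Cons e st)
  obtain q s where e: "e = (q, s)" by (cases e)
  define w where "w = map2 (-) (ws ! q) (e6_rows ! s)"
  have q: "q < length ws" "s < 6" "ws ! q ! s > 0" and rest: "descend (ws @ [w]) st = Some ws'"
    using Cons.prems(1) by (auto simp: e w_def split: if_splits)
  define y where "y = lowering s *v ys ! q"
  have row: "length (e6_rows ! s) = 6"
  proof -
    have "\<forall>s<6. length (e6_rows ! s) = 6" by (simp add: all_less_numeral e6_rows_def)
    then show ?thesis using q by blast
  qed
  have wq: "length (ws ! q) = 6" "ys ! q \<noteq> 0" "is_weight_vector (\<lambda>j. of_int (ws ! q ! j + d j)) (ys ! q)"
    using Cons.prems(3) q(1) by blast+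
  \<comment> \<open>The check \<open>ws ! q ! s > 0\<close> survives the nonnegative offset, and a
    positive integer is never minus a natural number.\<close>
  have "of_int (ws ! q ! s + d s) \<noteq> - (of_nat n :: complex)" for n
  proof
    assume "of_int (ws ! q ! s + d s) = - (of_nat n :: complex)"
    then have "of_int (ws ! q ! s + d s) = (of_int (- int n) :: complex)" by simp
    then have "ws ! q ! s + d s = - int n" by (simp only: of_int_eq_iff)
    then show False using q d[of s] by simp
  qed
  from lowering_nonzero[OF wq(3,2) q(2) this] have "y \<noteq> 0" by (simp add: y_def)
  moreover have "length w = 6" using wq row by (simp add: w_def)
  moreover have "is_weight_vector (\<lambda>j. of_int (w ! j + d j)) y"
    using is_weight_vector_lowering[OF wq(3) q(2)] wq(1) row
    unfolding is_weight_vector_def y_def by (simp add: w_def algebra_simps)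
  ultimately have "\<forall>k<length (ws @ [w]). length ((ws @ [w]) ! k) = 6 \<and> (ys @ [y]) ! k \<noteq> 0 \<and>
      is_weight_vector (\<lambda>j. of_int ((ws @ [w]) ! k ! j + d j)) ((ys @ [y]) ! k)"
    using Cons.prems(2,3) by (simp add: nth_append less_Suc_eq)
  from Cons.IH[OF rest _ this] Cons.prems(2) obtain ys' where ys': "length ys' = length ws'"
    "length ws' = length (ws @ [w]) + length st"
    "\<forall>k<length ws'. length (ws' ! k) = 6 \<and> ys' ! k \<noteq> 0 \<and> is_weight_vector (\<lambda>j. of_int (ws' ! k ! j + d j)) (ys' ! k)"
    "\<forall>k<length (ws @ [w]). ys' ! k = (ys @ [y]) ! k"
    "\<forall>i<length st. ys' ! (length (ws @ [w]) + i) = lowering (snd (st ! i)) *v ys' ! fst (st ! i)"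
    by auto
  have "ys' ! (length ws + i) = lowering (snd ((e # st) ! i)) *v ys' ! fst ((e # st) ! i)" if "i < length (e # st)" for i
  proof (cases i)
    case 0
    then show ?thesis
      using ys'(4) Cons.prems(2) q(1) by (simp add: e nth_append y_def)
  next
    case (Suc j)
    then show ?thesis using ys'(5) that by simp
  qed
  moreover have "\<forall>k<length ws. ys' ! k = ys ! k"
    using ys'(4) Cons.prems(2) by (simp add: nth_append)
  ultimately show ?case
    using ys'(1-3) by (intro exI[of _ ys']) simp
qed

text \<open>If \<open>l\<close> dominates \<open>w\<close> coordinatewise, the steps valid for
  \<open>w\<close> are valid for \<open>l\<close>: the difference keeps positive coordinates
  positive and shifts all grades by the same constant, so the 28 eigenvalues stay distinct.\<close>

lemma weights_bound:
  assumes x: "x \<noteq> 0" "is_weight_vector (\<lambda>j. of_nat (l j)) x"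
    and w: "length w = 6" "\<And>j. j < 6 \<Longrightarrow> w ! j \<le> int (l j)"
    and check: "case descend [w] st of None \<Rightarrow> False | Some ws \<Rightarrow> length ws = 28 \<and> distinct (map grade ws)"
  shows "28 \<le> CARD('n)"
proof -
  define d where "d j = int (l j) - w ! j" for j
  obtain ws where ws: "descend [w] st = Some ws" "length ws = 28" "distinct (map grade ws)"
    using check by (auto split: option.splits)
  have "is_weight_vector (\<lambda>j. of_int (w ! j + d j)) x"
    using x(2) by (simp add: d_def)
  then obtain ys where ys: "\<forall>k<28. length (ws ! k) = 6 \<and> ys ! k \<noteq> 0 \<and> is_weight_vector (\<lambda>j. of_int (ws ! k ! j + d j)) (ys ! k)"
    using descend_vectors[OF ws(1), of "[x]" d] x(1) w ws(2) by (auto simp: d_def)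
  have "grading_op *v (ys ! k) = of_int (grade (ws ! k) + (\<Sum>j<6. grading ! j * d j)) *s (ys ! k)" if "k < 28" for k
    using grading_op_weight[of "\<lambda>j. of_int (ws ! k ! j + d j)" "ys ! k"] ys that
    by (simp add: grade_eq_sum sum.distrib distrib_left)
  moreover have "inj_on (\<lambda>k. of_int (grade (ws ! k) + (\<Sum>j<6. grading ! j * d j)) :: complex) {..<28}"
    using ws(2,3) by (auto simp: inj_on_def distinct_conv_nth)
  ultimately have "card {..<28 :: nat} \<le> CARD('n)"
    by (intro eigenvectors_card_le[of _ grading_op "(!) ys" "\<lambda>k. of_int (grade (ws ! k) + (\<Sum>j<6. grading ! j * d j))"])
      (use ys in auto)
  then show ?thesis by simp
qed

end

section \<open>The 27-dimensional representations of $e_6$\<close>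

definition e6_weights :: "int list" where
  "e6_weights =
    [139, 137, 111, 89, 70, 78, 59, 55, 37, 36, 11, 14, 9, -12, 3, -14, -23, -25, -45, -47, -64,
     -66, -73, -92, -114, -125, -148]"

definition e6_arrows :: "edges" where
  "e6_arrows =
    [(0, 0, 1, 1), (2, 1, 2, 1), (3, 2, 3, 1), (1, 3, 4, 1), (4, 3, 5, 1), (4, 4, 6, 1), (1, 5, 6,
     1), (5, 5, 7, 1), (3, 6, 8, 1), (5, 6, 9, 1), (1, 7, 9, 1), (2, 8, 10, 1), (5, 8, 11, 1), (3,
     9, 11, 1), (0, 10, 12, 1), (5, 10, 13, 1), (2, 11, 13, 1), (4, 11, 14, 1), (5, 12, 15, 1), (0,
     13, 15, 1), (4, 13, 16, 1), (2, 14, 16, 1), (4, 15, 17, 1), (0, 16, 17, 1), (3, 16, 18, 1), (3,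
     17, 19, 1), (0, 18, 19, 1), (1, 18, 20, 1), (1, 19, 21, 1), (2, 19, 22, 1), (0, 20, 21, 1), (2,
     21, 23, 1), (1, 22, 23, 1), (3, 23, 24, 1), (4, 24, 25, 1), (5, 25, 26, 1)]"

text \<open>The 45 keys are the triples of weights of sum zero, which correspond to the 45
  tritangent planes of a cubic surface with its 27 lines.\<close>

definition e6_cubic :: "cubic_table" where
  "e6_cubic =
    [((0, 12, 26), 1), ((0, 15, 25), -1), ((0, 17, 24), 1), ((0, 19, 23), -1), ((0, 21, 22), 1),
     ((1, 10, 26), -1), ((1, 13, 25), 1), ((1, 16, 24), -1), ((1, 18, 23), 1), ((1, 20, 22), -1),
     ((2, 8, 26), 1), ((2, 11, 25), -1), ((2, 14, 24), 1), ((2, 18, 21), -1), ((2, 19, 20), 1), ((3,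
     6, 26), -1), ((3, 9, 25), 1), ((3, 14, 23), -1), ((3, 16, 21), 1), ((3, 17, 20), -1), ((4, 5,
     26), 1), ((4, 7, 25), -1), ((4, 14, 22), 1), ((4, 16, 19), -1), ((4, 17, 18), 1), ((5, 9, 24),
     -1), ((5, 11, 23), 1), ((5, 13, 21), -1), ((5, 15, 20), 1), ((6, 7, 24), 1), ((6, 11, 22), -1),
     ((6, 13, 19), 1), ((6, 15, 18), -1), ((7, 8, 23), -1), ((7, 10, 21), 1), ((7, 12, 20), -1),
     ((8, 9, 22), 1), ((8, 13, 17), -1), ((8, 15, 16), 1), ((9, 10, 19), -1), ((9, 12, 18), 1),
     ((10, 11, 17), 1), ((10, 14, 15), -1), ((11, 12, 16), -1), ((12, 13, 14), 1)]"

definition e6_certificate :: "(key \<times> nat \<times> key) list" where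
  "e6_certificate =
    [((1, 10, 26), 0, (0, 10, 26)), ((2, 8, 26), 2, (1, 8, 26)), ((3, 6, 26), 3, (2, 6, 26)), ((4,
     5, 26), 4, (3, 4, 26)), ((0, 15, 25), 5, (0, 12, 25)), ((1, 13, 25), 5, (1, 10, 25)), ((2, 11,
     25), 5, (2, 8, 25)), ((3, 9, 25), 5, (3, 6, 25)), ((4, 7, 25), 5, (4, 5, 25)), ((0, 17, 24), 4,
     (0, 15, 24)), ((1, 16, 24), 4, (1, 13, 24)), ((2, 14, 24), 4, (2, 11, 24)), ((5, 9, 24), 4, (3,
     9, 24)), ((6, 7, 24), 4, (4, 7, 24)), ((0, 19, 23), 3, (0, 17, 23)), ((1, 18, 23), 3, (1, 16,
     23)), ((3, 14, 23), 3, (2, 14, 23)), ((5, 11, 23), 3, (5, 9, 23)), ((7, 8, 23), 3, (6, 7, 23)),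
     ((0, 21, 22), 1, (0, 19, 22)), ((1, 20, 22), 1, (1, 18, 22)), ((4, 14, 22), 1, (3, 14, 22)),
     ((6, 11, 22), 1, (5, 11, 22)), ((8, 9, 22), 1, (7, 8, 22)), ((2, 18, 21), 2, (1, 18, 21)), ((2,
     19, 20), 2, (1, 19, 20)), ((3, 16, 21), 2, (3, 14, 21)), ((4, 16, 19), 2, (4, 14, 19)), ((5,
     13, 21), 2, (5, 11, 21)), ((6, 13, 19), 2, (6, 11, 19)), ((7, 10, 21), 2, (7, 8, 21)), ((9, 10,
     19), 2, (8, 9, 19)), ((3, 17, 20), 3, (2, 17, 20)), ((4, 17, 18), 3, (4, 16, 17)), ((8, 13,
     17), 3, (6, 13, 17)), ((10, 11, 17), 3, (9, 10, 17)), ((5, 15, 20), 4, (3, 15, 20)), ((6, 15,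
     18), 4, (4, 15, 18)), ((8, 15, 16), 4, (8, 13, 15)), ((10, 14, 15), 4, (10, 11, 15)), ((7, 12,
     20), 5, (5, 12, 20)), ((9, 12, 18), 5, (6, 12, 18)), ((11, 12, 16), 5, (8, 12, 16)), ((12, 13,
     14), 5, (10, 12, 14))]"

lemma e6_adjoint: "adjoint_identity {..<27} (cubic_of e6_cubic) (cubic_of e6_cubic) (4/3)"
proof (rule adjoint_identity_of_gradient)
  show "keys_ok 27 e6_cubic" "keys_ok 27 e6_cubic"
    by code_simp+
  fix x
  define y where "y = gradient e6_cubic x"
  define z where "z = cubic_value e6_cubic x"
  have "\<forall>a<27. gradient e6_cubic y a = 4/3 * z * x a"
    unfolding gradient_def[of _ y] e6_cubic_def
    apply (simp add: all_less_numeral del: One_nat_def)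
    unfolding y_def z_def gradient_def cubic_value_def e6_cubic_def
    apply (simp del: One_nat_def)
    apply (intro conjI; algebra)
    done
  then show "\<forall>a<27. gradient e6_cubic (gradient e6_cubic x) a = 4/3 * cubic_value e6_cubic x * x a"
    unfolding y_def z_def .
qed

lemma e6_covers: "covers e6_weights e6_cubic"
  by code_simp

lemma e6_determines: "determines 27 6 e6_arrows e6_cubic [(0, 12, 26)] e6_certificate"
  by code_simp

lemma all_less_6: "(\<forall>j<6. P j) \<longleftrightarrow> P 0 \<and> P 1 \<and> P 2 \<and> P 3 \<and> P 4 \<and> P (5 :: nat)"
  by (auto simp: all_less_numeral)

lemma ex_less_6: "(\<exists>j<6. P j) \<longleftrightarrow> P 0 \<or> P 1 \<or> P 2 \<or> P 3 \<or> P 4 \<or> P (5 :: nat)"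
  using all_less_6[of "\<lambda>j. \<not> P j"] by blast

lemma e6_cubic_base: "cubic_coeff e6_cubic (0, 12, 26) \<noteq> 0"
  by code_simp

lemma e6_weights_distinct: "length e6_weights = 27" "distinct e6_weights"
  by code_simp+

lemma e6_arrows_bounded: "list_all (\<lambda>(s, k, l, c). k < 27 \<and> l < 27) e6_arrows"
  by code_simp

text \<open>Step number \<open>i\<close> creates vertex \<open>Suc i\<close>, vertex 0 being the
  highest weight. Along these arrows one basis vector is the image of the other by
  construction.\<close>

definition e6_tree :: "(nat \<times> nat \<times> nat) list"
  where "e6_tree = map (\<lambda>(i, q, s). (s, q, Suc i)) (List.enumerate 0 steps_1)"

text \<open>Each arrow starts at a weight with coroot value 1, as in every minuscule representation.
  Hence raising undoes lowering without a factor.\<close>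

lemma e6_nodes: "case descend [[1, 0, 0, 0, 0, 0]] steps_1 of None \<Rightarrow> False
  | Some ws \<Rightarrow> map grade ws = e6_weights \<and> list_all (\<lambda>(s, k, l, c). s < 6 \<and> c = 1 \<and> ws ! k ! s = 1) e6_arrows"
  by code_simp

lemma e6_arrows_known: "case complete_squares e6_tree e6_squares of None \<Rightarrow> False
  | Some known \<Rightarrow> list_all (\<lambda>(s, k, l, c). List.member known (s, k, l)) e6_arrows"
  by code_simp

text \<open>Where an arrow is missing, the grade of its would-be end is not among the 27, which will
  force the operator to vanish there.\<close>

lemma e6_non_edges: "list_all (\<lambda>s. list_all (\<lambda>k.
    (edge_terms e6_arrows s k = [] \<longrightarrow> \<not> List.member e6_weights (e6_weights ! k - grading_steps ! s))
    \<and> (edge_terms (reverse_edges e6_arrows) s k = [] \<longrightarrow> \<not> List.member e6_weights (e6_weights ! k + grading_steps ! s))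
    \<and> length (edge_terms e6_arrows s k) \<le> 1 \<and> length (edge_terms (reverse_edges e6_arrows) s k) \<le> 1)
    [0..<27]) [0..<6]"
  by code_simp

text \<open>The source of an arrow is the top of its root string.\<close>

lemma e6_arrows_no_string: "list_all (\<lambda>(s, k, l, c). \<not> List.member e6_weights (e6_weights ! k + grading_steps ! s)) e6_arrows"
  by code_simp

context e6_rep
begin

definition generated :: "(complex^'n^'n) set"
  where "generated = lie_generated (\<Union>i\<in>{1..6}. {E i, F i, H i})"

lemma generated_mem: "s < 6 \<Longrightarrow> lowering s \<in> generated" "s < 6 \<Longrightarrow> raising s \<in> generated" "s < 6 \<Longrightarrow> coroot s \<in> generated"
  unfolding generated_def lowering_def raising_def coroot_def
  by (rule lie_generated.generator, rule UN_I[of "Suc s"], simp_all)+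

lemma grading_op_generated: "grading_op \<in> generated"
proof -
  have "(\<Sum>j\<in>J. of_int (grading ! j) *\<^sub>m coroot j) \<in> generated" if "finite J" "J \<subseteq> {..<6}" for J
    using that
  proof (induction J)
    case empty
    then show ?case by (simp add: generated_def lie_generated.zero)
  next
    case (insert j J)
    then show ?case
      using generated_mem(3)[of j] by (auto simp: generated_def intro!: lie_generated.add lie_generated.smult)
  qed
  then show ?thesis unfolding grading_op_def by blast
qed

text \<open>Lowering operators of orthogonal simple roots commute. Starting at the common vertex
  \<open>m\<close>, the two paths around the square therefore end in the same vector.\<close>

lemma complete_squares_sound:
  assumes "complete_squares known cert = Some known'"
    and "\<forall>(s, k, l)\<in>set known. lowering s *v b k = b l"
  shows "\<forall>(s, k, l)\<in>set known'. lowering s *v b k = b l"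
  using assms
proof (induction known cert rule: complete_squares.induct)
  case (2 known s k l t m k' cert)
  have c: "s < 6" "t < 6" "s \<noteq> t" "e6_rows ! s ! t = 0"
    "(s, m, k') \<in> set known" "(t, m, k) \<in> set known" "(t, k', l) \<in> set known"
    and rest: "complete_squares ((s, k, l) # known) cert = Some known'"
    using "2.prems"(1) by (simp_all split: if_splits)
  have "lowering s *v b m = b k'" "lowering t *v b m = b k" "lowering t *v b k' = b l"
    using c(5-7) "2.prems"(2) by fastforce+
  then have "lowering s *v b k = b l"
    using lowering_commute[OF c(1-4), of "b m"] by simp
  then show ?case
    using "2.IH" c rest "2.prems"(2) by simp
qed simp

text \<open>The 27 vectors lowered from \<open>x\<close> have distinct grades and thus form a basis,
  on which all generators can be computed: lowering by construction and by the commuting squares,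
  raising by the sl2 relations, and zero wherever the new grade is absent.\<close>

lemma cubic_pair_minuscule:
  fixes dU dL :: "'n cubic"
  assumes d: "d_tensors generated dU dL" and card: "CARD('n) = 27"
    and x: "x \<noteq> 0" "is_weight_vector (\<lambda>j. of_int ([1, 0, 0, 0, 0, 0] ! j)) x"
  shows "cubic_pair (tensor dU) (tensor dL) (1 / (of_nat 8 + 2))"
proof -
  obtain ws where ws: "descend [[1, 0, 0, 0, 0, 0]] steps_1 = Some ws" "map grade ws = e6_weights"
    and one: "list_all (\<lambda>(s, k, l, c). s < 6 \<and> c = 1 \<and> ws ! k ! s = 1) e6_arrows"
    using e6_nodes by (auto split: option.splits)
  have len: "length ws = 27"
    using arg_cong[OF ws(2), of length] e6_weights_distinct(1) by simp
  have "\<exists>ys'. length ys' = length ws \<and> length ws = length [[1, 0, 0, 0, 0, 0 :: int]] + length steps_1 \<and>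
    (\<forall>k<length ws. length (ws ! k) = 6 \<and> ys' ! k \<noteq> 0 \<and> is_weight_vector (\<lambda>j. of_int (ws ! k ! j + 0)) (ys' ! k)) \<and>
    (\<forall>k<length [[1, 0, 0, 0, 0, 0 :: int]]. ys' ! k = [x] ! k) \<and>
    (\<forall>i<length steps_1. ys' ! (length [[1, 0, 0, 0, 0, 0 :: int]] + i) = lowering (snd (steps_1 ! i)) *v ys' ! fst (steps_1 ! i))"
    by (rule descend_vectors[OF ws(1)]) (use x in simp_all)
  then obtain ys where ys: "\<forall>k<27. length (ws ! k) = 6 \<and> ys ! k \<noteq> 0 \<and> is_weight_vector (\<lambda>j. of_int (ws ! k ! j)) (ys ! k)"
    and steps: "\<forall>i<length steps_1. ys ! Suc i = lowering (snd (steps_1 ! i)) *v ys ! fst (steps_1 ! i)"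
    unfolding len by auto
  define b where "b k = ys ! k" for k
  have b: "b k \<noteq> 0" "grading_op *v b k = of_int (e6_weights ! k) *s b k"
    and wt: "s < 6 \<Longrightarrow> coroot s *v b k = of_int (ws ! k ! s) *s b k" if "k < 27" for k s
  proof -
    show "b k \<noteq> 0" using ys that by (simp add: b_def)
    have "grade (ws ! k) = e6_weights ! k"
      using ws(2) len that by (metis nth_map)
    then show "grading_op *v b k = of_int (e6_weights ! k) *s b k"
      using grading_op_weight[of "\<lambda>j. of_int (ws ! k ! j)" "b k"] ys that
      by (simp add: b_def grade_eq_sum flip: of_int_mult of_int_sum)
    show "s < 6 \<Longrightarrow> coroot s *v b k = of_int (ws ! k ! s) *s b k"
      using ys that by (simp add: b_def is_weight_vector_def)
  qed
  \<comment> \<open>A nonzero \<open>y\<close> would contribute a 28th eigenvalue in dimension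
    27.\<close>
  have absent: "y = 0" if "grading_op *v y = of_int e *s y" "e \<notin> set e6_weights" for y e
  proof (rule ccontr)
    assume "y \<noteq> 0"
    define b' where "b' k = (if k < 27 then b k else y)" for k
    define \<nu> where "\<nu> k = (if k < 27 then e6_weights ! k else e)" for k
    have "inj_on \<nu> {..27}"
      using e6_weights_distinct that(2) by (auto simp: inj_on_def \<nu>_def nth_eq_iff_index_eq dest: nth_mem split: if_splits)
    then have "card {..27 :: nat} \<le> CARD('n)"
      by (intro eigenvectors_card_le[of _ grading_op b' "\<lambda>k. of_int (\<nu> k)"])
        (use b \<open>y \<noteq> 0\<close> that(1) in \<open>auto simp: b'_def \<nu>_def inj_on_def\<close>)
    then show False using card by simp
  qed
  have tree: "\<forall>(s, k, l)\<in>set e6_tree. lowering s *v b k = b l"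
    using steps by (auto simp: e6_tree_def in_set_enumerate_eq b_def)
  obtain known where "complete_squares e6_tree e6_squares = Some known"
    and known: "list_all (\<lambda>(s, k, l, c). List.member known (s, k, l)) e6_arrows"
    using e6_arrows_known by (auto split: option.splits)
  from complete_squares_sound[OF this(1) tree]
  have edges: "lowering s *v b k = b l" if "(s, k, l, c) \<in> set e6_arrows" for s k l c
    using known that by (fastforce simp: list_all_iff)
  have edge: "c = 1 \<and> s < 6 \<and> ws ! k ! s = 1 \<and> k < 27 \<and> l < 27 \<and> e6_weights ! k + grading_steps ! s \<notin> set e6_weights"
    if "(s, k, l, c) \<in> set e6_arrows" for s k l c
    using one e6_arrows_no_string e6_arrows_bounded that unfolding list_all_iff by fastforce
  have low: "grading_op *v (lowering s *v b k) = of_int (e6_weights ! k - grading_steps ! s) *s (lowering s *v b k)"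
    "grading_op *v (raising s *v b k) = of_int (e6_weights ! k + grading_steps ! s) *s (raising s *v b k)"
    if "s < 6" "k < 27" for s k
    using grading_op_lowering[OF that(1), of "b k"] grading_op_raising[OF that(1), of "b k"] b(2)[OF that(2)]
    by (simp_all add: vec.scale vec.scale_left_distrib vec.scale_left_diff_distrib)
  have checks: "(edge_terms e6_arrows s k = [] \<longrightarrow> e6_weights ! k - grading_steps ! s \<notin> set e6_weights)
    \<and> (edge_terms (reverse_edges e6_arrows) s k = [] \<longrightarrow> e6_weights ! k + grading_steps ! s \<notin> set e6_weights)
    \<and> length (edge_terms e6_arrows s k) \<le> 1 \<and> length (edge_terms (reverse_edges e6_arrows) s k) \<le> 1" if "s < 6" "k < 27" for s k
    using e6_non_edges that unfolding list_all_iff by auto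
  show ?thesis
  proof (rule cubic_pair_of_weight_basis[where b = b and h = grading_op and F = lowering and E = raising and N = 27 and r = 6
        and nus = e6_weights and DL = e6_arrows and DU = e6_arrows, OF d])
    show "lowering s *v b k = (\<Sum>(l, c)\<leftarrow>edge_terms e6_arrows s k. of_int c *s b l)" if "s < 6" "k < 27" for s k
    proof (cases "edge_terms e6_arrows s k")
      case Nil
      then show ?thesis
        using absent[OF low(1)[OF that]] checks[OF that] by simp
    next
      case (Cons e es)
      obtain l c where e: "e = (l, c)" by (cases e)
      have "es = []" using Cons checks[OF that] by simp
      moreover have "(l, c) \<in> set (edge_terms e6_arrows s k)" using Cons e by simp
      then have "(s, k, l, c) \<in> set e6_arrows" by (auto simp: edge_terms_def)
      ultimately show ?thesis
        using edges[of s k l c] edge[of s k l c] by (simp add: Cons e)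
    qed
    show "raising s *v b k = (\<Sum>(l, c)\<leftarrow>edge_terms (reverse_edges e6_arrows) s k. of_int c *s b l)" if "s < 6" "k < 27" for s k
    proof (cases "edge_terms (reverse_edges e6_arrows) s k")
      case Nil
      then show ?thesis
        using absent[OF low(2)[OF that]] checks[OF that] by simp
    next
      case (Cons e es)
      obtain l c where e: "e = (l, c)" by (cases e)
      have "es = []" using Cons checks[OF that] by simp
      have "(l, c) \<in> set (edge_terms (reverse_edges e6_arrows) s k)" using Cons e by simp
      then have mem: "(s, l, k, c) \<in> set e6_arrows" by (auto simp: edge_terms_def reverse_edges_def)
      note ed = edge[OF mem]
      \<comment> \<open>Since \<open>b k\<close> is \<open>lowering s *v b l\<close>, the commutator
        of raising and lowering leaves the coroot, with value 1, acting on
        \<open>b l\<close>.\<close>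
      have "raising s *v b l = 0"
        using absent[OF low(2)[OF that(1), of l]] ed by simp
      then have "raising s *v b k = b l"
        using raising_lowering[OF that(1,1), of "b l"] edges[OF mem] wt[of l s] ed by simp
      then show ?thesis using ed \<open>es = []\<close> by (simp add: Cons e)
    qed
  qed (rule b e6_weights_distinct generated_mem grading_op_generated e6_arrows_bounded e6_covers e6_determines
      e6_cubic_base e6_adjoint | assumption | simp add: card)+
qed

text \<open>All generators kill \<open>x\<close>, and with them the whole generated Lie algebra. So
  the line through \<open>x\<close> is invariant and, by irreducibility, the entire space.\<close>

lemma trivial_highest_weight_impossible:
  assumes irr: "irreducible_action generated" and card: "CARD('n) > 1"
    and x: "x \<noteq> 0" "is_weight_vector (\<lambda>_. 0) x" "\<And>s. s < 6 \<Longrightarrow> raising s *v x = 0"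
  shows False
proof -
  have co: "coroot s *v x = 0" if "s < 6" for s
    using x(2) that by (simp add: is_weight_vector_def)
  \<comment> \<open>Otherwise the lowered vector would be killed by \<open>raising s\<close> while
    its own coroot has the value -2, which is not a natural number.\<close>
  have lo: "lowering s *v x = 0" if s: "s < 6" for s
  proof (rule ccontr)
    assume nz: "lowering s *v x \<noteq> 0"
    have "is_weight_vector (\<lambda>j. - of_int (e6_rows ! s ! j)) (lowering s *v x)"
      using is_weight_vector_lowering[OF x(2) s] by simp
    moreover have "raising s *v (lowering s *v x) = 0"
      using raising_lowering[OF s s, of x] x(3)[OF s] co[OF s] by simp
    ultimately obtain n where "- of_int (e6_rows ! s ! s) = (of_nat n :: complex)"
      using highest_weight_natural[OF _ nz s] by blast
    moreover have "\<forall>s<6. e6_rows ! s ! s = 2" by (simp add: all_less_numeral e6_rows_def)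
    ultimately have "of_int (- 2) = (of_int (int n) :: complex)" using s by simp
    then have "- 2 = int n" by (simp only: of_int_eq_iff)
    then show False by simp
  qed
  have kill: "X *v x = 0" if "X \<in> generated" for X
    using that unfolding generated_def
  proof (induction rule: lie_generated.induct)
    case (generator X)
    then obtain i where i: "i \<in> {1..6}" "X = E i \<or> X = F i \<or> X = H i" by auto
    then obtain s where "i = Suc s" "s < 6" by (cases i) auto
    then show ?case
      using i(2) co[of s] lo[of s] x(3)[of s] by (auto simp: coroot_def lowering_def raising_def)
  next
    case (bracket X Y)
    then show ?case
      by (simp add: lie_bracket_def matrix_vector_mult_diff_rdistrib flip: matrix_vector_mul_assoc)
  qed (simp_all add: matrix_vector_mult_add_rdistrib smult_mat_mult_vec)
  have "vec.subspace (vec.span {x})" by (rule vec.subspace_span)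
  moreover have "\<forall>X\<in>generated. \<forall>y\<in>vec.span {x}. X *v y \<in> vec.span {x}"
    using kill by (auto simp: vec.span_singleton vec.scale intro: exI[of _ 0])
  ultimately have "vec.span {x} = {0} \<or> vec.span {x} = UNIV"
    using irr unfolding irreducible_action_def by blast
  moreover have "x \<in> vec.span {x}" by (rule vec.span_base) simp
  ultimately have "vec.span {x} = UNIV" using x(1) by auto
  then have "vec.dim (UNIV :: (complex^'n) set) \<le> card {x}"
    by (intro vec.dim_le_card) auto
  then show False using card by (simp add: vec.dim_UNIV card_cart_basis)
qed

lemma weights_bound_27:
  assumes "CARD('n) = 27" "x \<noteq> 0" "is_weight_vector (\<lambda>j. of_nat (l j)) x" "length w = 6"
    and "case descend [w] st of None \<Rightarrow> False | Some ws \<Rightarrow> length ws = 28 \<and> distinct (map grade ws)"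
  shows "\<exists>j<6. int (l j) < w ! j"
proof (rule ccontr)
  assume "\<not> ?thesis"
  then have "w ! j \<le> int (l j)" if "j < 6" for j
    using that by (meson not_less)
  from weights_bound[OF assms(2,3,4) this assms(5)] show False
    using assms(1) by simp
qed

text \<open>A highest weight has natural coordinates. Unless it is 0 or one of the two end weights,
  it dominates one of seven weights: a fundamental weight with number 2, 3, 4 or 5, the sum of those
  with numbers 1 and 6, or the double of either of these two.\<close>

lemma fundamental_weight_vector_exists:
  assumes irr: "irreducible_action generated" and card: "CARD('n) = 27"
  obtains x where "x \<noteq> 0" "is_weight_vector (\<lambda>j. of_int ([1, 0, 0, 0, 0, 0] ! j)) x \<or> is_weight_vector (\<lambda>j. of_int ([0, 0, 0, 0, 0, 1] ! j)) x"
proof -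
  obtain x \<mu> where x: "x \<noteq> 0" "is_weight_vector \<mu> x" "\<And>s. s < 6 \<Longrightarrow> raising s *v x = 0"
    using highest_weight_vector_exists by blast
  have "\<forall>s. \<exists>n. s < 6 \<longrightarrow> \<mu> s = of_nat n"
    using highest_weight_natural[OF x(2,1) _ x(3)] by blast
  from choice[OF this] obtain l where l: "\<forall>s. s < 6 \<longrightarrow> \<mu> s = of_nat (l s)" ..
  then have wt: "is_weight_vector (\<lambda>j. of_nat (l j)) x"
    using x(2) by (simp add: is_weight_vector_def)
  note bound = weights_bound_27[OF card x(1) wt]
  have "\<exists>j<6. int (l j) < [0, 1, 0, 0, 0, 0] ! j" by (rule bound[where st = steps_2]) (simp, code_simp)
  then have l1: "l 1 = 0" unfolding ex_less_6 by simp
  have "\<exists>j<6. int (l j) < [0, 0, 1, 0, 0, 0] ! j" by (rule bound[where st = steps_3]) (simp, code_simp)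
  then have l2: "l 2 = 0" unfolding ex_less_6 by simp
  have "\<exists>j<6. int (l j) < [0, 0, 0, 1, 0, 0] ! j" by (rule bound[where st = steps_4]) (simp, code_simp)
  then have l3: "l 3 = 0" unfolding ex_less_6 by simp
  have "\<exists>j<6. int (l j) < [0, 0, 0, 0, 1, 0] ! j" by (rule bound[where st = steps_5]) (simp, code_simp)
  then have l4: "l 4 = 0" unfolding ex_less_6 by simp
  have "\<exists>j<6. int (l j) < [1, 0, 0, 0, 0, 1] ! j" by (rule bound[where st = steps_16]) (simp, code_simp)
  then have l05: "l 0 = 0 \<or> l 5 = 0" unfolding ex_less_6 by simp
  have "\<exists>j<6. int (l j) < [2, 0, 0, 0, 0, 0] ! j" by (rule bound[where st = steps_11]) (simp, code_simp)
  then have l0: "l 0 < 2" unfolding ex_less_6 by simp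
  have "\<exists>j<6. int (l j) < [0, 0, 0, 0, 0, 2] ! j" by (rule bound[where st = steps_66]) (simp, code_simp)
  then have l5: "l 5 < 2" unfolding ex_less_6 by simp
  consider "l 0 = 0" "l 5 = 0" | "l 0 = 1" "l 5 = 0" | "l 0 = 0" "l 5 = 1"
    using l05 l0 l5 by linarith
  then show thesis
  proof cases
    case 1
    then have "is_weight_vector (\<lambda>_. 0) x"
      using wt l1 l2 l3 l4 unfolding is_weight_vector_def all_less_6 by simp
    then show ?thesis
      using trivial_highest_weight_impossible[OF irr _ x(1) _ x(3)] card by simp
  next
    case 2
    then have "is_weight_vector (\<lambda>j. of_int ([1, 0, 0, 0, 0, 0] ! j)) x"
      using wt l1 l2 l3 l4 unfolding is_weight_vector_def all_less_6 by simp
    then show ?thesis using that x(1) by blast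
  next
    case 3
    then have "is_weight_vector (\<lambda>j. of_int ([0, 0, 0, 0, 0, 1] ! j)) x"
      using wt l1 l2 l3 l4 unfolding is_weight_vector_def all_less_6 by simp
    then show ?thesis using that x(1) by blast
  qed
qed

end

section \<open>The diagram automorphism and the case m = 8\<close>

definition diagram_flip :: "nat \<Rightarrow> nat"
  where "diagram_flip i = (if i = 1 then 6 else if i = 6 then 1 else if i = 3 then 5 else if i = 5 then 3 else i)"

lemma diagram_flip:
  "i \<in> {1..6} \<Longrightarrow> diagram_flip i \<in> {1..6}" "diagram_flip (diagram_flip i) = i"
  "i \<in> {1..6} \<Longrightarrow> j \<in> {1..6} \<Longrightarrow> e6_cartan (diagram_flip i) (diagram_flip j) = e6_cartan i j"
proof -
  show "i \<in> {1..6} \<Longrightarrow> diagram_flip i \<in> {1..6}" "diagram_flip (diagram_flip i) = i"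
    by (auto simp: diagram_flip_def)
  have s: "{1..6} = {1, 2, 3, 4, 5, 6 :: nat}" by auto
  have "\<forall>i\<in>{1..6}. \<forall>j\<in>{1..6}. e6_cartan (diagram_flip i) (diagram_flip j) = e6_cartan i j"
    unfolding s by (simp add: diagram_flip_def e6_cartan_def e6_edges_def doubleton_eq_iff)
  then show "i \<in> {1..6} \<Longrightarrow> j \<in> {1..6} \<Longrightarrow> e6_cartan (diagram_flip i) (diagram_flip j) = e6_cartan i j"
    by blast
qed

lemma e6_rep_flip:
  assumes "e6_rep E F H"
  shows "e6_rep (E \<circ> diagram_flip) (F \<circ> diagram_flip) (H \<circ> diagram_flip)"
proof
  have inj: "diagram_flip i = diagram_flip j \<longleftrightarrow> i = j" for i j
    by (metis diagram_flip(2))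
  show "e6_relations (E \<circ> diagram_flip) (F \<circ> diagram_flip) (H \<circ> diagram_flip)"
    unfolding e6_relations_def comp_def
  proof (intro ballI)
    fix i j :: nat assume "i \<in> {1..6}" "j \<in> {1..6}"
    note ij = this
    note r = assms[unfolded e6_rep_def e6_relations_def, rule_format, OF diagram_flip(1)[OF ij(1)] diagram_flip(1)[OF ij(2)],
        unfolded inj diagram_flip(3)[OF ij]]
    show "lie_bracket (H (diagram_flip i)) (H (diagram_flip j)) = 0 \<and>
      lie_bracket (H (diagram_flip i)) (E (diagram_flip j)) = of_int (e6_cartan i j) *\<^sub>m E (diagram_flip j) \<and>
      lie_bracket (H (diagram_flip i)) (F (diagram_flip j)) = - (of_int (e6_cartan i j) *\<^sub>m F (diagram_flip j)) \<and>
      lie_bracket (E (diagram_flip i)) (F (diagram_flip j)) = (if i = j then H (diagram_flip i) else 0) \<and>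
      (i \<noteq> j \<longrightarrow>
        (lie_bracket (E (diagram_flip i)) ^^ nat (1 - e6_cartan i j)) (E (diagram_flip j)) = 0 \<and>
        (lie_bracket (F (diagram_flip i)) ^^ nat (1 - e6_cartan i j)) (F (diagram_flip j)) = 0)"
      by (rule r)
  qed
qed

lemma cubic_pair_e6:
  fixes dU dL :: "'n::finite cubic"
  assumes rel: "e6_relations E F H" and L: "L = lie_generated (\<Union>i\<in>{1..6}. {E i, F i, H i})"
    and irr: "irreducible_action L" and d: "d_tensors L dU dL" and card: "CARD('n) = 27"
  shows "cubic_pair (tensor dU) (tensor dL) (1 / (of_nat 8 + 2))"
proof -
  interpret e6_rep E F H by unfold_locales (rule rel)
  interpret flip: e6_rep "E \<circ> diagram_flip" "F \<circ> diagram_flip" "H \<circ> diagram_flip"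
    by (rule e6_rep_flip) unfold_locales
  have gen: "L = generated" by (simp add: L generated_def)
  \<comment> \<open>Relabelling permutes the generators, so the generated Lie algebra and with it
    the invariant tensors stay the same, while a weight vector of the last fundamental weight
    becomes one of the first.\<close>
  have "(\<Union>i\<in>{1..6}. {E (diagram_flip i), F (diagram_flip i), H (diagram_flip i)}) = (\<Union>i\<in>{1..6}. {E i, F i, H i})"
  proof -
    have "{1..6} = {1, 2, 3, 4, 5, 6 :: nat}" by auto
    then have "diagram_flip ` {1..6} = {1..6}"
      by (simp add: diagram_flip_def) auto
    moreover have "(\<Union>i\<in>{1..6}. {E (diagram_flip i), F (diagram_flip i), H (diagram_flip i)})
      = (\<Union>i\<in>diagram_flip ` {1..6}. {E i, F i, H i})"
      by (simp only: image_image)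
    ultimately show ?thesis by simp
  qed
  then have gen': "L = flip.generated" by (simp add: L flip.generated_def)
  obtain x where x: "x \<noteq> 0" "is_weight_vector (\<lambda>j. of_int ([1, 0, 0, 0, 0, 0] ! j)) x \<or> is_weight_vector (\<lambda>j. of_int ([0, 0, 0, 0, 0, 1] ! j)) x"
    using fundamental_weight_vector_exists irr card unfolding gen by blast
  from x(2) show ?thesis
  proof
    assume "is_weight_vector (\<lambda>j. of_int ([1, 0, 0, 0, 0, 0] ! j)) x"
    with d card x(1) show ?thesis unfolding gen by (rule cubic_pair_minuscule)
  next
    assume w: "is_weight_vector (\<lambda>j. of_int ([0, 0, 0, 0, 0, 1] ! j)) x"
    have "flip.is_weight_vector (\<lambda>j. of_int ([1, 0, 0, 0, 0, 0] ! j)) x"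
      using w unfolding is_weight_vector_def flip.is_weight_vector_def all_less_6
      by (simp add: coroot_def flip.coroot_def diagram_flip_def eval_nat_numeral)
    with d card x(1) show ?thesis unfolding gen' by (rule flip.cubic_pair_minuscule)
  qed
qed

theorem corollary4p12:
  fixes m :: nat
    and L :: "(complex^'n^'n) set"
    and dU dL :: "'n::finite cubic"
  assumes "m \<in> {1, 2, 4, 8}"
    and "e6_series m L"
    and "d_tensors L dU dL"
  shows "(\<forall>u. u \<notin> {of_nat m, of_nat m + 4, 3 * of_nat m} \<longrightarrow>
            ((u - of_nat m - 4) / (u - of_nat m)) *\<^sub>m R_mixed m dU dL u = R_mixed_rescaled m dU dL u)
       \<and> (\<forall>u v. u \<notin> {of_nat m + 4, 3 * of_nat m} \<and> u + v \<notin> {of_nat m + 4, 3 * of_nat m}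
              \<and> v \<noteq> 2 * of_nat m \<longrightarrow>
            yang_baxter_mixed (R_mixed m dU dL) (R_VV m dU dL) u v)
       \<and> (\<forall>u v. u \<notin> {of_nat m, 3 * of_nat m} \<and> u + v \<notin> {of_nat m, 3 * of_nat m}
              \<and> v \<noteq> 2 * of_nat m \<longrightarrow>
            yang_baxter_mixed (R_mixed_rescaled m dU dL) (R_VV m dU dL) u v)"
proof (rule corollary_of_cubic_pair)
  have card: "CARD('n) = 3 * m + 3" using assms(2) unfolding e6_series_def by blast
  have "m = 1 \<and> (\<exists>e :: 'n \<Rightarrow> complex^(3 \<times> 3). is_basis e sym2 \<and>
        L = operator_matrices e {tensor_act X X | X. X \<in> sl}) \<or>
     m = 2 \<and> (\<exists>e :: 'n \<Rightarrow> complex^(3 \<times> 3). is_basis e UNIV \<and>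
        L = operator_matrices e {tensor_act X Y | X Y. X \<in> sl \<and> Y \<in> sl}) \<or>
     m = 4 \<and> (\<exists>e :: 'n \<Rightarrow> complex^(6 \<times> 6). is_basis e ext2 \<and>
        L = operator_matrices e {tensor_act X X | X. X \<in> sl}) \<or>
     m = 8 \<and> (\<exists>E F H. e6_relations E F H \<and>
        L = lie_generated (\<Union>i\<in>{1..6}. {E i, F i, H i}) \<and> irreducible_action L)"
    using assms(2) unfolding e6_series_def by blast
  then show "cubic_pair (tensor dU) (tensor dL) (1 / (of_nat m + 2))"
  proof (elim disjE conjE exE)
    fix e :: "'n \<Rightarrow> complex^(3 \<times> 3)"
    assume "m = 1" "is_basis e sym2" "L = operator_matrices e {tensor_act X X | X. X \<in> sl}"
    then show ?thesis using cubic_pair_sym2[of e dU dL] assms(3) card by simp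
  next
    fix e :: "'n \<Rightarrow> complex^(3 \<times> 3)"
    assume "m = 2" "is_basis e UNIV" "L = operator_matrices e {tensor_act X Y | X Y. X \<in> sl \<and> Y \<in> sl}"
    then show ?thesis using cubic_pair_bivector[of e dU dL] assms(3) card by simp
  next
    fix e :: "'n \<Rightarrow> complex^(6 \<times> 6)"
    assume "m = 4" "is_basis e ext2" "L = operator_matrices e {tensor_act X X | X. X \<in> sl}"
    then show ?thesis using cubic_pair_ext2[of e dU dL] assms(3) card by simp
  next
    fix E F H :: "nat \<Rightarrow> complex^'n^'n"
    assume "m = 8" "e6_relations E F H" "L = lie_generated (\<Union>i\<in>{1..6}. {E i, F i, H i})" "irreducible_action L"
    then show ?thesis using cubic_pair_e6[of E F H L dU dL] assms(3) card by simp
  qed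
qed

end
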